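(* Let $C_f>0$, let $u$ be the solution of $-\varepsilon^2\triangle u+f(x,y;u)=0$ in $\Omega$, $u=0$ on $\partial\Omega$, and let $u_h\in S_h$ be arbitrary, with $f_h(\cdot):=f(\cdot;u_h)$. Let $\boldsymbol\tau$ be a vector field on $\Omega$ such that $\boldsymbol\tau\in H^1(\mathrm{div},T)$ for all $T\in\mathcal T$ and $$[\boldsymbol\tau\cdot\boldsymbol\nu]=[\partial_{\boldsymbol\nu}u_h]\qquad\text{on all edges } S\in\mathcal S\setminus\partial\Omega .$$ Then $$|||u_h-u|||_{\varepsilon;\Omega}\le\mathcal E:=\Bigl\{\|\varepsilon\boldsymbol\tau\|_\Omega^2+C_f^{-1}\|\varepsilon^2\,\mathrm{div}\,\boldsymbol\tau+f_h\|_\Omega^2\Bigr\}^{1/2},$$ where $\mathrm{div}\,\boldsymbol\tau$ is understood elementwise (as a function on $\Omega$ defined triangle by triangle).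
   Context: Problem. $\Omega\subset\mathbb R^2$ is a (possibly non-Lipschitz) polygonal domain, $0<\varepsilon\le1$. $f$ is continuous on $\Omega\times\mathbb R$, $f(\cdot;s)\in L_\infty(\Omega)$ for all $s\in\mathbb R$, and $f(x,y;u)-f(x,y;v)\ge C_f[u-v]$ whenever $u\ge v$, with a constant $C_f\ge0$; also $C_f+\varepsilon^2\ge1$. Under these conditions there is a unique solution $u\in W^2_\ell(\Omega)\subseteq W^1_q(\Omega)\subset C(\bar\Omega)$ for some $\ell>1$, $q>2$. Notation. $\|\cdot\|_{\mathcal D}$ is the $L_2(\mathcal D)$ norm; $|||v|||_{\varepsilon;\Omega}:=\{\varepsilon^2\|\nabla v\|_\Omega^2+C_f\|v\|_\Omega^2\}^{1/2}$. $\mathcal T$ is a triangulation of $\Omega$ with the set of edges $\mathcal S$; $S_h\subset H^1_0(\Omega)\cap C(\bar\Omega)$ is the space of continuous piecewise-linear functions on $\mathcal T$ vanishing on $\partial\Omega$. $H^1(\mathrm{div},T)$ denotes vector fields in $L_2(T)^2$ with divergence in $L_2(T)$. For triangles $T,T'$ sharing an edge, $[\boldsymbol\tau\cdot\boldsymbol\nu]_{\partial T\cap\partial T'}:=\boldsymbol\tau\cdot\boldsymbol\nu|_T+\boldsymbol\tau\cdot\boldsymbol\nu|_{T'}$, where in each term $\boldsymbol\nu$ is the outward unit normal of the respective triangle, and $[\partial_{\boldsymbol\nu}u_h]:=[\nabla u_h\cdot\boldsymbol\nu]$ (normal traces are understood in the usual sense). *)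

theory Defs
  imports "HOL-Analysis.Analysis"
begin

type_synonym plane = "real^2"

section \<open>Lebesgue spaces\<close>

definition Lp_on :: "real \<Rightarrow> plane set \<Rightarrow> (plane \<Rightarrow> 'b::euclidean_space) \<Rightarrow> bool" where
  "Lp_on p U v \<longleftrightarrow> v \<in> borel_measurable (lebesgue_on U) \<and>
     integrable (lebesgue_on U) (\<lambda>x. norm (v x) powr p)"

definition Linf_on :: "plane set \<Rightarrow> (plane \<Rightarrow> 'b::euclidean_space) \<Rightarrow> bool" where
  "Linf_on U v \<longleftrightarrow> v \<in> borel_measurable (lebesgue_on U) \<and>
     (\<exists>M. AE x in lebesgue_on U. norm (v x) \<le> M)"

definition L2_norm :: "plane set \<Rightarrow> (plane \<Rightarrow> 'b::euclidean_space) \<Rightarrow> real" where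
  "L2_norm U v = sqrt (LINT x|lebesgue_on U. (norm (v x))\<^sup>2)"

definition loc_integrable_on :: "plane set \<Rightarrow> (plane \<Rightarrow> 'b::euclidean_space) \<Rightarrow> bool" where
  "loc_integrable_on U v \<longleftrightarrow> (\<forall>K. compact K \<and> K \<subseteq> U \<longrightarrow> integrable (lebesgue_on K) v)"

section \<open>Test functions and weak derivatives\<close>

definition grad :: "(plane \<Rightarrow> real) \<Rightarrow> plane \<Rightarrow> plane" where
  "grad \<phi> x = (\<chi> i. frechet_derivative \<phi> (at x) (axis i 1))"

fun times_cont_diff :: "nat \<Rightarrow> (plane \<Rightarrow> real) \<Rightarrow> bool" where
  "times_cont_diff 0 \<phi> \<longleftrightarrow> continuous_on UNIV \<phi>"
| "times_cont_diff (Suc k) \<phi> \<longleftrightarrow>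
     \<phi> differentiable_on UNIV \<and> (\<forall>i. times_cont_diff k (\<lambda>x. grad \<phi> x $ i))"

definition fun_support :: "(plane \<Rightarrow> real) \<Rightarrow> plane set" where
  "fun_support \<phi> = closure {x. \<phi> x \<noteq> 0}"

text \<open>The space \<open>C\<^sub>c\<^sup>\<infinity>(U)\<close>; its elements are extended by zero to the whole plane.\<close>

definition test_fun :: "plane set \<Rightarrow> (plane \<Rightarrow> real) set" where
  "test_fun U = {\<phi>. (\<forall>k. times_cont_diff k \<phi>) \<and> compact (fun_support \<phi>) \<and> fun_support \<phi> \<subseteq> U}"

definition has_weak_grad :: "plane set \<Rightarrow> (plane \<Rightarrow> real) \<Rightarrow> (plane \<Rightarrow> plane) \<Rightarrow> bool" where
  "has_weak_grad U v g \<longleftrightarrow> loc_integrable_on U v \<and> loc_integrable_on U g \<and>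
     (\<forall>\<phi>\<in>test_fun U. (LINT x|lebesgue_on U. v x *\<^sub>R grad \<phi> x) = - (LINT x|lebesgue_on U. \<phi> x *\<^sub>R g x))"

definition has_weak_div :: "plane set \<Rightarrow> (plane \<Rightarrow> plane) \<Rightarrow> (plane \<Rightarrow> real) \<Rightarrow> bool" where
  "has_weak_div U \<tau> d \<longleftrightarrow> loc_integrable_on U \<tau> \<and> loc_integrable_on U d \<and>
     (\<forall>\<phi>\<in>test_fun U. (LINT x|lebesgue_on U. \<tau> x \<bullet> grad \<phi> x) = - (LINT x|lebesgue_on U. \<phi> x * d x))"

text \<open>Weak derivatives are unique only almost everywhere, so the operators pick a representative.
  They are unspecified if no weak derivative exists; the spaces below require existence.\<close>

definition weak_grad :: "plane set \<Rightarrow> (plane \<Rightarrow> real) \<Rightarrow> plane \<Rightarrow> plane" where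
  "weak_grad U v = (SOME g. has_weak_grad U v g)"

definition weak_div :: "plane set \<Rightarrow> (plane \<Rightarrow> plane) \<Rightarrow> plane \<Rightarrow> real" where
  "weak_div U \<tau> = (SOME d. has_weak_div U \<tau> d)"

definition weak_laplacian :: "plane set \<Rightarrow> (plane \<Rightarrow> real) \<Rightarrow> plane \<Rightarrow> real" where
  "weak_laplacian U v x = (\<Sum>i\<in>UNIV. weak_grad U (\<lambda>y. weak_grad U v y $ i) x $ i)"

section \<open>Sobolev spaces\<close>

definition W1_on :: "real \<Rightarrow> plane set \<Rightarrow> (plane \<Rightarrow> real) \<Rightarrow> bool" where
  "W1_on p U v \<longleftrightarrow> Lp_on p U v \<and> (\<exists>g. has_weak_grad U v g \<and> Lp_on p U g)"

definition W2_on :: "real \<Rightarrow> plane set \<Rightarrow> (plane \<Rightarrow> real) \<Rightarrow> bool" where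
  "W2_on p U v \<longleftrightarrow> W1_on p U v \<and> (\<forall>i. W1_on p U (\<lambda>x. weak_grad U v x $ i))"

text \<open>The space \<open>H\<^sup>1\<^sub>0(U)\<close> is the closure of the test functions in \<open>H\<^sup>1(U)\<close>.\<close>

definition H10_on :: "plane set \<Rightarrow> (plane \<Rightarrow> real) \<Rightarrow> bool" where
  "H10_on U v \<longleftrightarrow> W1_on 2 U v \<and>
     (\<exists>\<phi>. (\<forall>n::nat. \<phi> n \<in> test_fun U) \<and>
          (\<lambda>n. L2_norm U (\<lambda>x. \<phi> n x - v x)) \<longlonglongrightarrow> 0 \<and>
          (\<lambda>n. L2_norm U (\<lambda>x. grad (\<phi> n) x - weak_grad U v x)) \<longlonglongrightarrow> 0)"

definition Hdiv_on :: "plane set \<Rightarrow> (plane \<Rightarrow> plane) \<Rightarrow> bool" where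
  "Hdiv_on U \<tau> \<longleftrightarrow> Lp_on 2 U \<tau> \<and> (\<exists>d. has_weak_div U \<tau> d \<and> Lp_on 2 U d)"

definition energy_norm :: "real \<Rightarrow> real \<Rightarrow> plane set \<Rightarrow> (plane \<Rightarrow> real) \<Rightarrow> real" where
  "energy_norm \<epsilon> C U v = sqrt (\<epsilon>\<^sup>2 * (L2_norm U (weak_grad U v))\<^sup>2 + C * (L2_norm U v)\<^sup>2)"

section \<open>Polygonal domains and triangulations\<close>

text \<open>The domain need not lie on one side of its boundary (cracks are allowed) and need not be
  simply connected.\<close>

definition polygonal_domain :: "plane set \<Rightarrow> bool" where
  "polygonal_domain \<Omega> \<longleftrightarrow> \<Omega> \<noteq> {} \<and> open \<Omega> \<and> connected \<Omega> \<and> bounded \<Omega> \<and>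
     (\<exists>E. finite E \<and> (\<forall>(a, b)\<in>E. a \<noteq> b) \<and> frontier \<Omega> = (\<Union>(a, b)\<in>E. closed_segment a b))"

definition mesh_edges :: "plane set set \<Rightarrow> plane set set" where
  "mesh_edges \<T> = {S. \<exists>T\<in>\<T>. S edge_of T}"

text \<open>The last condition says that the boundary, including any crack, is made up of edges. It
  implies that each triangle has its interior in \<open>\<Omega>\<close>.\<close>

definition triangulation_of :: "plane set set \<Rightarrow> plane set \<Rightarrow> bool" where
  "triangulation_of \<T> \<Omega> \<longleftrightarrow> triangulation \<T> \<and> (\<forall>T\<in>\<T>. 2 simplex T) \<and> \<Union>\<T> = closure \<Omega> \<and>
     frontier \<Omega> = \<Union>{S \<in> mesh_edges \<T>. S \<subseteq> frontier \<Omega>}"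

definition fe_space :: "plane set \<Rightarrow> plane set set \<Rightarrow> (plane \<Rightarrow> real) set" where
  "fe_space \<Omega> \<T> = {v. H10_on \<Omega> v \<and> continuous_on (closure \<Omega>) v \<and> (\<forall>x\<in>frontier \<Omega>. v x = 0) \<and>
     (\<forall>T\<in>\<T>. \<exists>a b. \<forall>x\<in>T. v x = a \<bullet> x + b)}"

definition elementwise_div :: "plane set set \<Rightarrow> (plane \<Rightarrow> plane) \<Rightarrow> plane \<Rightarrow> real" where
  "elementwise_div \<T> \<tau> x = (\<Sum>T\<in>\<T>. indicator (interior T) x * weak_div (interior T) \<tau> x)"

section \<open>Normal traces\<close>

text \<open>The trace \<open>\<tau> \<cdot> \<nu>\<close> of a field in \<open>H\<^sup>1(div, T)\<close> on the boundary of the triangle \<open>T\<close>, with \<open>\<nu>\<close> the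
  outward normal, is the functional given by Green's formula
  \<open>\<langle>\<tau> \<cdot> \<nu>, \<phi>\<rangle> = \<integral>\<^sub>T \<tau> \<cdot> \<nabla>\<phi> + \<phi> div \<tau>\<close>.\<close>

definition normal_trace :: "plane set \<Rightarrow> (plane \<Rightarrow> plane) \<Rightarrow> (plane \<Rightarrow> real) \<Rightarrow> real" where
  "normal_trace T \<tau> \<phi> =
     (LINT x|lebesgue_on (interior T). \<tau> x \<bullet> grad \<phi> x + \<phi> x * weak_div (interior T) \<tau> x)"

definition normal_jump :: "plane set \<Rightarrow> plane set \<Rightarrow> (plane \<Rightarrow> plane) \<Rightarrow> (plane \<Rightarrow> real) \<Rightarrow> real" where
  "normal_jump T T' \<tau> \<phi> = normal_trace T \<tau> \<phi> + normal_trace T' \<tau> \<phi>"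

text \<open>The restriction of such a functional to an edge \<open>S\<close> is tested with functions that do not see the
  rest of the boundary of the triangle; on \<open>S\<close> these are the functions in \<open>C\<^sub>c\<^sup>\<infinity>\<close> of the open edge,
  which are dense in \<open>H\<^sup>1\<^sup>/\<^sup>2\<^sub>0\<^sub>0(S)\<close>.\<close>

definition edge_test_fun :: "plane set \<Rightarrow> plane set \<Rightarrow> (plane \<Rightarrow> real) set" where
  "edge_test_fun T S = {\<phi> \<in> test_fun UNIV. fun_support \<phi> \<inter> frontier T \<subseteq> rel_interior S}"

definition normal_jumps_agree_on ::
  "plane set \<Rightarrow> plane set set \<Rightarrow> (plane \<Rightarrow> plane) \<Rightarrow> (plane \<Rightarrow> plane) \<Rightarrow> bool" where
  "normal_jumps_agree_on S \<T> \<tau> \<sigma> \<longleftrightarrow>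
     (\<forall>T\<in>\<T>. \<forall>T'\<in>\<T>. T \<noteq> T' \<and> S edge_of T \<and> S edge_of T' \<longrightarrow>
        (\<forall>\<phi>\<in>edge_test_fun T S \<inter> edge_test_fun T' S. normal_jump T T' \<tau> \<phi> = normal_jump T T' \<sigma> \<phi>))"

section \<open>The boundary value problem\<close>

text \<open>The boundary condition \<open>u = 0\<close> holds in the sense of \<open>H\<^sup>1\<^sub>0\<close>, and hence pointwise for the
  continuous representative.\<close>

definition bvp_solution ::
  "plane set \<Rightarrow> real \<Rightarrow> (plane \<Rightarrow> real \<Rightarrow> real) \<Rightarrow> (plane \<Rightarrow> real) \<Rightarrow> bool" where
  "bvp_solution \<Omega> \<epsilon> f u \<longleftrightarrow>
     (\<exists>l>1. W2_on l \<Omega> u) \<and> (\<exists>q>2. W1_on q \<Omega> u) \<and> continuous_on (closure \<Omega>) u \<and>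
     (AE x in lebesgue_on \<Omega>. - \<epsilon>\<^sup>2 * weak_laplacian \<Omega> u x + f x (u x) = 0) \<and>
     H10_on \<Omega> u \<and> (\<forall>x\<in>frontier \<Omega>. u x = 0)"

end

theory Submission
  imports Defs
begin

text \<open>Write \<open>w = u\<^sub>h - u\<close> and test the equation with \<open>w\<close>, a limit of test functions. Monotonicity of \<open>f\<close> gives
  \<open>|||w|||\<^sup>2 \<le> \<epsilon>\<^sup>2 (\<nabla>u\<^sub>h, \<nabla>w) + (f\<^sub>h, w)\<close>. As \<open>\<nabla>u\<^sub>h\<close> is constant on each triangle and the normal jumps of \<open>\<tau>\<close>
  and \<open>\<nabla>u\<^sub>h\<close> agree, elementwise Green's formula turns \<open>(\<nabla>u\<^sub>h, \<nabla>w)\<close> into \<open>(\<tau>, \<nabla>w) + (div \<tau>, w)\<close>, and the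
  inequalities of Cauchy-Schwarz and Young conclude.

  The jump condition only concerns test functions supported near a single open edge. A smooth
  partition of unity handles all test functions vanishing near the vertices. A vertex is removable,
  because cutoffs at scale \<open>\<delta>\<close> around it have gradients bounded in \<open>L\<^sub>2\<close> uniformly in \<open>\<delta>\<close>, while the
  \<open>L\<^sub>2\<close> norm of \<open>\<tau> - \<nabla>u\<^sub>h\<close> on their supports tends to zero.\<close>

section \<open>Smooth functions and cutoffs\<close>

text \<open>The Laplacian of \<open>u\<close> lies only in some L_l with \<open>l > 1\<close>, so
  pairing it directly with \<open>w\<close> would call for a Sobolev embedding, and normal traces on
  edges are mere functionals. Hence every identity is proved for smooth compactly supported
  functions and arranged so that only square-integrable data are paired with the test function and
  its gradient; then both sides pass to the limit in H^1_0. The equation itself replaces the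
  Laplacian by a multiple of the nonlinear term at \<open>u\<close>, and that term is square
  integrable because monotonicity squeezes it between the values of \<open>f\<close> at two
  constants. The difference between the two sides of elementwise Green's formula for \<tau> minus
  the discrete gradient is treated as one functional on test functions. The jump condition makes it
  vanish off a finite set of points. Points can be removed because the plane has dimension two: a
  gradient of size 1/\<delta> on a disc of area proportional to \<delta>^2 has an L_2 norm that does
  not grow as \<delta> shrinks.\<close>

lemma plane_sum_axis: "(v::plane) = (\<Sum>i\<in>UNIV. v $ i *\<^sub>R axis i 1)"
  by (simp add: vec_eq_iff axis_def if_distrib sum.delta cong: if_cong)

lemma grad_has_derivative:
  assumes "\<phi> differentiable at x"
  shows "(\<phi> has_derivative (\<lambda>v. grad \<phi> x \<bullet> v)) (at x)"
proof -
  define D where "D = frechet_derivative \<phi> (at x)"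
  have D: "(\<phi> has_derivative D) (at x)"
    using assms by (simp add: D_def frechet_derivative_works)
  then have lin: "linear D" by (rule has_derivative_linear)
  have "D v = grad \<phi> x \<bullet> v" for v
  proof -
    have "D v = D (\<Sum>i\<in>UNIV. v $ i *\<^sub>R axis i 1)"
      using plane_sum_axis[of v] by simp
    also have "\<dots> = (\<Sum>i\<in>UNIV. v $ i * D (axis i 1))"
      using lin by (simp add: linear_sum linear_scale)
    also have "\<dots> = grad \<phi> x \<bullet> v"
      by (simp add: grad_def inner_vec_def D_def mult.commute)
    finally show ?thesis .
  qed
  then have "D = (\<lambda>v. grad \<phi> x \<bullet> v)" by auto
  with D show ?thesis by simp
qed

lemma grad_eqI:
  assumes "(\<phi> has_derivative (\<lambda>v. a \<bullet> v)) (at x)"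
  shows "grad \<phi> x = a"
proof -
  have "frechet_derivative \<phi> (at x) = (\<lambda>v. a \<bullet> v)"
    using frechet_derivative_at[OF assms] by simp
  then show ?thesis by (simp add: grad_def vec_eq_iff inner_axis)
qed

lemma differentiable_on_UNIV_iff: "\<phi> differentiable_on UNIV \<longleftrightarrow> (\<forall>x. \<phi> differentiable at x)"
  by (simp add: differentiable_on_def)

lemma tcd_differentiable: "times_cont_diff (Suc k) \<phi> \<Longrightarrow> \<phi> differentiable at x"
  by (simp add: differentiable_on_UNIV_iff)

lemma tcd_grad: "times_cont_diff (Suc k) \<phi> \<Longrightarrow> times_cont_diff k (\<lambda>x. grad \<phi> x $ i)"
  by simp

lemma tcd_continuous: "times_cont_diff k \<phi> \<Longrightarrow> continuous_on UNIV \<phi>"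
  by (cases k) (auto intro: differentiable_imp_continuous_on)

lemma tcd_Suc_imp: "times_cont_diff (Suc k) \<phi> \<Longrightarrow> times_cont_diff k \<phi>"
  by (induction k arbitrary: \<phi>) (auto intro: differentiable_imp_continuous_on)

text \<open>Any explicit formula for the derivative identifies \<open>grad\<close>, so closure under
  an operation reduces to its differentiation rule and induction on the order.\<close>

lemma tcd_SucI:
  assumes "\<And>x. (\<phi> has_derivative (\<lambda>v. g x \<bullet> v)) (at x)" "\<And>i. times_cont_diff k (\<lambda>x. g x $ i)"
  shows "times_cont_diff (Suc k) \<phi>"
proof -
  have "grad \<phi> = g" using grad_eqI[OF assms(1)] by auto
  with assms show ?thesis by (auto simp: differentiable_on_UNIV_iff differentiable_def)
qed

lemma tcd_const: "times_cont_diff k (\<lambda>_. c)"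
proof (induction k arbitrary: c)
  case (Suc k)
  then show ?case by (intro tcd_SucI[where g="\<lambda>_. 0"]) (auto simp del: times_cont_diff.simps)
qed simp

lemma tcd_add:
  "times_cont_diff k \<phi> \<Longrightarrow> times_cont_diff k \<psi> \<Longrightarrow> times_cont_diff k (\<lambda>x. \<phi> x + \<psi> x)"
proof (induction k arbitrary: \<phi> \<psi>)
  case (Suc k)
  show ?case
  proof (rule tcd_SucI[where g="\<lambda>x. grad \<phi> x + grad \<psi> x"])
    show "((\<lambda>x. \<phi> x + \<psi> x) has_derivative (\<bullet>) (grad \<phi> x + grad \<psi> x)) (at x)" for x
      by (auto intro!: derivative_eq_intros grad_has_derivative tcd_differentiable[OF Suc.prems(1)]
          tcd_differentiable[OF Suc.prems(2)] simp: inner_left_distrib)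
    show "times_cont_diff k (\<lambda>x. (grad \<phi> x + grad \<psi> x) $ i)" for i
      using Suc.IH[OF tcd_grad[OF Suc.prems(1)] tcd_grad[OF Suc.prems(2)]] by simp
  qed
qed (auto intro: continuous_intros)

lemma tcd_mult:
  "times_cont_diff k \<phi> \<Longrightarrow> times_cont_diff k \<psi> \<Longrightarrow> times_cont_diff k (\<lambda>x. \<phi> x * \<psi> x)"
proof (induction k arbitrary: \<phi> \<psi>)
  case (Suc k)
  show ?case
  proof (rule tcd_SucI[where g="\<lambda>x. \<phi> x *\<^sub>R grad \<psi> x + \<psi> x *\<^sub>R grad \<phi> x"])
    show "((\<lambda>x. \<phi> x * \<psi> x) has_derivative (\<bullet>) (\<phi> x *\<^sub>R grad \<psi> x + \<psi> x *\<^sub>R grad \<phi> x)) (at x)" for x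
      by (auto intro!: derivative_eq_intros grad_has_derivative tcd_differentiable[OF Suc.prems(1)]
          tcd_differentiable[OF Suc.prems(2)] simp: inner_left_distrib)
    show "times_cont_diff k (\<lambda>x. (\<phi> x *\<^sub>R grad \<psi> x + \<psi> x *\<^sub>R grad \<phi> x) $ i)" for i
      using tcd_add[OF Suc.IH[OF tcd_Suc_imp[OF Suc.prems(1)] tcd_grad[OF Suc.prems(2)]]
          Suc.IH[OF tcd_Suc_imp[OF Suc.prems(2)] tcd_grad[OF Suc.prems(1)]]] by simp
  qed
qed (auto intro: continuous_intros)

lemma tcd_inverse:
  assumes "\<And>x. \<phi> x \<noteq> 0"
  shows "times_cont_diff k \<phi> \<Longrightarrow> times_cont_diff k (\<lambda>x. inverse (\<phi> x))"
proof (induction k)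
  case 0
  then show ?case using assms by (auto intro: continuous_intros)
next
  case (Suc k)
  \<comment> \<open>The derivative of the inverse contains the inverse again, but only to order
    \<open>k\<close>, which the induction hypothesis supplies.\<close>
  have inv: "times_cont_diff k (\<lambda>x. inverse (\<phi> x))" using Suc tcd_Suc_imp by blast
  show ?case
  proof (rule tcd_SucI[where g="\<lambda>x. (- 1 * (inverse (\<phi> x) * inverse (\<phi> x))) *\<^sub>R grad \<phi> x"])
    show "((\<lambda>x. inverse (\<phi> x)) has_derivative
        (\<bullet>) ((- 1 * (inverse (\<phi> x) * inverse (\<phi> x))) *\<^sub>R grad \<phi> x)) (at x)" for x
      by (auto intro!: derivative_eq_intros grad_has_derivative tcd_differentiable[OF Suc.prems(1)]
          simp: assms mult_ac)
    show "times_cont_diff k (\<lambda>x. ((- 1 * (inverse (\<phi> x) * inverse (\<phi> x))) *\<^sub>R grad \<phi> x) $ i)" for i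
      using tcd_mult[OF tcd_mult[OF tcd_const[of k "-1"] tcd_mult[OF inv inv]] tcd_grad[OF Suc.prems, of i]]
      by simp
  qed
qed

definition smooth :: "(plane \<Rightarrow> real) \<Rightarrow> bool" where
  "smooth \<phi> \<longleftrightarrow> (\<forall>k. times_cont_diff k \<phi>)"

lemma smooth_const [intro, simp]: "smooth (\<lambda>_. c)"
  and smooth_add [intro]: "smooth \<phi> \<Longrightarrow> smooth \<psi> \<Longrightarrow> smooth (\<lambda>x. \<phi> x + \<psi> x)"
  and smooth_mult [intro]: "smooth \<phi> \<Longrightarrow> smooth \<psi> \<Longrightarrow> smooth (\<lambda>x. \<phi> x * \<psi> x)"
  and smooth_inverse [intro]: "(\<And>x. \<phi> x \<noteq> 0) \<Longrightarrow> smooth \<phi> \<Longrightarrow> smooth (\<lambda>x. inverse (\<phi> x))"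
  and smooth_grad [intro]: "smooth \<phi> \<Longrightarrow> smooth (\<lambda>x. grad \<phi> x $ i)"
  unfolding smooth_def
  using tcd_const tcd_add tcd_mult tcd_inverse tcd_grad by blast+

lemma smooth_diff [intro]: "smooth \<phi> \<Longrightarrow> smooth \<psi> \<Longrightarrow> smooth (\<lambda>x. \<phi> x - \<psi> x)"
  using smooth_add[OF _ smooth_mult[OF smooth_const[of "-1"]], of \<phi> \<psi>] by simp

lemma smooth_prod [intro]: "(\<And>i. i \<in> I \<Longrightarrow> smooth (\<phi> i)) \<Longrightarrow> smooth (\<lambda>x. \<Prod>i\<in>I. \<phi> i x)"
  by (induction I rule: infinite_finite_induct) auto

lemma smooth_has_derivative: "smooth \<phi> \<Longrightarrow> (\<phi> has_derivative (\<lambda>v. grad \<phi> x \<bullet> v)) (at x)"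
  unfolding smooth_def by (blast intro: grad_has_derivative tcd_differentiable)

lemma smooth_continuous: "smooth \<phi> \<Longrightarrow> continuous_on S \<phi>"
  unfolding smooth_def using tcd_continuous continuous_on_subset by blast

lemma smooth_grad_continuous: "smooth \<phi> \<Longrightarrow> continuous_on S (grad \<phi>)"
proof -
  assume "smooth \<phi>"
  then have "continuous_on S (\<lambda>x. \<chi> i. grad \<phi> x $ i)"
    by (intro continuous_on_vec_lambda smooth_continuous smooth_grad)
  then show ?thesis by simp
qed

lemma grad_add: "smooth \<phi> \<Longrightarrow> smooth \<psi> \<Longrightarrow> grad (\<lambda>x. \<phi> x + \<psi> x) x = grad \<phi> x + grad \<psi> x"
  by (rule grad_eqI) (auto intro!: derivative_eq_intros smooth_has_derivative simp: inner_left_distrib)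

lemma grad_diff: "smooth \<phi> \<Longrightarrow> smooth \<psi> \<Longrightarrow> grad (\<lambda>x. \<phi> x - \<psi> x) x = grad \<phi> x - grad \<psi> x"
  by (rule grad_eqI) (auto intro!: derivative_eq_intros smooth_has_derivative simp: inner_diff_left)

lemma grad_mult:
  "smooth \<phi> \<Longrightarrow> smooth \<psi> \<Longrightarrow> grad (\<lambda>x. \<phi> x * \<psi> x) x = \<phi> x *\<^sub>R grad \<psi> x + \<psi> x *\<^sub>R grad \<phi> x"
  by (rule grad_eqI) (auto intro!: derivative_eq_intros smooth_has_derivative simp: inner_left_distrib)

lemma smooth_inner: "smooth (\<lambda>x. a \<bullet> x)"
  unfolding smooth_def
proof
  fix k show "times_cont_diff k (\<lambda>x. a \<bullet> x)"
  proof (cases k)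
    case (Suc m)
    show ?thesis unfolding Suc
      by (rule tcd_SucI[where g="\<lambda>_. a"]) (auto intro!: derivative_eq_intros tcd_const)
  qed (auto intro: continuous_intros)
qed

section \<open>A flat function and the standard bump\<close>

definition flat_exp :: "nat \<Rightarrow> real \<Rightarrow> real" where
  "flat_exp n t = (if t \<le> 0 then 0 else exp (- inverse t) * inverse t ^ n)"

lemma flat_exp_tendsto_0: "((flat_exp n) \<longlongrightarrow> 0) (at 0)"
proof -
  \<comment> \<open>Passing to 1/t turns the limit into the decay of a power over the exponential at
    infinity.\<close>
  have "((\<lambda>t. inverse t ^ n / exp (inverse t)) \<longlongrightarrow> (0::real)) (at_right 0)"
    by (rule filterlim_compose[OF tendsto_power_div_exp_0 filterlim_inverse_at_top_right])
  then have R: "((flat_exp n) \<longlongrightarrow> 0) (at_right 0)"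
    by (rule Lim_transform_eventually)
      (auto simp: eventually_at_right_less flat_exp_def exp_minus field_simps
        intro!: eventually_at_rightI[of 0 1])
  have L: "((flat_exp n) \<longlongrightarrow> 0) (at_left 0)"
    by (rule Lim_transform_eventually[OF tendsto_const])
      (auto simp: flat_exp_def intro!: eventually_at_leftI[of "-1" 0])
  from L R show ?thesis by (simp add: filterlim_split_at)
qed

lemma flat_exp_has_derivative:
  "(flat_exp n has_real_derivative (flat_exp (n + 2) t - of_nat n * flat_exp (n + 1) t)) (at t)"
proof (cases t "0::real" rule: linorder_cases)
  case less
  have "((\<lambda>_. 0) has_real_derivative 0) (at t)" by simp
  then have "(flat_exp n has_real_derivative 0) (at t)"
    by (rule has_field_derivative_transform_within_open[of _ _ _ "{..<0}"]) (use less in \<open>auto simp: flat_exp_def\<close>)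
  with less show ?thesis by (simp add: flat_exp_def)
next
  case equal
  \<comment> \<open>The difference quotient at 0 is \<open>flat_exp (Suc n)\<close> itself, whose
    limit is already known.\<close>
  have "((\<lambda>h. (flat_exp n (0 + h) - flat_exp n 0) / h) \<longlongrightarrow> 0) (at 0)"
    by (rule Lim_transform_eventually[OF flat_exp_tendsto_0[of "Suc n"]])
       (auto simp: flat_exp_def field_simps eventually_at_filter)
  with equal show ?thesis by (simp add: DERIV_def flat_exp_def)
next
  case greater
  have "((\<lambda>t. exp (- inverse t) * inverse t ^ n) has_real_derivative
      (flat_exp (n + 2) t - of_nat n * flat_exp (n + 1) t)) (at t)"
    using greater
  proof (cases n)
    case (Suc m)
    show ?thesis using greater unfolding Suc
      by (auto intro!: derivative_eq_intros simp del: power_Suc)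
        (simp add: flat_exp_def algebra_simps power2_eq_square)
  qed (auto intro!: derivative_eq_intros simp: flat_exp_def power2_eq_square)
  then show ?thesis
    by (rule has_field_derivative_transform_within_open[of _ _ _ "{0<..}"])
      (use greater in \<open>auto simp: flat_exp_def\<close>)
qed

text \<open>Differentiation raises the exponent \<open>n\<close> by 1 and 2 and stays inside the
  family. This is why the powers are part of \<open>flat_exp\<close>, and why the induction on the
  order ranges over all \<open>n\<close> at once.\<close>

lemma tcd_flat_exp:
  assumes "smooth q"
  shows "times_cont_diff k (\<lambda>x. flat_exp n (q x))"
proof (induction k arbitrary: n)
  have der: "((\<lambda>x. flat_exp n (q x)) has_derivative
      (\<lambda>v. ((flat_exp (n + 2) (q x) + (- of_nat n) * flat_exp (n + 1) (q x)) *\<^sub>R grad q x) \<bullet> v)) (at x)" for n x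
    using has_derivative_compose[OF smooth_has_derivative[OF assms]
        has_field_derivative_imp_has_derivative[OF flat_exp_has_derivative]]
    by (simp add: algebra_simps)
  {
    case 0
    show ?case using has_derivative_continuous[OF der]
      by (simp add: continuous_at_imp_continuous_on)
  next
    case (Suc k)
    have q: "times_cont_diff k (\<lambda>x. grad q x $ i)" for i
      using assms unfolding smooth_def using tcd_grad by blast
    show ?case
    proof (rule tcd_SucI, rule der)
      show "times_cont_diff k (\<lambda>x. ((flat_exp (n + 2) (q x) + (- of_nat n) * flat_exp (n + 1) (q x)) *\<^sub>R grad q x) $ i)" for i
        using tcd_mult[OF tcd_add[OF Suc[of "n + 2"] tcd_mult[OF tcd_const[of k "- of_nat n"] Suc[of "n + 1"]]] q[of i]]
        by (simp only: vector_scaleR_component real_scaleR_def)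
    qed
  }
qed

text \<open>Of the two flat functions one is positive exactly for norms below 2, the other exactly
  for norms above 1. They never vanish together, so the quotient a / (a + b) is smooth; it is 1
  where b vanishes and 0 where a does.\<close>

definition bump :: "plane \<Rightarrow> real" where
  "bump x = flat_exp 0 (4 - x \<bullet> x) * inverse (flat_exp 0 (4 - x \<bullet> x) + flat_exp 0 (x \<bullet> x - 1))"

lemma flat_exp_nonneg: "0 \<le> flat_exp n t" and flat_exp_pos: "0 < t \<Longrightarrow> 0 < flat_exp n t"
  and flat_exp_0: "t \<le> 0 \<Longrightarrow> flat_exp n t = 0"
  by (auto simp: flat_exp_def)

lemma bump_denom: "flat_exp 0 (4 - x \<bullet> x) + flat_exp 0 (x \<bullet> x - 1) > 0" for x :: plane
proof (cases "x \<bullet> x < 4")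
  case True
  then show ?thesis using flat_exp_pos[of "4 - x \<bullet> x" 0] flat_exp_nonneg[of 0 "x \<bullet> x - 1"] by auto
next
  case False
  then show ?thesis using flat_exp_pos[of "x \<bullet> x - 1" 0] flat_exp_nonneg[of 0 "4 - x \<bullet> x"] by auto
qed

text \<open>A squared norm is a polynomial in the coordinates. The scaling is included because this
  expression occurs in the arguments of \<open>flat_exp\<close> once \<open>bump_at\<close> is
  unfolded.\<close>

lemma smooth_norm2: "smooth (\<lambda>x. (s *\<^sub>R (x - p)) \<bullet> (s *\<^sub>R (x - p)))"
proof -
  have "(\<lambda>x. (s *\<^sub>R (x - p)) \<bullet> (s *\<^sub>R (x - p))) = (\<lambda>x. \<Sum>i\<in>UNIV. (s * (axis i 1 \<bullet> x - p $ i)) * (s * (axis i 1 \<bullet> x - p $ i)))"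
    unfolding inner_axis' by (simp add: inner_vec_def)
  moreover have "smooth \<dots>" unfolding UNIV_2 by (auto intro!: smooth_add smooth_mult smooth_diff smooth_const smooth_inner)
  ultimately show ?thesis by (simp only:)
qed

definition bump_at :: "plane \<Rightarrow> real \<Rightarrow> plane \<Rightarrow> real" where
  "bump_at p r x = bump ((1 / r) *\<^sub>R (x - p))"

lemma smooth_bump_at: "smooth (bump_at p r)"
proof -
  have *: "smooth (\<lambda>x. flat_exp 0 (q x))" if "smooth q" for q
    using tcd_flat_exp[OF that] by (simp add: smooth_def)
  show ?thesis
    unfolding bump_at_def[abs_def] bump_def
    using bump_denom
    by (intro smooth_mult smooth_inverse smooth_add * smooth_diff smooth_const smooth_norm2) (metis less_irrefl)
qed

lemma smooth_bump: "smooth bump"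
  using smooth_bump_at[of 0 1] by (simp add: bump_at_def[abs_def])

lemma bump_range: "0 \<le> bump x" "bump x \<le> 1"
  using bump_denom[of x] flat_exp_nonneg[of 0 "4 - x \<bullet> x"] flat_exp_nonneg[of 0 "x \<bullet> x - 1"]
  by (auto simp: bump_def divide_inverse[symmetric])

lemma bump_1: "norm x \<le> 1 \<Longrightarrow> bump x = 1"
proof -
  assume "norm x \<le> 1"
  then have "x \<bullet> x \<le> 1" by (simp add: norm_eq_sqrt_inner)
  then show "bump x = 1" using flat_exp_pos[of "4 - x \<bullet> x" 0] by (simp add: bump_def flat_exp_0)
qed

lemma bump_0: "norm x \<ge> 2 \<Longrightarrow> bump x = 0"
proof -
  assume "norm x \<ge> 2"
  then have "x \<bullet> x \<ge> 4"
    using power_mono[of 2 "norm x" 2] by (simp add: power2_norm_eq_inner)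
  then show "bump x = 0" by (simp add: bump_def flat_exp_0)
qed

lemma bump_at_range: "0 \<le> bump_at p r x" "bump_at p r x \<le> 1"
  by (auto simp: bump_at_def bump_range)

lemma bump_at_1: "0 < r \<Longrightarrow> dist p x \<le> r \<Longrightarrow> bump_at p r x = 1"
  unfolding bump_at_def by (rule bump_1) (simp add: dist_norm norm_minus_commute divide_simps)

lemma bump_at_0: "0 < r \<Longrightarrow> dist p x \<ge> 2 * r \<Longrightarrow> bump_at p r x = 0"
  unfolding bump_at_def by (rule bump_0) (simp add: dist_norm norm_minus_commute divide_simps)

lemma grad_bump_at: "grad (bump_at p r) x = (1 / r) *\<^sub>R grad bump ((1 / r) *\<^sub>R (x - p))"
proof (rule grad_eqI)
  have "((\<lambda>x. (1 / r) *\<^sub>R (x - p)) has_derivative (\<lambda>v. (1 / r) *\<^sub>R v)) (at x)"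
    by (auto intro!: derivative_eq_intros)
  from has_derivative_compose[OF this smooth_has_derivative[OF smooth_bump]]
  show "(bump_at p r has_derivative (\<bullet>) ((1 / r) *\<^sub>R grad bump ((1 / r) *\<^sub>R (x - p)))) (at x)"
    unfolding bump_at_def[abs_def] by (rule has_derivative_eq_rhs) auto
qed

section \<open>Test functions, smooth cutoffs and localisation\<close>

lemma test_fun_iff: "\<phi> \<in> test_fun U \<longleftrightarrow> smooth \<phi> \<and> (\<exists>K. compact K \<and> K \<subseteq> U \<and> (\<forall>x. x \<notin> K \<longrightarrow> \<phi> x = 0))"
proof safe
  assume \<phi>: "\<phi> \<in> test_fun U"
  then show "smooth \<phi>" by (simp add: test_fun_def smooth_def)
  show "\<exists>K. compact K \<and> K \<subseteq> U \<and> (\<forall>x. x \<notin> K \<longrightarrow> \<phi> x = 0)"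
    using \<phi> closure_subset[of "{x. \<phi> x \<noteq> 0}"] by (intro exI[of _ "fun_support \<phi>"]) (auto simp: test_fun_def fun_support_def)
next
  fix K assume K: "compact K" "K \<subseteq> U" "\<forall>x. x \<notin> K \<longrightarrow> \<phi> x = 0" and s: "smooth \<phi>"
  \<comment> \<open>A compact set is closed, so any compact \<open>K\<close> off which the function
    vanishes contains the support. Working with such sets avoids computing supports of sums and
    products.\<close>
  have "fun_support \<phi> \<subseteq> K"
    unfolding fun_support_def by (rule closure_minimal) (use K compact_imp_closed in auto)
  moreover from this have "compact (fun_support \<phi>)"
    using K(1) unfolding fun_support_def by (meson bounded_subset closed_closure compact_eq_bounded_closed)
  ultimately show "\<phi> \<in> test_fun U" using K s by (auto simp: test_fun_def smooth_def)
qed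

lemma test_fun_smooth: "\<phi> \<in> test_fun U \<Longrightarrow> smooth \<phi>"
  by (simp add: test_fun_iff)

lemma test_fun_0 [simp]: "(\<lambda>_. 0) \<in> test_fun U"
  by (auto simp: test_fun_iff intro!: exI[of _ "{}"])

lemma test_fun_mono: "\<phi> \<in> test_fun U \<Longrightarrow> U \<subseteq> V \<Longrightarrow> \<phi> \<in> test_fun V"
  by (auto simp: test_fun_iff)

lemma test_fun_add: "\<phi> \<in> test_fun U \<Longrightarrow> \<psi> \<in> test_fun U \<Longrightarrow> (\<lambda>x. \<phi> x + \<psi> x) \<in> test_fun U"
proof -
  assume "\<phi> \<in> test_fun U" "\<psi> \<in> test_fun U"
  then obtain K L where "compact K" "K \<subseteq> U" "\<forall>x. x \<notin> K \<longrightarrow> \<phi> x = 0" "smooth \<phi>"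
     "compact L" "L \<subseteq> U" "\<forall>x. x \<notin> L \<longrightarrow> \<psi> x = 0" "smooth \<psi>" by (auto simp: test_fun_iff)
  then show ?thesis by (auto simp: test_fun_iff intro!: exI[of _ "K \<union> L"])
qed

lemma test_fun_mult: "\<phi> \<in> test_fun U \<Longrightarrow> \<psi> \<in> test_fun V \<Longrightarrow> (\<lambda>x. \<phi> x * \<psi> x) \<in> test_fun (U \<inter> V)"
proof -
  assume "\<phi> \<in> test_fun U" "\<psi> \<in> test_fun V"
  then obtain K L where "compact K" "K \<subseteq> U" "\<forall>x. x \<notin> K \<longrightarrow> \<phi> x = 0" "smooth \<phi>"
     "compact L" "L \<subseteq> V" "\<forall>x. x \<notin> L \<longrightarrow> \<psi> x = 0" "smooth \<psi>" by (auto simp: test_fun_iff)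
  then show ?thesis by (auto simp: test_fun_iff intro!: exI[of _ "K \<inter> L"] compact_Int)
qed

lemma test_fun_mult_smooth: "\<phi> \<in> test_fun U \<Longrightarrow> smooth \<psi> \<Longrightarrow> (\<lambda>x. \<phi> x * \<psi> x) \<in> test_fun U"
  by (auto simp: test_fun_iff)

lemma test_fun_diff: "\<phi> \<in> test_fun U \<Longrightarrow> \<psi> \<in> test_fun U \<Longrightarrow> (\<lambda>x. \<phi> x - \<psi> x) \<in> test_fun U"
  using test_fun_add[OF _ test_fun_mult_smooth[OF _ smooth_const[of "-1"]], of \<phi> U \<psi>] by simp

lemma grad_0_outside:
  assumes "closed K" "\<And>x. x \<notin> K \<Longrightarrow> \<phi> x = 0" "x \<notin> K"
  shows "grad \<phi> x = 0"
proof (rule grad_eqI)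
  have "((\<lambda>_. 0) has_derivative (\<lambda>v. 0 \<bullet> v)) (at x)" by simp
  then show "(\<phi> has_derivative (\<lambda>v. 0 \<bullet> v)) (at x)"
    by (rule has_derivative_transform_within_open[of _ _ _ _ "- K"]) (use assms in \<open>auto\<close>)
qed

lemma test_fun_support_obtain:
  assumes "\<phi> \<in> test_fun U"
  obtains K M where "compact K" "K \<subseteq> U" "\<And>x. x \<notin> K \<Longrightarrow> \<phi> x = 0" "\<And>x. x \<notin> K \<Longrightarrow> grad \<phi> x = 0"
    "0 < M" "\<And>x. \<bar>\<phi> x\<bar> \<le> M" "\<And>x. norm (grad \<phi> x) \<le> M"
proof -
  from assms obtain K where K: "compact K" "K \<subseteq> U" "\<And>x. x \<notin> K \<Longrightarrow> \<phi> x = 0" and s: "smooth \<phi>"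
    by (auto simp: test_fun_iff)
  have g: "grad \<phi> x = 0" if "x \<notin> K" for x
    using grad_0_outside[of K \<phi> x] K that compact_imp_closed by blast
  obtain M1 where M1: "\<And>x. x \<in> K \<Longrightarrow> norm (\<phi> x) \<le> M1"
    using compact_imp_bounded[OF compact_continuous_image[OF smooth_continuous[OF s] K(1)]]
    unfolding bounded_iff by auto
  obtain M2 where M2: "\<And>x. x \<in> K \<Longrightarrow> norm (grad \<phi> x) \<le> M2"
    using compact_imp_bounded[OF compact_continuous_image[OF smooth_grad_continuous[OF s] K(1)]]
    unfolding bounded_iff by auto
  \<comment> \<open>The maximum with 1 keeps the common bound positive even for the zero
    function.\<close>
  have "\<bar>\<phi> x\<bar> \<le> max 1 (max M1 M2)" "norm (grad \<phi> x) \<le> max 1 (max M1 M2)" for x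
    using M1[of x] M2[of x] K(3)[of x] g[of x] by (cases "x \<in> K"; force)+
  with K g show ?thesis by (intro that[of K "max 1 (max M1 M2)"]) auto
qed

lemma test_fun_bump_at:
  assumes "0 < r" "cball p (2 * r) \<subseteq> U"
  shows "bump_at p r \<in> test_fun U"
  using assms smooth_bump_at bump_at_0
  by (auto simp: test_fun_iff intro!: exI[of _ "cball p (2 * r)"])

text \<open>Multiplying \<open>\<phi>\<close> by finitely many factors \<open>1 - \<eta>\<^sub>i\<close>, where the sets \<open>{\<eta>\<^sub>i = 1}\<close> cover its support,
  serves as a partition of unity.\<close>

lemma test_fun_local_bumps:
  assumes "compact K" and "\<And>x. x \<in> K \<Longrightarrow> open (W x) \<and> x \<in> W x"
  shows "\<exists>I r. finite I \<and> I \<subseteq> K \<and> (\<forall>i\<in>I. 0 < r i \<and> cball i (2 * r i) \<subseteq> W i) \<and>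
    (\<forall>x\<in>K. \<exists>i\<in>I. bump_at i (r i) x = 1)"
proof -
  have "\<exists>r>0. cball x (2 * r) \<subseteq> W x" if x: "x \<in> K" for x
  proof -
    obtain e where "e > 0" "cball x e \<subseteq> W x"
      using assms(2)[OF x] open_contains_cball by blast
    then show ?thesis by (intro exI[of _ "e/2"]) auto
  qed
  then obtain r where r: "\<And>x. x \<in> K \<Longrightarrow> r x > 0 \<and> cball x (2 * r x) \<subseteq> W x" by metis
  have "K \<subseteq> (\<Union>x\<in>K. ball x (r x))" using r by force
  then obtain I where I: "I \<subseteq> K" "finite I" "K \<subseteq> (\<Union>x\<in>I. ball x (r x))"
    using compactE_image[OF assms(1), of K "\<lambda>x. ball x (r x)"] by auto
  have "\<exists>i\<in>I. bump_at i (r i) x = 1" if x: "x \<in> K" for x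
  proof -
    obtain i where "i \<in> I" "x \<in> ball i (r i)" using I x by blast
    then show ?thesis using r[of i] I by (intro bexI[of _ i] bump_at_1) auto
  qed
  with I r show ?thesis by (intro exI[of _ I] exI[of _ r]) blast
qed

text \<open>One minus the product of the factors \<open>1 - bump_at\<close> lies between 0 and 1
  without normalisation, equals 1 where some bump does, and vanishes where all of them do.\<close>

lemma smooth_Urysohn:
  assumes "compact K" "open U" "K \<subseteq> U"
  obtains \<eta> where "\<eta> \<in> test_fun U" "\<And>x. 0 \<le> \<eta> x" "\<And>x. \<eta> x \<le> 1" "\<And>x. x \<in> K \<Longrightarrow> \<eta> x = 1"
proof -
  have "\<exists>I r. finite I \<and> I \<subseteq> K \<and> (\<forall>i\<in>I. 0 < r i \<and> cball i (2 * r i) \<subseteq> U) \<and>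
    (\<forall>x\<in>K. \<exists>i\<in>I. bump_at i (r i) x = 1)"
    by (rule test_fun_local_bumps) (use assms in auto)
  then obtain I r where "finite I \<and> I \<subseteq> K \<and> (\<forall>i\<in>I. 0 < r i \<and> cball i (2 * r i) \<subseteq> U) \<and>
    (\<forall>x\<in>K. \<exists>i\<in>I. bump_at i (r i) x = 1)" by (elim exE)
  then have I: "finite I" "I \<subseteq> K" "\<And>i. i \<in> I \<Longrightarrow> 0 < r i \<and> cball i (2 * r i) \<subseteq> U"
    "\<And>x. x \<in> K \<Longrightarrow> \<exists>i\<in>I. bump_at i (r i) x = 1"
    by simp_all
  define P where "P x = (\<Prod>i\<in>I. 1 - bump_at i (r i) x)" for x
  have P: "0 \<le> P x" "P x \<le> 1" for x
    unfolding P_def by (auto intro!: prod_nonneg prod_le_1 simp: bump_at_range)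
  show ?thesis
  proof (rule that[of "\<lambda>x. 1 - P x"])
    show "(\<lambda>x. 1 - P x) \<in> test_fun U"
      unfolding test_fun_iff
    proof (intro conjI exI[of _ "\<Union>i\<in>I. cball i (2 * r i)"] allI impI)
      show "smooth (\<lambda>x. 1 - P x)" unfolding P_def
        by (intro smooth_diff smooth_const smooth_prod smooth_bump_at)
      fix x assume x: "x \<notin> (\<Union>i\<in>I. cball i (2 * r i))"
      have "P x = (\<Prod>i\<in>I. 1)" unfolding P_def
      proof (rule prod.cong)
        fix i assume i: "i \<in> I"
        then have "bump_at i (r i) x = 0" using x I(3)[OF i] by (intro bump_at_0) force+
        then show "1 - bump_at i (r i) x = 1" by simp
      qed simp
      then show "1 - P x = 0" by simp
    qed (use I in auto)
    show "1 - P x = 1" if "x \<in> K" for x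
      using I(1) I(4)[OF that] by (auto simp: P_def prod_zero_iff)
  qed (use P in auto)
qed

text \<open>Bumps are peeled off one at a time: each splits the remaining function into a part
  supported where \<Lambda> is known to vanish and a part carrying one more factor
  \<open>1 - bump_at\<close>.\<close>

lemma test_fun_locality:
  fixes \<Lambda> :: "(plane \<Rightarrow> real) \<Rightarrow> real"
  assumes add: "\<And>\<phi> \<psi>. \<phi> \<in> test_fun U \<Longrightarrow> \<psi> \<in> test_fun U \<Longrightarrow> \<Lambda> (\<lambda>x. \<phi> x + \<psi> x) = \<Lambda> \<phi> + \<Lambda> \<psi>"
    and local: "\<And>x. x \<in> U \<Longrightarrow> \<exists>W. open W \<and> x \<in> W \<and> (\<forall>\<phi>\<in>test_fun (U \<inter> W). \<Lambda> \<phi> = 0)"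
    and \<phi>: "\<phi> \<in> test_fun U"
  shows "\<Lambda> \<phi> = 0"
proof -
  obtain W where W: "\<And>x. x \<in> U \<Longrightarrow> open (W x) \<and> x \<in> W x"
    "\<And>x \<phi>. x \<in> U \<Longrightarrow> \<phi> \<in> test_fun (U \<inter> W x) \<Longrightarrow> \<Lambda> \<phi> = 0" using local by metis
  from \<phi> obtain K where K: "compact K" "K \<subseteq> U" "\<And>x. x \<notin> K \<Longrightarrow> \<phi> x = 0"
    by (auto simp: test_fun_iff)
  have "\<exists>I r. finite I \<and> I \<subseteq> K \<and> (\<forall>i\<in>I. 0 < r i \<and> cball i (2 * r i) \<subseteq> W i) \<and>
    (\<forall>x\<in>K. \<exists>i\<in>I. bump_at i (r i) x = 1)"
    by (rule test_fun_local_bumps) (use W(1) K(1,2) in auto)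
  then obtain I r where "finite I \<and> I \<subseteq> K \<and> (\<forall>i\<in>I. 0 < r i \<and> cball i (2 * r i) \<subseteq> W i) \<and>
    (\<forall>x\<in>K. \<exists>i\<in>I. bump_at i (r i) x = 1)" by (elim exE)
  then have I: "finite I" "I \<subseteq> K" "\<And>i. i \<in> I \<Longrightarrow> 0 < r i \<and> cball i (2 * r i) \<subseteq> W i"
    "\<And>x. x \<in> K \<Longrightarrow> \<exists>i\<in>I. bump_at i (r i) x = 1"
    by simp_all
  have "\<Lambda> \<phi> = \<Lambda> (\<lambda>x. \<phi> x * (\<Prod>i\<in>J. 1 - bump_at i (r i) x))" if "J \<subseteq> I" for J
    using finite_subset[OF that I(1)] that
  proof (induction J rule: finite_induct)
    case (insert j J)
    define \<psi> where "\<psi> = (\<lambda>x. \<phi> x * (\<Prod>i\<in>J. 1 - bump_at i (r i) x))"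
    have \<psi>: "\<psi> \<in> test_fun U"
      unfolding \<psi>_def using \<phi> by (intro test_fun_mult_smooth smooth_prod smooth_diff smooth_const smooth_bump_at) auto
    have 1: "(\<lambda>x. \<psi> x * bump_at j (r j) x) \<in> test_fun (U \<inter> W j)"
      using I(3)[of j] insert.prems by (intro test_fun_mult[OF \<psi> test_fun_bump_at]) auto
    have 2: "(\<lambda>x. \<psi> x * (1 - bump_at j (r j) x)) \<in> test_fun U"
      by (intro test_fun_mult_smooth[OF \<psi>] smooth_diff smooth_const smooth_bump_at)
    have "\<Lambda> \<phi> = \<Lambda> (\<lambda>x. \<psi> x * bump_at j (r j) x + \<psi> x * (1 - bump_at j (r j) x))"
      using insert by (simp add: \<psi>_def algebra_simps)
    also have "\<dots> = \<Lambda> (\<lambda>x. \<psi> x * bump_at j (r j) x) + \<Lambda> (\<lambda>x. \<psi> x * (1 - bump_at j (r j) x))"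
      by (rule add) (use 1 2 test_fun_mono in auto)
    also have "\<Lambda> (\<lambda>x. \<psi> x * bump_at j (r j) x) = 0"
      using W(2)[OF _ 1] insert.prems I(2) K(2) by auto
    finally show ?case using insert.hyps by (simp add: \<psi>_def mult_ac)
  qed simp
  then have "\<Lambda> \<phi> = \<Lambda> (\<lambda>x. \<phi> x * (\<Prod>i\<in>I. 1 - bump_at i (r i) x))" by blast
  \<comment> \<open>The bumps cover \<open>K\<close>, so at each of its points some factor is 0, and
    off \<open>K\<close> the function \<phi> is 0: nothing remains after all bumps have been peeled
    off.\<close>
  also have "(\<lambda>x. \<phi> x * (\<Prod>i\<in>I. 1 - bump_at i (r i) x)) = (\<lambda>x. 0)"
  proof
    fix x show "\<phi> x * (\<Prod>i\<in>I. 1 - bump_at i (r i) x) = 0"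
      using I(1) I(4)[of x] K(3)[of x] by (cases "x \<in> K") (auto simp: prod_zero_iff)
  qed
  also have "\<Lambda> (\<lambda>x. 0) = 0" using add[of "\<lambda>_. 0" "\<lambda>_. 0"] by simp
  finally show ?thesis .
qed

section \<open>The space \<open>L\<^sub>2\<close> and uniqueness of weak derivatives\<close>

lemma sets_lebesgue_open [simp]: "open U \<Longrightarrow> U \<in> sets lebesgue"
  and sets_lebesgue_compact [simp]: "compact K \<Longrightarrow> K \<in> sets lebesgue"
  by (auto dest: borel_open borel_compact intro: sets_completionI_sets)

lemma integrable_lebesgue_on_subset:
  fixes f :: "'a::euclidean_space \<Rightarrow> 'b::{banach, second_countable_topology}"
  assumes "integrable (lebesgue_on S) f" "T \<subseteq> S" "S \<in> sets lebesgue" "T \<in> sets lebesgue"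
  shows "integrable (lebesgue_on T) f"
proof -
  have "integrable lebesgue (\<lambda>x. indicator T x *\<^sub>R (if x \<in> S then f x else 0))"
    using assms by (intro integrable_mult_indicator) (simp_all add: Lebesgue_Measure.integrable_restrict_UNIV)
  also have "(\<lambda>x. indicator T x *\<^sub>R (if x \<in> S then f x else 0)) = (\<lambda>x. if x \<in> T then f x else 0)"
    using assms by (auto simp: indicator_def fun_eq_iff)
  finally show ?thesis using assms by (simp add: Lebesgue_Measure.integrable_restrict_UNIV)
qed

lemma
  fixes f :: "'a::euclidean_space \<Rightarrow> 'b::euclidean_space"
  assumes "T \<subseteq> S" "S \<in> sets lebesgue" "T \<in> sets lebesgue" "\<And>x. x \<in> S - T \<Longrightarrow> f x = 0"
  shows integrable_lebesgue_on_superset: "integrable (lebesgue_on S) f \<longleftrightarrow> integrable (lebesgue_on T) f"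
    and integral_lebesgue_on_superset: "integral\<^sup>L (lebesgue_on S) f = integral\<^sup>L (lebesgue_on T) f"
proof -
  have eq: "(\<lambda>x. if x \<in> S then f x else 0) = (\<lambda>x. if x \<in> T then f x else 0)"
    using assms by (auto simp: fun_eq_iff)
  show "integrable (lebesgue_on S) f \<longleftrightarrow> integrable (lebesgue_on T) f"
    by (simp only: Lebesgue_Measure.integrable_restrict_UNIV[OF assms(2), symmetric] Lebesgue_Measure.integrable_restrict_UNIV[OF assms(3), symmetric] eq)
  show "integral\<^sup>L (lebesgue_on S) f = integral\<^sup>L (lebesgue_on T) f"
    by (simp only: Lebesgue_Measure.integral_restrict_UNIV[OF assms(2), symmetric]
        Lebesgue_Measure.integral_restrict_UNIV[OF assms(3), symmetric] eq)
qed

lemma borel_measurable_lebesgue_on_subset: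
  "f \<in> borel_measurable (lebesgue_on S) \<Longrightarrow> T \<subseteq> S \<Longrightarrow> f \<in> borel_measurable (lebesgue_on T)"
  by (rule measurable_restrict_mono)

text \<open>Completeness of Lebesgue measure. Weak derivatives are arbitrarily chosen
  representatives, and measurability reaches them through almost everywhere equality with a
  measurable function.\<close>

lemma borel_measurable_lebesgue_on_AE:
  fixes f g :: "'a::euclidean_space \<Rightarrow> 'b::euclidean_space"
  assumes S: "S \<in> sets lebesgue" and f: "f \<in> borel_measurable (lebesgue_on S)"
    and ae: "AE x in lebesgue_on S. f x = g x"
  shows "g \<in> borel_measurable (lebesgue_on S)"
proof -
  let ?f = "\<lambda>x. if x \<in> S then f x else 0" and ?g = "\<lambda>x. if x \<in> S then g x else 0"
  have f': "?f \<in> borel_measurable lebesgue" using f S by (simp add: borel_measurable_if)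
  have ae': "AE x in lebesgue. ?f x = ?g x" using ae S by (auto simp: AE_restrict_space_iff)
  have "?g \<in> borel_measurable lebesgue"
  proof (rule measurableI)
    fix A :: "'b set" assume A: "A \<in> sets borel"
    show "?g -` A \<inter> space lebesgue \<in> sets lebesgue"
    proof (rule completion.in_sets_AE)
      show "?f -` A \<inter> space lebesgue \<in> sets lebesgue" using f' A by (rule measurable_sets)
      show "AE x in lebesgue. x \<in> ?f -` A \<inter> space lebesgue \<longleftrightarrow> x \<in> ?g -` A \<inter> space lebesgue"
        using ae' by eventually_elim auto
    qed auto
  qed simp
  then show ?thesis using S by (simp add: borel_measurable_if)
qed

lemma continuous_measurable_lebesgue_on:
  fixes f :: "'a::euclidean_space \<Rightarrow> 'b::euclidean_space"
  shows "continuous_on S f \<Longrightarrow> S \<in> sets lebesgue \<Longrightarrow> f \<in> borel_measurable (lebesgue_on S)"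
  by (rule continuous_imp_measurable_on_sets_lebesgue)

section \<open>Square-integrable functions\<close>

lemma Lp2_iff: "Lp_on 2 U v \<longleftrightarrow>
    v \<in> borel_measurable (lebesgue_on U) \<and> integrable (lebesgue_on U) (\<lambda>x. (norm (v x))\<^sup>2)"
proof -
  have "norm (v x) powr 2 = (norm (v x))\<^sup>2" for x by (simp add: powr_numeral)
  then show ?thesis by (simp add: Lp_on_def)
qed

lemma Lp2_measurable: "Lp_on 2 U v \<Longrightarrow> v \<in> borel_measurable (lebesgue_on U)"
  and Lp2_integrable: "Lp_on 2 U v \<Longrightarrow> integrable (lebesgue_on U) (\<lambda>x. (norm (v x))\<^sup>2)"
  by (simp_all add: Lp2_iff)

lemma Lp2_bound:
  assumes g: "g \<in> borel_measurable (lebesgue_on U)" and F: "integrable (lebesgue_on U) F"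
    and "\<And>x. x \<in> U \<Longrightarrow> (norm (g x))\<^sup>2 \<le> F x"
  shows "Lp_on 2 U g"
  unfolding Lp2_iff
proof (intro conjI g Bochner_Integration.integrable_bound[OF F])
  show "AE x in lebesgue_on U. norm ((norm (g x))\<^sup>2) \<le> norm (F x)"
    using assms(3) by (intro AE_I2) force
  show "(\<lambda>x. (norm (g x))\<^sup>2) \<in> borel_measurable (lebesgue_on U)" using g by measurable
qed

lemma Lp2_add:
  assumes f: "Lp_on 2 U f" and g: "Lp_on 2 U g"
  shows "Lp_on 2 U (\<lambda>x. f x + g x)"
proof (rule Lp2_bound[where F="\<lambda>x. 2 * (norm (f x))\<^sup>2 + 2 * (norm (g x))\<^sup>2"])
  show "(norm (f x + g x))\<^sup>2 \<le> 2 * (norm (f x))\<^sup>2 + 2 * (norm (g x))\<^sup>2" for x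
  proof -
    have "(norm (f x + g x))\<^sup>2 \<le> (norm (f x) + norm (g x))\<^sup>2"
      by (intro power_mono norm_triangle_ineq) simp
    also have "\<dots> \<le> 2 * (norm (f x))\<^sup>2 + 2 * (norm (g x))\<^sup>2"
      using sum_squares_bound[of "norm (f x)" "norm (g x)"] by (simp add: power2_sum)
    finally show ?thesis .
  qed
qed (use f g in \<open>simp_all add: Lp2_iff borel_measurable_add\<close>)

lemma Lp2_scaleR:
  assumes f: "Lp_on 2 U f"
  shows "Lp_on 2 U (\<lambda>x. c *\<^sub>R f x)"
  by (rule Lp2_bound[where F="\<lambda>x. c\<^sup>2 * (norm (f x))\<^sup>2"])
    (use f in \<open>simp_all add: Lp2_iff borel_measurable_scaleR power_mult_distrib\<close>)

lemma Lp2_diff: "Lp_on 2 U f \<Longrightarrow> Lp_on 2 U g \<Longrightarrow> Lp_on 2 U (\<lambda>x. f x - g x)"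
  using Lp2_add[OF _ Lp2_scaleR[of U g "-1"], of f] by simp

lemma Lp2_cmult: "Lp_on 2 U f \<Longrightarrow> Lp_on 2 U (\<lambda>x. c * f x :: real)"
  using Lp2_scaleR[of U f c] by simp

lemma Lp2_AE:
  assumes U: "U \<in> sets lebesgue" and f: "Lp_on 2 U f" and ae: "AE x in lebesgue_on U. f x = g x"
  shows "Lp_on 2 U g"
proof -
  have g: "g \<in> borel_measurable (lebesgue_on U)"
    by (rule borel_measurable_lebesgue_on_AE[OF U Lp2_measurable[OF f] ae])
  have "integrable (lebesgue_on U) (\<lambda>x. (norm (f x))\<^sup>2) \<longleftrightarrow> integrable (lebesgue_on U) (\<lambda>x. (norm (g x))\<^sup>2)"
    using ae g Lp2_measurable[OF f] by (intro integrable_cong_AE) (auto elim: AE_mp)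
  then show ?thesis using f g by (simp add: Lp2_iff)
qed

lemma Lp2_subset:
  assumes "Lp_on 2 U f" "V \<subseteq> U" "U \<in> sets lebesgue" "V \<in> sets lebesgue"
  shows "Lp_on 2 V f"
  using assms by (auto simp: Lp2_iff intro: borel_measurable_lebesgue_on_subset integrable_lebesgue_on_subset)

lemma L2_norm_cong_AE:
  assumes "f \<in> borel_measurable (lebesgue_on U)" "g \<in> borel_measurable (lebesgue_on U)"
    "AE x in lebesgue_on U. f x = g x"
  shows "L2_norm U f = L2_norm U g"
  unfolding L2_norm_def
  using assms by (intro arg_cong[where f=sqrt] integral_cong_AE) (auto elim: AE_mp)

lemma L2_norm_power2: "(L2_norm U f)\<^sup>2 = (LINT x|lebesgue_on U. (norm (f x))\<^sup>2)"
  by (simp add: L2_norm_def)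

lemma L2_norm_nonneg: "0 \<le> L2_norm U f"
  by (simp add: L2_norm_def)

lemma Lp2_inner_integrable:
  assumes f: "Lp_on 2 U f" and g: "Lp_on 2 U g"
  shows "integrable (lebesgue_on U) (\<lambda>x. f x \<bullet> g x)"
proof (rule Bochner_Integration.integrable_bound[where f="\<lambda>x. (norm (f x))\<^sup>2 + (norm (g x))\<^sup>2"])
  show "AE x in lebesgue_on U. norm (f x \<bullet> g x) \<le> norm ((norm (f x))\<^sup>2 + (norm (g x))\<^sup>2)"
  proof (rule AE_I2)
    fix x
    have "\<bar>f x \<bullet> g x\<bar> \<le> norm (f x) * norm (g x)" by (rule Cauchy_Schwarz_ineq2)
    also have "\<dots> \<le> (norm (f x))\<^sup>2 + (norm (g x))\<^sup>2"
      using sum_squares_bound[of "norm (f x)" "norm (g x)"] mult_nonneg_nonneg[of "norm (f x)" "norm (g x)"]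
      by (simp del: mult_nonneg_nonneg)
    finally show "norm (f x \<bullet> g x) \<le> norm ((norm (f x))\<^sup>2 + (norm (g x))\<^sup>2)" by simp
  qed
qed (use f g in \<open>auto simp: Lp2_iff\<close>)

lemma Lp2_mult_integrable:
  fixes f g :: "plane \<Rightarrow> real"
  shows "Lp_on 2 U f \<Longrightarrow> Lp_on 2 U g \<Longrightarrow> integrable (lebesgue_on U) (\<lambda>x. f x * g x)"
  using Lp2_inner_integrable[of U f g] by simp

lemma L2_Cauchy_Schwarz:
  assumes f: "Lp_on 2 U f" and g: "Lp_on 2 U g"
  shows "\<bar>LINT x|lebesgue_on U. f x \<bullet> g x\<bar> \<le> L2_norm U f * L2_norm U g"
proof -
  define A B C where "A = (LINT x|lebesgue_on U. f x \<bullet> f x)" and "B = (LINT x|lebesgue_on U. f x \<bullet> g x)"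
    and "C = (LINT x|lebesgue_on U. g x \<bullet> g x)"
  note int = Lp2_inner_integrable[OF f f] Lp2_inner_integrable[OF f g] Lp2_inner_integrable[OF g g]
  \<comment> \<open>This is the squared norm of f - t g; the claim is the discriminant condition of
    a quadratic that is nowhere negative.\<close>
  have q: "0 \<le> A - 2 * t * B + t\<^sup>2 * C" for t
  proof -
    have "0 \<le> (LINT x|lebesgue_on U. (f x - t *\<^sub>R g x) \<bullet> (f x - t *\<^sub>R g x))"
      by (rule Bochner_Integration.integral_nonneg) simp
    also have "\<dots> = (LINT x|lebesgue_on U. f x \<bullet> f x - 2 * t * (f x \<bullet> g x) + t\<^sup>2 * (g x \<bullet> g x))"
      by (intro Bochner_Integration.integral_cong) (auto simp: inner_simps inner_commute power2_eq_square algebra_simps)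
    also have "\<dots> = A - 2 * t * B + t\<^sup>2 * C"
      using int by (simp add: A_def B_def C_def)
    finally show ?thesis .
  qed
  have AC: "0 \<le> A" "0 \<le> C" by (auto simp: A_def C_def)
  have "B\<^sup>2 \<le> A * C"
  proof (cases "C = 0")
    case True
    have "B = 0"
    proof (rule ccontr)
      assume "B \<noteq> 0"
      \<comment> \<open>For \<open>C = 0\<close> the quadratic is affine in \<open>t\<close>, and
        this \<open>t\<close> is chosen so that it takes the value -1.\<close>
      then have "A - 2 * ((A + 1) / (2 * B)) * B = -1" by (simp add: field_simps)
      with q[of "(A + 1) / (2 * B)"] True show False by simp
    qed
    with True show ?thesis by simp
  next
    case False
    with AC have "C > 0" by simp
    \<comment> \<open>The minimiser of the quadratic.\<close>
    with q[of "B / C"] have "0 \<le> A - B\<^sup>2 / C" by (simp add: power2_eq_square)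
    with \<open>C > 0\<close> show ?thesis by (simp add: field_simps)
  qed
  then have "\<bar>B\<bar> \<le> sqrt (A * C)" by (simp add: real_le_rsqrt abs_le_square_iff)
  then show ?thesis
    by (simp add: B_def A_def C_def L2_norm_def power2_norm_eq_inner real_sqrt_mult)
qed

lemma L2_tendsto_inner:
  assumes F: "Lp_on 2 U F" and g: "\<And>n. Lp_on 2 U (g n)" "Lp_on 2 U h"
    and lim: "(\<lambda>n. L2_norm U (\<lambda>x. g n x - h x)) \<longlonglongrightarrow> 0"
  shows "(\<lambda>n. LINT x|lebesgue_on U. F x \<bullet> g n x) \<longlonglongrightarrow> (LINT x|lebesgue_on U. F x \<bullet> h x)"
proof -
  have "(\<lambda>n. L2_norm U F * L2_norm U (\<lambda>x. g n x - h x)) \<longlonglongrightarrow> 0"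
    using tendsto_mult_right_zero[OF lim] .
  then have "(\<lambda>n. LINT x|lebesgue_on U. F x \<bullet> (g n x - h x)) \<longlonglongrightarrow> 0"
    by (rule Lim_null_comparison[rotated])
      (auto intro!: always_eventually L2_Cauchy_Schwarz[OF F] Lp2_diff g)
  then have "(\<lambda>n. (LINT x|lebesgue_on U. F x \<bullet> g n x) - (LINT x|lebesgue_on U. F x \<bullet> h x)) \<longlonglongrightarrow> 0"
    using Lp2_inner_integrable[OF F] g by (simp add: inner_diff_right)
  then show ?thesis by (simp add: LIM_zero_iff)
qed

lemma L2_norm_triangle_diff:
  assumes f: "Lp_on 2 U f" and g: "Lp_on 2 U g"
  shows "L2_norm U (\<lambda>x. f x - g x) \<le> L2_norm U f + L2_norm U g"
proof -
  have "(L2_norm U (\<lambda>x. f x - g x))\<^sup>2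
      = (LINT x|lebesgue_on U. f x \<bullet> f x - 2 * (f x \<bullet> g x) + g x \<bullet> g x)"
    unfolding L2_norm_power2 power2_norm_eq_inner
    by (intro Bochner_Integration.integral_cong) (auto simp: inner_simps inner_commute)
  also have "\<dots> = (L2_norm U f)\<^sup>2 - 2 * (LINT x|lebesgue_on U. f x \<bullet> g x) + (L2_norm U g)\<^sup>2"
    unfolding L2_norm_power2 power2_norm_eq_inner
    using Lp2_inner_integrable[OF f f] Lp2_inner_integrable[OF f g] Lp2_inner_integrable[OF g g] by simp
  also have "\<dots> \<le> (L2_norm U f + L2_norm U g)\<^sup>2"
    using L2_Cauchy_Schwarz[OF f g] by (simp add: power2_sum)
  finally show ?thesis by (rule power2_le_imp_le) (simp add: L2_norm_nonneg)
qed

section \<open>Locally integrable functions against test functions\<close>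

lemma loc_integrable_mult:
  assumes h: "loc_integrable_on U h" and U: "open U" and K: "compact K" "K \<subseteq> U"
    and F: "F \<in> borel_measurable (lebesgue_on K)" "\<And>x. x \<in> K \<Longrightarrow> norm (F x) \<le> M * norm (h x)"
      "\<And>x. x \<notin> K \<Longrightarrow> F x = 0"
  shows "integrable (lebesgue_on U) (F :: plane \<Rightarrow> 'b::euclidean_space)"
proof -
  have hK: "integrable (lebesgue_on K) h" using h K by (auto simp: loc_integrable_on_def)
  have "integrable (lebesgue_on K) F"
    by (rule Bochner_Integration.integrable_bound[where f="\<lambda>x. M * norm (h x)"])
      (use hK F in \<open>auto intro!: AE_I2 intro: order_trans[OF _ abs_ge_self]\<close>)
  then show ?thesis using integrable_lebesgue_on_superset[of K U F] K U F by auto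
qed

lemma loc_integrable_test:
  assumes \<phi>: "\<phi> \<in> test_fun U" and U: "open U" and h: "loc_integrable_on U h"
  shows "integrable (lebesgue_on U) (\<lambda>x. \<phi> x *\<^sub>R h x)"
proof -
  obtain K M where K: "compact K" "K \<subseteq> U" "\<And>x. x \<notin> K \<Longrightarrow> \<phi> x = 0" "\<And>x. \<bar>\<phi> x\<bar> \<le> M"
    using \<phi> by (rule test_fun_support_obtain) blast
  have "h \<in> borel_measurable (lebesgue_on K)" "\<phi> \<in> borel_measurable (lebesgue_on K)"
    using h K test_fun_smooth[OF \<phi>]
    by (auto simp: loc_integrable_on_def intro: borel_measurable_integrable continuous_measurable_lebesgue_on[OF smooth_continuous])
  then show ?thesis
    by (intro loc_integrable_mult[OF h U K(1,2), where M=M]) (use K in \<open>auto intro!: mult_right_mono\<close>)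
qed

lemma loc_integrable_scaleR_grad:
  assumes \<phi>: "\<phi> \<in> test_fun U" and U: "open U" and v: "loc_integrable_on U v"
  shows "integrable (lebesgue_on U) (\<lambda>x. v x *\<^sub>R grad \<phi> x)"
proof -
  obtain K M where K: "compact K" "K \<subseteq> U" "\<And>x. x \<notin> K \<Longrightarrow> grad \<phi> x = 0" "\<And>x. norm (grad \<phi> x) \<le> M"
    using \<phi> by (rule test_fun_support_obtain) blast
  have "v \<in> borel_measurable (lebesgue_on K)" "grad \<phi> \<in> borel_measurable (lebesgue_on K)"
    using v K test_fun_smooth[OF \<phi>]
    by (auto simp: loc_integrable_on_def intro: borel_measurable_integrable continuous_measurable_lebesgue_on[OF smooth_grad_continuous])
  then show ?thesis
    by (intro loc_integrable_mult[OF v U K(1,2), where M=M])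
      (use K in \<open>auto simp: mult.commute[of M] intro!: mult_left_mono\<close>)
qed

lemma integrable_continuous_compact_support:
  fixes F :: "plane \<Rightarrow> 'b::euclidean_space"
  assumes "continuous_on UNIV F" "compact K" "\<And>x. x \<notin> K \<Longrightarrow> F x = 0" "open U" "K \<subseteq> U"
  shows "integrable (lebesgue_on U) F"
proof (rule loc_integrable_mult[where h="\<lambda>_. 1::real"])
  obtain M where M: "\<And>x. x \<in> K \<Longrightarrow> norm (F x) \<le> M"
    using compact_imp_bounded[OF compact_continuous_image[OF continuous_on_subset[OF assms(1)] assms(2)]]
    unfolding bounded_iff by auto
  then show "norm (F x) \<le> max 0 (SUP x\<in>K. norm (F x)) * norm (1::real)" if "x \<in> K" for x
    using cSUP_upper[OF that, of "\<lambda>x. norm (F x)"] by (fastforce simp: bdd_above_def)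
  show "loc_integrable_on U (\<lambda>_. 1::real)"
    unfolding loc_integrable_on_def
    using finite_measure_lebesgue_on lmeasurable_compact
    by (metis finite_measure.integrable_const)
qed (use assms in \<open>auto intro!: continuous_measurable_lebesgue_on intro: continuous_on_subset\<close>)

lemma
  assumes "\<phi> \<in> test_fun V" "V \<subseteq> U" "open U"
  shows Lp2_test_fun: "Lp_on 2 U \<phi>" and Lp2_grad_test_fun: "Lp_on 2 U (grad \<phi>)"
proof -
  obtain K where K: "compact K" "K \<subseteq> V" "\<And>x. x \<notin> K \<Longrightarrow> \<phi> x = 0" "\<And>x. x \<notin> K \<Longrightarrow> grad \<phi> x = 0"
    using assms(1) by (rule test_fun_support_obtain) blast
  note s = test_fun_smooth[OF assms(1)]
  show "Lp_on 2 U \<phi>" unfolding Lp2_iff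
    using s K assms by (intro conjI integrable_continuous_compact_support[where K=K] continuous_measurable_lebesgue_on
        continuous_on_power continuous_on_norm smooth_continuous) auto
  show "Lp_on 2 U (grad \<phi>)" unfolding Lp2_iff
    using s K assms by (intro conjI integrable_continuous_compact_support[where K=K] continuous_measurable_lebesgue_on
        continuous_on_power continuous_on_norm smooth_grad_continuous) auto
qed

section \<open>The fundamental lemma of the calculus of variations\<close>

lemma compact_neighbourhood:
  fixes K U :: "'a::euclidean_space set"
  assumes "compact K" "open U" "K \<subseteq> U"
  shows "\<exists>C. compact C \<and> C \<subseteq> U \<and> K \<subseteq> interior C"
proof -
  obtain C :: "nat \<Rightarrow> 'a set" where C: "\<And>n. compact (C n)" "\<And>n. C n \<subseteq> U" "\<And>n. C n \<subseteq> interior (C (Suc n))"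
      "\<Union> (range C) = U" "\<And>K. compact K \<Longrightarrow> K \<subseteq> U \<Longrightarrow> \<exists>N. \<forall>n\<ge>N. K \<subseteq> C n"
    by (rule open_Union_compact_subsets[OF assms(2)]) (rule that, assumption+)
  obtain N where "\<forall>n\<ge>N. K \<subseteq> C n" using C(5)[OF assms(1,3)] ..
  then have "K \<subseteq> interior (C (Suc N))" using C(3)[of N] by blast
  with C(1,2)[of "Suc N"] show ?thesis by blast
qed

text \<open>Cutoffs that are 1 on \<open>K\<close> and have supports shrinking to \<open>K\<close>
  converge pointwise to its indicator, so dominated convergence carries the hypothesis from test
  functions to \<open>K\<close>.\<close>

lemma integral_compact_eq_0:
  assumes U: "open U" and h: "loc_integrable_on U h" and K: "compact K" "K \<subseteq> U"
    and test: "\<And>\<phi>. \<phi> \<in> test_fun U \<Longrightarrow> (LINT x|lebesgue_on U. \<phi> x *\<^sub>R h x) = (0::'b::euclidean_space)"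
  shows "(LINT x|lebesgue_on K. h x) = 0"
\<comment> \<open>The empty set is split off because \<open>infdist\<close> to it is 0 by
  convention, so the neighbourhoods below would not shrink.\<close>
proof (cases "K = {}")
  case False
  \<comment> \<open>As \<open>h\<close> is only locally integrable, all cutoffs are confined to one
    compact set, over which the norm of \<open>h\<close> is an integrable majorant.\<close>
  obtain C where C: "compact C" "C \<subseteq> U" "K \<subseteq> interior C"
    using compact_neighbourhood[OF K(1) U K(2)] by (elim exE conjE)
  define V where "V n = interior C \<inter> {x. infdist x K < inverse (real (Suc n))}" for n
  have V: "open (V n)" "K \<subseteq> V n" for n
    using C(3) by (auto simp: V_def intro!: open_Collect_less continuous_intros)
  have "\<exists>\<eta>. \<eta> \<in> test_fun (V n) \<and> (\<forall>x. 0 \<le> \<eta> x \<and> \<eta> x \<le> 1) \<and> (\<forall>x\<in>K. \<eta> x = 1)" for n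
    by (rule smooth_Urysohn[OF K(1) V(1)[of n] V(2)]) (intro exI conjI ballI allI; assumption)
  then have "\<forall>n. \<exists>\<eta>. \<eta> \<in> test_fun (V n) \<and> (\<forall>x. 0 \<le> \<eta> x \<and> \<eta> x \<le> 1) \<and> (\<forall>x\<in>K. \<eta> x = 1)"
    by blast
  then obtain \<eta> where "\<forall>n. \<eta> n \<in> test_fun (V n) \<and> (\<forall>x. 0 \<le> \<eta> n x \<and> \<eta> n x \<le> 1) \<and> (\<forall>x\<in>K. \<eta> n x = 1)"
    unfolding choice_iff by (elim exE)
  then have \<eta>: "\<And>n. \<eta> n \<in> test_fun (V n)" "\<And>n x. 0 \<le> \<eta> n x \<and> \<eta> n x \<le> 1" "\<And>n x. x \<in> K \<Longrightarrow> \<eta> n x = 1"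
    by simp_all
  have out: "\<eta> n x = 0" if "x \<notin> V n" for n x
    using \<eta>(1)[of n] that by (auto simp: test_fun_iff)
  have VU: "V n \<subseteq> U" "V n \<subseteq> C" for n using C interior_subset by (auto simp: V_def)
  have hC: "integrable (lebesgue_on C) h" using h C by (auto simp: loc_integrable_on_def)
  have "(LINT x|lebesgue_on C. \<eta> n x *\<^sub>R h x) = (LINT x|lebesgue_on U. \<eta> n x *\<^sub>R h x)" for n
    by (rule integral_lebesgue_on_superset[symmetric]) (use C U VU(2)[of n] out[of _ n] in auto)
  moreover have "(LINT x|lebesgue_on U. \<eta> n x *\<^sub>R h x) = 0" for n
    using test_fun_mono[OF \<eta>(1) VU(1)] by (rule test)
  ultimately have 0: "(LINT x|lebesgue_on C. \<eta> n x *\<^sub>R h x) = 0" for n by simp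
  have "(\<lambda>n. LINT x|lebesgue_on C. \<eta> n x *\<^sub>R h x) \<longlonglongrightarrow> (LINT x|lebesgue_on C. (if x \<in> K then h x else 0))"
  proof (rule integral_dominated_convergence[where w="\<lambda>x. norm (h x)"])
    show "(\<lambda>x. if x \<in> K then h x else 0) \<in> borel_measurable (lebesgue_on C)"
      using borel_measurable_lebesgue_on_subset[OF borel_measurable_integrable[OF hC], of K]
        C(3) interior_subset[of C] K(1) C(1)
      by (subst borel_measurable_if_lebesgue_on) auto
    show "(\<lambda>x. \<eta> n x *\<^sub>R h x) \<in> borel_measurable (lebesgue_on C)" for n
      using hC C(1) test_fun_smooth[OF \<eta>(1)[of n]]
      by (intro borel_measurable_scaleR) (auto intro!: continuous_measurable_lebesgue_on smooth_continuous)
    show "AE x in lebesgue_on C. norm (\<eta> n x *\<^sub>R h x) \<le> norm (h x)" for n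
      using \<eta>(2)[of n] by (intro AE_I2) (simp add: mult_left_le_one_le)
    show "AE x in lebesgue_on C. (\<lambda>n. \<eta> n x *\<^sub>R h x) \<longlonglongrightarrow> (if x \<in> K then h x else 0)"
    proof (rule AE_I2)
      fix x
      show "(\<lambda>n. \<eta> n x *\<^sub>R h x) \<longlonglongrightarrow> (if x \<in> K then h x else 0)"
      proof (cases "x \<in> K")
        case True
        then show ?thesis using \<eta>(3) by simp
      next
        case False
        then have "infdist x K > 0"
          using K(1) \<open>K \<noteq> {}\<close> by (metis compact_imp_closed in_closed_iff_infdist_zero infdist_nonneg order_le_less)
        then have "\<forall>\<^sub>F n in sequentially. inverse (real (Suc n)) < infdist x K"
          by (rule order_tendstoD[OF LIMSEQ_inverse_real_of_nat])
        then have "\<forall>\<^sub>F n in sequentially. \<eta> n x *\<^sub>R h x = 0"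
        proof eventually_elim
          case (elim n)
          then have "x \<notin> V n" by (simp add: V_def)
          then show ?case by (simp add: out)
        qed
        with False show ?thesis by (simp add: tendsto_eventually)
      qed
    qed
  qed (use hC in auto)
  with 0 have "(LINT x|lebesgue_on C. (if x \<in> K then h x else 0)) = 0"
    by (simp add: LIMSEQ_const_iff)
  then show ?thesis
    using integral_restrict[of K C h] C K interior_subset[of C] by auto
qed simp

text \<open>Inner regularity: up to a null set, the set where \<open>h\<close> is positive is a
  countable union of compact sets. On each of them a positive function has integral 0, so each is a
  null set.\<close>

lemma null_sets_pos_part:
  fixes h :: "plane \<Rightarrow> real"
  assumes C: "compact C" and h: "integrable (lebesgue_on C) h"
    and 0: "\<And>F. compact F \<Longrightarrow> F \<subseteq> C \<Longrightarrow> (LINT x|lebesgue_on F. h x) = 0"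
  shows "{x\<in>C. 0 < h x} \<in> null_sets lebesgue"
proof -
  let ?E = "{x\<in>C. 0 < h x}"
  have E: "?E \<in> sets lebesgue"
  proof -
    have "{x \<in> space (lebesgue_on C). 0 < h x} \<in> sets (lebesgue_on C)"
      using h by measurable
    then show ?thesis using C by (auto simp: sets_restrict_space_iff)
  qed
  obtain D N where D: "fsigma D" and N: "N \<in> null_sets lebesgue" and DN: "D \<union> N = ?E"
    using lebesgue_set_almost_fsigma[OF E] by metis
  obtain F :: "nat \<Rightarrow> plane set" where F: "range F \<subseteq> Collect compact" "D = \<Union> (range F)"
    using fsigma_Union_compact[of D] D by auto
  have "F n \<in> null_sets lebesgue" for n
  proof -
    have Fn: "compact (F n)" "F n \<subseteq> ?E" using F DN by auto
    have hF: "integrable (lebesgue_on (F n)) h"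
      using Fn C by (intro integrable_lebesgue_on_subset[OF h]) auto
    have "AE x in lebesgue_on (F n). 0 \<le> h x"
      using Fn by (intro AE_I2) (auto simp: less_imp_le)
    moreover have "(LINT x|lebesgue_on (F n). h x) = 0" using 0[of "F n"] Fn by auto
    ultimately have "AE x in lebesgue_on (F n). h x = 0"
      using integral_nonneg_eq_0_iff_AE[OF hF] by simp
    then have "AE x in lebesgue. x \<in> F n \<longrightarrow> h x = 0"
      using Fn by (simp add: AE_restrict_space_iff)
    then have "AE x in lebesgue. x \<notin> F n"
      by eventually_elim (use Fn in auto)
    then show ?thesis using Fn by (simp add: completion.null_sets_iff_AE)
  qed
  then have "D \<in> null_sets lebesgue" unfolding F(2) by blast
  then have "D \<union> N \<in> null_sets lebesgue" using N by (rule null_sets.Un)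
  then show ?thesis by (simp only: DN)
qed

text \<open>Applied to \<open>h\<close> and \<open>- h\<close> on an exhaustion of \<open>U\<close>
  by compact sets, the previous lemma exhibits the set where \<open>h\<close> is nonzero as a
  countable union of null sets.\<close>

lemma fundamental_lemma_real:
  fixes h :: "plane \<Rightarrow> real"
  assumes U: "open U" and h: "loc_integrable_on U h"
    and 0: "\<And>F. compact F \<Longrightarrow> F \<subseteq> U \<Longrightarrow> (LINT x|lebesgue_on F. h x) = 0"
  shows "AE x in lebesgue_on U. h x = 0"
proof -
  obtain C :: "nat \<Rightarrow> plane set" where C: "\<And>n. compact (C n)" "\<And>n. C n \<subseteq> U" "\<And>n. C n \<subseteq> interior (C (Suc n))"
      "\<Union> (range C) = U" "\<And>K. compact K \<Longrightarrow> K \<subseteq> U \<Longrightarrow> \<exists>N. \<forall>n\<ge>N. K \<subseteq> C n"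
    by (rule open_Union_compact_subsets[OF U]) (rule that, assumption+)
  have "{x\<in>C n. 0 < h x} \<in> null_sets lebesgue" "{x\<in>C n. 0 < - h x} \<in> null_sets lebesgue" for n
  proof -
    have "integrable (lebesgue_on (C n)) h" using h C(1,2) by (simp add: loc_integrable_on_def)
    moreover have "(LINT x|lebesgue_on F. h x) = 0" if "compact F" "F \<subseteq> C n" for F
      using 0 that C(2)[of n] by (meson order_trans)
    ultimately show "{x\<in>C n. 0 < h x} \<in> null_sets lebesgue" "{x\<in>C n. 0 < - h x} \<in> null_sets lebesgue"
      using C(1)[of n] by (simp_all add: null_sets_pos_part del: neg_0_less_iff_less)
  qed
  then have "(\<Union>n. {x\<in>C n. 0 < h x} \<union> {x\<in>C n. 0 < - h x}) \<in> null_sets lebesgue" by blast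
  also have "(\<Union>n. {x\<in>C n. 0 < h x} \<union> {x\<in>C n. 0 < - h x}) = {x\<in>U. h x \<noteq> 0}"
    using C(4) by auto
  finally show ?thesis
    using U by (auto simp: AE_restrict_space_iff completion.AE_iff_null_sets cong: conj_cong)
qed

text \<open>Components along the basis reduce the claim to real functions. Weak gradients use the
  vector-valued case, weak divergences the real one.\<close>

lemma fundamental_lemma:
  fixes h :: "plane \<Rightarrow> 'b::euclidean_space"
  assumes U: "open U" and h: "loc_integrable_on U h"
    and test: "\<And>\<phi>. \<phi> \<in> test_fun U \<Longrightarrow> (LINT x|lebesgue_on U. \<phi> x *\<^sub>R h x) = 0"
  shows "AE x in lebesgue_on U. h x = 0"
proof -
  have "AE x in lebesgue_on U. h x \<bullet> b = 0" if "b \<in> Basis" for b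
  proof (rule fundamental_lemma_real[OF U])
    show "loc_integrable_on U (\<lambda>x. h x \<bullet> b)" using h by (auto simp: loc_integrable_on_def)
    fix F assume F: "compact F" "F \<subseteq> U"
    have "(LINT x|lebesgue_on F. h x \<bullet> b) = (LINT x|lebesgue_on F. h x) \<bullet> b"
      using h F by (intro integral_inner_left) (auto simp: loc_integrable_on_def)
    also have "\<dots> = 0" using integral_compact_eq_0[OF U h F test] by simp
    finally show "(LINT x|lebesgue_on F. h x \<bullet> b) = 0" .
  qed
  then have "AE x in lebesgue_on U. \<forall>b\<in>Basis. h x \<bullet> b = 0"
    by (intro AE_finite_allI) auto
  then show ?thesis by eventually_elim (simp add: euclidean_all_zero_iff)
qed

section \<open>Uniqueness of weak derivatives and their representatives\<close>

lemma loc_integrable_diff: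
  "loc_integrable_on U f \<Longrightarrow> loc_integrable_on U g \<Longrightarrow> loc_integrable_on U (\<lambda>x. f x - g x)"
  by (auto simp: loc_integrable_on_def)

lemma weak_grad_unique:
  assumes U: "open U" and g: "has_weak_grad U v g" and g': "has_weak_grad U v g'"
  shows "AE x in lebesgue_on U. g x = g' x"
proof -
  have li: "loc_integrable_on U g" "loc_integrable_on U g'" using g g' by (auto simp: has_weak_grad_def)
  have "AE x in lebesgue_on U. g x - g' x = 0"
  proof (rule fundamental_lemma[OF U loc_integrable_diff[OF li]])
    fix \<phi> assume \<phi>: "\<phi> \<in> test_fun U"
    have "(LINT x|lebesgue_on U. \<phi> x *\<^sub>R g x) = (LINT x|lebesgue_on U. \<phi> x *\<^sub>R g' x)"
      using g g' \<phi> unfolding has_weak_grad_def by simp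
    then show "(LINT x|lebesgue_on U. \<phi> x *\<^sub>R (g x - g' x)) = 0"
      using loc_integrable_test[OF \<phi> U li(1)] loc_integrable_test[OF \<phi> U li(2)] by (simp add: scaleR_diff_right)
  qed
  then show ?thesis by simp
qed

lemma weak_div_unique:
  assumes U: "open U" and d: "has_weak_div U \<tau> d" and d': "has_weak_div U \<tau> d'"
  shows "AE x in lebesgue_on U. d x = d' x"
proof -
  have li: "loc_integrable_on U d" "loc_integrable_on U d'" using d d' by (auto simp: has_weak_div_def)
  have "AE x in lebesgue_on U. d x - d' x = 0"
  proof (rule fundamental_lemma[OF U loc_integrable_diff[OF li]])
    fix \<phi> assume \<phi>: "\<phi> \<in> test_fun U"
    have "(LINT x|lebesgue_on U. \<phi> x * d x) = (LINT x|lebesgue_on U. \<phi> x * d' x)"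
      using d d' \<phi> unfolding has_weak_div_def by simp
    then show "(LINT x|lebesgue_on U. \<phi> x *\<^sub>R (d x - d' x)) = 0"
      using loc_integrable_test[OF \<phi> U li(1)] loc_integrable_test[OF \<phi> U li(2)] by (simp add: right_diff_distrib)
  qed
  then show ?thesis by simp
qed

lemma has_weak_grad_weak_grad: "has_weak_grad U v g \<Longrightarrow> has_weak_grad U v (weak_grad U v)"
  unfolding weak_grad_def by (rule someI[of "has_weak_grad U v"])

lemma has_weak_div_weak_div: "has_weak_div U v g \<Longrightarrow> has_weak_div U v (weak_div U v)"
  unfolding weak_div_def by (rule someI[of "has_weak_div U v"])

text \<open>Membership in the Sobolev space supplies some square-integrable gradient; uniqueness
  almost everywhere hands integrability on to the representative picked by choice.\<close>

lemma Lp2_weak_grad: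
  assumes "open U" "W1_on 2 U v"
  shows "has_weak_grad U v (weak_grad U v)" "Lp_on 2 U (weak_grad U v)"
proof -
  obtain g where g: "has_weak_grad U v g" "Lp_on 2 U g" using assms by (auto simp: W1_on_def)
  show *: "has_weak_grad U v (weak_grad U v)" using g(1) by (rule has_weak_grad_weak_grad)
  show "Lp_on 2 U (weak_grad U v)"
    by (rule Lp2_AE[OF sets_lebesgue_open[OF assms(1)] g(2) weak_grad_unique[OF assms(1) g(1) *]])
qed

lemma Lp2_weak_div:
  assumes "open U" "Hdiv_on U \<tau>"
  shows "has_weak_div U \<tau> (weak_div U \<tau>)" "Lp_on 2 U (weak_div U \<tau>)"
proof -
  obtain d where d: "has_weak_div U \<tau> d" "Lp_on 2 U d" using assms by (auto simp: Hdiv_on_def)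
  show *: "has_weak_div U \<tau> (weak_div U \<tau>)" using d(1) by (rule has_weak_div_weak_div)
  show "Lp_on 2 U (weak_div U \<tau>)"
    by (rule Lp2_AE[OF sets_lebesgue_open[OF assms(1)] d(2) weak_div_unique[OF assms(1) d(1) *]])
qed

section \<open>Integration by parts for test functions\<close>

lemma continuous_borel_lborel: "continuous_on UNIV f \<Longrightarrow> f \<in> borel_measurable lborel"
  by (simp add: borel_measurable_continuous_onI)

text \<open>Bounds all difference quotients by one constant, as dominated convergence will
  require.\<close>

lemma smooth_Lipschitz:
  assumes s: "smooth \<phi>" and M: "\<And>x. norm (grad \<phi> x) \<le> M"
  shows "\<bar>\<phi> x - \<phi> y\<bar> \<le> M * norm (x - y)"
proof -
  have "norm (\<phi> x - \<phi> y) \<le> M * norm (x - y)"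
  proof (rule differentiable_bound[of UNIV _ "\<lambda>x v. grad \<phi> x \<bullet> v"])
    fix z :: plane
    show "(\<phi> has_derivative (\<bullet>) (grad \<phi> z)) (at z)" by (rule smooth_has_derivative[OF s])
    have "norm (grad \<phi> z \<bullet> v) \<le> M * norm v" for v
      using Cauchy_Schwarz_ineq2[of "grad \<phi> z" v] mult_right_mono[OF M[of z] norm_ge_zero[of v]] by simp
    then show "onorm ((\<bullet>) (grad \<phi> z)) \<le> M" by (rule onorm_le)
  qed auto
  then show ?thesis by simp
qed

text \<open>The integral of a difference quotient vanishes by translation invariance.\<close>

lemma integral_partial_test_fun:
  assumes \<phi>: "\<phi> \<in> test_fun UNIV"
  shows "(LINT x|lborel. grad \<phi> x \<bullet> e) = 0"
proof -
  obtain K M where K: "compact K" "\<And>x. x \<notin> K \<Longrightarrow> \<phi> x = 0" "\<And>x. x \<notin> K \<Longrightarrow> grad \<phi> x = 0"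
    "0 < M" "\<And>x. \<bar>\<phi> x\<bar> \<le> M" "\<And>x. norm (grad \<phi> x) \<le> M"
    using \<phi> by (rule test_fun_support_obtain) blast
  note s = test_fun_smooth[OF \<phi>]
  obtain R where R: "\<And>x. x \<in> K \<Longrightarrow> norm x \<le> R"
    using compact_imp_bounded[OF K(1)] unfolding bounded_iff by auto
  have cont: "continuous_on UNIV \<phi>" "continuous_on UNIV (grad \<phi>)"
    using s by (auto intro: smooth_continuous smooth_grad_continuous)
  have meas [measurable]: "\<phi> \<in> borel_measurable lborel" "grad \<phi> \<in> borel_measurable lborel"
    using cont by (auto intro: borel_measurable_continuous_onI)
  have int: "integrable lborel \<phi>"
  proof (rule Bochner_Integration.integrable_bound[where f="\<lambda>x. M * indicator (cball 0 R) x"])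
    show "integrable lborel (\<lambda>x. M * indicat_real (cball 0 R) x)"
      by (intro integrable_mult_right integrable_real_indicator emeasure_bounded_finite) auto
    show "AE x in lborel. norm (\<phi> x) \<le> norm (M * indicat_real (cball 0 R) x)"
    proof (rule AE_I2)
      fix x
      show "norm (\<phi> x) \<le> norm (M * indicat_real (cball 0 R) x)"
      proof (cases "x \<in> K")
        case True
        then show ?thesis using R[OF True] K(5)[of x] by (simp add: indicator_def)
      qed (simp add: K(2))
    qed
  qed (rule meas)
  have trans: "integrable lborel (\<lambda>x. \<phi> (c + x))" "(LINT x|lborel. \<phi> (c + x)) = (LINT x|lborel. \<phi> x)" for c
    using int by (simp_all add: integrable_distr_eq[symmetric, of "(+) c" lborel borel \<phi>]
        integral_distr[symmetric, of "(+) c" lborel borel \<phi>] lborel_distr_plus)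
  define s where "s n x = (\<phi> (inverse (real (Suc n)) *\<^sub>R e + x) - \<phi> x) / inverse (real (Suc n))" for n x
  have "(\<lambda>n. LINT x|lborel. s n x) \<longlonglongrightarrow> (LINT x|lborel. grad \<phi> x \<bullet> e)"
  \<comment> \<open>Steps of length at most 1 along \<open>e\<close> shift the support by at most
    the norm of \<open>e\<close>. One ball of radius \<open>R + norm e\<close> therefore carries all
    difference quotients, and the Lipschitz bound controls them there.\<close>
  proof (rule integral_dominated_convergence[where w="\<lambda>x. M * norm e * indicator (cball 0 (R + norm e)) x"])
    show "integrable lborel (\<lambda>x. M * norm e * indicat_real (cball 0 (R + norm e)) x)"
      by (intro integrable_mult_right integrable_real_indicator emeasure_bounded_finite) auto
    show "s n \<in> borel_measurable lborel" for n
      unfolding s_def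
      by (intro borel_measurable_divide borel_measurable_diff borel_measurable_const meas
          borel_measurable_integrable[OF trans(1)])
    show "AE x in lborel. (\<lambda>n. s n x) \<longlonglongrightarrow> grad \<phi> x \<bullet> e"
    proof (rule AE_I2)
      fix x :: plane
      have "((\<lambda>t. t *\<^sub>R e + x) has_derivative (\<lambda>t. t *\<^sub>R e)) (at 0)"
        by (auto intro!: derivative_eq_intros)
      moreover have "(\<phi> has_derivative (\<bullet>) (grad \<phi> x)) (at (0 *\<^sub>R e + x))"
        using smooth_has_derivative[OF test_fun_smooth[OF \<phi>]] by simp
      ultimately have "((\<lambda>t. \<phi> (t *\<^sub>R e + x)) has_derivative (\<lambda>t. grad \<phi> x \<bullet> (t *\<^sub>R e))) (at 0)"
        by (rule has_derivative_compose)
      then have "((\<lambda>t. \<phi> (t *\<^sub>R e + x)) has_real_derivative (grad \<phi> x \<bullet> e)) (at 0)"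
        by (simp add: has_field_derivative_def mult.commute[of _ "grad \<phi> x \<bullet> e"])
      then have "((\<lambda>t. (\<phi> (t *\<^sub>R e + x) - \<phi> x) / t) \<longlongrightarrow> grad \<phi> x \<bullet> e) (at 0)"
        by (simp add: DERIV_def)
      moreover have "filterlim (\<lambda>n. inverse (real (Suc n))) (at 0) sequentially"
        by (simp add: filterlim_at LIMSEQ_inverse_real_of_nat del: of_nat_Suc)
      ultimately show "(\<lambda>n. s n x) \<longlonglongrightarrow> grad \<phi> x \<bullet> e"
        unfolding s_def by (rule filterlim_compose)
    qed
    show "AE x in lborel. norm (s n x) \<le> M * norm e * indicat_real (cball 0 (R + norm e)) x" for n
    proof (rule AE_I2)
      fix x
      define t where "t = inverse (real (Suc n))"
      have t: "0 < t" "t \<le> 1" by (auto simp: t_def inverse_le_1_iff simp del: of_nat_Suc)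
      show "norm (s n x) \<le> M * norm e * indicat_real (cball 0 (R + norm e)) x"
      proof (cases "x \<in> cball 0 (R + norm e)")
        case True
        have "\<bar>\<phi> (t *\<^sub>R e + x) - \<phi> x\<bar> \<le> M * norm (t *\<^sub>R e + x - x)"
          by (rule smooth_Lipschitz[OF test_fun_smooth[OF \<phi>] K(6)])
        also have "\<dots> = M * norm e * t" using t by simp
        finally have "\<bar>\<phi> (t *\<^sub>R e + x) - \<phi> x\<bar> / t \<le> M * norm e"
          using t(1) by (simp add: pos_divide_le_eq)
        moreover have "norm (s n x) = \<bar>\<phi> (t *\<^sub>R e + x) - \<phi> x\<bar> / t"
          using t(1) unfolding s_def t_def[symmetric] by simp
        ultimately show ?thesis using True by simp
      next
        case False
        then have "norm x > R + norm e" by simp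
        moreover have "norm (t *\<^sub>R e) \<le> norm e" using t by (simp add: mult_left_le_one_le)
        ultimately have "norm (t *\<^sub>R e + x) > R" "norm x > R"
          using norm_diff_ineq[of x "t *\<^sub>R e"] norm_ge_zero[of e] by (auto simp: add.commute[of _ x] simp del: norm_ge_zero)
        then have "t *\<^sub>R e + x \<notin> K" "x \<notin> K" using R by force+
        then show ?thesis using K(2) False unfolding s_def t_def[symmetric] by simp
      qed
    qed
  qed (auto intro!: borel_measurable_continuous_onI continuous_intros cont)
  moreover have "(LINT x|lborel. s n x) = 0" for n
    unfolding s_def using trans int by simp
  ultimately show ?thesis by (simp add: LIMSEQ_const_iff)
qed

section \<open>Integration by parts on open sets\<close>

lemma continuous_loc_integrable:
  "continuous_on U f \<Longrightarrow> loc_integrable_on U f"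
  unfolding loc_integrable_on_def
proof safe
  fix K assume f: "continuous_on U f" and K: "compact K" "K \<subseteq> U"
  have f': "continuous_on K f" using f K(2) by (rule continuous_on_subset)
  obtain M where M: "\<And>x. x \<in> K \<Longrightarrow> norm (f x) \<le> M"
    using compact_imp_bounded[OF compact_continuous_image[OF f' K(1)]] unfolding bounded_iff by auto
  show "integrable (lebesgue_on K) f"
  proof (rule Bochner_Integration.integrable_bound[where f="\<lambda>_. M"])
    show "integrable (lebesgue_on K) (\<lambda>_. M)"
      using K(1) by (intro finite_measure.integrable_const finite_measure_lebesgue_on lmeasurable_compact)
    show "AE x in lebesgue_on K. norm (f x) \<le> norm M"
      using M by (intro AE_I2) force
  qed (use f' K in \<open>auto intro: continuous_measurable_lebesgue_on\<close>)
qed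

lemma integrable_grad_test_fun:
  assumes "\<phi> \<in> test_fun U" "open U"
  shows "integrable (lebesgue_on U) (grad \<phi>)"
  using loc_integrable_scaleR_grad[OF assms continuous_loc_integrable[OF continuous_on_const[of U 1]]] by simp

lemma integral_grad_test_fun:
  assumes \<phi>: "\<phi> \<in> test_fun U" and U: "open U"
  shows "(LINT x|lebesgue_on U. grad \<phi> x) = 0"
proof -
  obtain K where K: "compact K" "K \<subseteq> U" "\<And>x. x \<notin> K \<Longrightarrow> grad \<phi> x = 0"
    using \<phi> by (rule test_fun_support_obtain) blast
  have g0: "grad \<phi> x = 0" if "x \<notin> U" for x using K(2,3) that by blast
  have \<phi>': "\<phi> \<in> test_fun UNIV" using \<phi> by (rule test_fun_mono) simp
  have "(LINT x|lebesgue_on U. grad \<phi> x) \<bullet> e = 0" for e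
  proof -
    have "(LINT x|lebesgue_on U. grad \<phi> x) \<bullet> e = (LINT x|lebesgue_on U. grad \<phi> x \<bullet> e)"
      using integrable_grad_test_fun[OF \<phi> U] by simp
    also have "\<dots> = (LINT x|lebesgue_on UNIV. grad \<phi> x \<bullet> e)"
      by (rule integral_lebesgue_on_superset[symmetric]) (use U g0 in auto)
    also have "\<dots> = (LINT x|lborel. grad \<phi> x \<bullet> e)"
      unfolding lebesgue_on_UNIV_eq using test_fun_smooth[OF \<phi>]
      by (intro integral_completion continuous_borel_lborel continuous_intros smooth_grad_continuous)
    also have "\<dots> = 0" by (rule integral_partial_test_fun[OF \<phi>'])
    finally show ?thesis .
  qed
  then show ?thesis by (metis inner_eq_zero_iff)
qed

lemma integral_test_fun_subset:
  fixes F :: "plane \<Rightarrow> 'b::euclidean_space"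
  assumes \<phi>: "\<phi> \<in> test_fun V" and "V \<subseteq> U" "open U" "open V"
    and F: "\<And>x. \<phi> x = 0 \<Longrightarrow> grad \<phi> x = 0 \<Longrightarrow> F x = 0"
  shows "(LINT x|lebesgue_on U. F x) = (LINT x|lebesgue_on V. F x)"
proof -
  obtain K where "K \<subseteq> V" "\<And>x. x \<notin> K \<Longrightarrow> \<phi> x = 0" "\<And>x. x \<notin> K \<Longrightarrow> grad \<phi> x = 0"
    using \<phi> by (rule test_fun_support_obtain) blast
  then show ?thesis using assms by (intro integral_lebesgue_on_superset) (auto intro!: F)
qed

lemma has_weak_grad_subset:
  assumes g: "has_weak_grad U v g" and V: "V \<subseteq> U" "open U" "open V"
  shows "has_weak_grad V v g"
  unfolding has_weak_grad_def
proof (intro conjI ballI)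
  fix \<phi> assume \<phi>: "\<phi> \<in> test_fun V"
  then have "\<phi> \<in> test_fun U" using V(1) by (rule test_fun_mono)
  then show "(LINT x|lebesgue_on V. v x *\<^sub>R grad \<phi> x) = - (LINT x|lebesgue_on V. \<phi> x *\<^sub>R g x)"
    using g integral_test_fun_subset[OF \<phi> V, of "\<lambda>x. v x *\<^sub>R grad \<phi> x"]
      integral_test_fun_subset[OF \<phi> V, of "\<lambda>x. \<phi> x *\<^sub>R g x"] by (simp add: has_weak_grad_def)
qed (use g V in \<open>auto simp: has_weak_grad_def loc_integrable_on_def\<close>)

text \<open>The product of \<phi> with the affine function is again a test function, so its gradient
  integrates to 0; the product rule turns this into the identity wanted. The globally smooth affine
  function stands in for \<open>v\<close>, which agrees with it only on \<open>U\<close>.\<close>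

lemma has_weak_grad_affine:
  assumes U: "open U" and v: "\<And>x. x \<in> U \<Longrightarrow> v x = a \<bullet> x + b"
  shows "has_weak_grad U v (\<lambda>_. a)"
  unfolding has_weak_grad_def
proof (intro conjI ballI)
  have "continuous_on U v \<longleftrightarrow> continuous_on U (\<lambda>x. a \<bullet> x + b)"
    using v by (intro continuous_on_cong) auto
  then have cont: "continuous_on U v" by (simp add: continuous_intros)
  then show li: "loc_integrable_on U v" "loc_integrable_on U (\<lambda>_. a)"
    by (auto intro: continuous_loc_integrable)
  fix \<phi> assume \<phi>: "\<phi> \<in> test_fun U"
  have s: "smooth (\<lambda>x. a \<bullet> x + b)" by (intro smooth_add smooth_inner smooth_const)
  have \<psi>: "(\<lambda>x. \<phi> x * (a \<bullet> x + b)) \<in> test_fun U" using \<phi> s by (rule test_fun_mult_smooth)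
  have ga: "grad (\<lambda>x. a \<bullet> x + b) x = a" for x
    by (rule grad_eqI) (auto intro!: derivative_eq_intros)
  have "0 = (LINT x|lebesgue_on U. grad (\<lambda>x. \<phi> x * (a \<bullet> x + b)) x)"
    using integral_grad_test_fun[OF \<psi> U] by simp
  also have "\<dots> = (LINT x|lebesgue_on U. \<phi> x *\<^sub>R a + v x *\<^sub>R grad \<phi> x)"
    by (intro Bochner_Integration.integral_cong) (auto simp: grad_mult[OF test_fun_smooth[OF \<phi>] s] ga v)
  also have "\<dots> = (LINT x|lebesgue_on U. \<phi> x *\<^sub>R a) + (LINT x|lebesgue_on U. v x *\<^sub>R grad \<phi> x)"
    by (intro Bochner_Integration.integral_add loc_integrable_test[OF \<phi> U li(2)] loc_integrable_scaleR_grad[OF \<phi> U li(1)])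
  finally show "(LINT x|lebesgue_on U. v x *\<^sub>R grad \<phi> x) = - (LINT x|lebesgue_on U. \<phi> x *\<^sub>R a)"
    unfolding eq_neg_iff_add_eq_0 by (simp only: add.commute)
qed

text \<open>A constant field is divergence-free because gradients of test functions integrate to 0.
  The hypothesis is an almost everywhere one since the field will be a chosen weak gradient of a
  piecewise linear function.\<close>

lemma has_weak_div_AE_const:
  assumes U: "open U" and G: "loc_integrable_on U G" "G \<in> borel_measurable (lebesgue_on U)"
    "AE x in lebesgue_on U. G x = a"
  shows "has_weak_div U G (\<lambda>_. 0)"
  unfolding has_weak_div_def
proof (intro conjI ballI)
  show "loc_integrable_on U G" by (rule G)
  show "loc_integrable_on U (\<lambda>_. 0::real)" by (simp add: loc_integrable_on_def)
  fix \<phi> assume \<phi>: "\<phi> \<in> test_fun U"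
  have gm: "grad \<phi> \<in> borel_measurable (lebesgue_on U)"
    by (rule borel_measurable_integrable[OF integrable_grad_test_fun[OF \<phi> U]])
  have "(LINT x|lebesgue_on U. G x \<bullet> grad \<phi> x) = (LINT x|lebesgue_on U. a \<bullet> grad \<phi> x)"
    using G(2,3) gm by (intro integral_cong_AE) (auto elim: AE_mp)
  also have "\<dots> = a \<bullet> (LINT x|lebesgue_on U. grad \<phi> x)"
    using integrable_grad_test_fun[OF \<phi> U] by simp
  finally show "(LINT x|lebesgue_on U. G x \<bullet> grad \<phi> x) = - (LINT x|lebesgue_on U. \<phi> x * 0)"
    by (simp add: integral_grad_test_fun[OF \<phi> U])
qed

section \<open>Geometry of the mesh\<close>

locale mesh =
  fixes \<T> :: "plane set set" and \<Omega> :: "plane set"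
  assumes triangulation: "triangulation_of \<T> \<Omega>" and open_domain: "open \<Omega>"
begin

lemma finite_mesh: "finite \<T>"
  and simplex: "T \<in> \<T> \<Longrightarrow> 2 simplex T"
  and Int_face: "T \<in> \<T> \<Longrightarrow> T' \<in> \<T> \<Longrightarrow> T \<inter> T' face_of T"
  and Union_mesh: "\<Union>\<T> = closure \<Omega>"
  and frontier_domain: "frontier \<Omega> = \<Union>{S \<in> mesh_edges \<T>. S \<subseteq> frontier \<Omega>}"
  using triangulation by (auto simp: triangulation_of_def triangulation_def)

lemma convex: "T \<in> \<T> \<Longrightarrow> convex T"
  and compact: "T \<in> \<T> \<Longrightarrow> compact T"
  and closed: "T \<in> \<T> \<Longrightarrow> closed T"
  and aff_dim: "T \<in> \<T> \<Longrightarrow> aff_dim T = 2"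
  and polyhedron: "T \<in> \<T> \<Longrightarrow> polyhedron T"
  using simplex convex_simplex compact_simplex closed_simplex aff_dim_simplex simplex_imp_polyhedron
  by blast+

text \<open>A triangle has full affine dimension, so the relative notions of the theory of faces
  become the topological ones of the plane.\<close>

lemma rel_interior_eq: "T \<in> \<T> \<Longrightarrow> rel_interior T = interior T"
  and rel_frontier_eq: "T \<in> \<T> \<Longrightarrow> rel_frontier T = frontier T"
proof -
  assume "T \<in> \<T>"
  then have "affine hull T = UNIV"
    using aff_dim_eq_full[of T] aff_dim[of T] by simp
  then show "rel_interior T = interior T" "rel_frontier T = frontier T"
    by (simp_all add: rel_interior_interior rel_frontier_def frontier_def)
qed

text \<open>If the common face were all of \<open>T'\<close>, then \<open>T'\<close> would be a
  proper face of \<open>T\<close> and have smaller dimension, although both have dimension 2. A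
  proper face misses the interior.\<close>

lemma Int_interior_empty:
  assumes "T \<in> \<T>" "T' \<in> \<T>" "T \<noteq> T'"
  shows "T \<inter> interior T' = {}"
proof -
  have f: "T' \<inter> T face_of T'" "T \<inter> T' face_of T" using assms Int_face by auto
  have "T' \<inter> T \<noteq> T'"
  proof
    assume eq: "T' \<inter> T = T'"
    then have "T' face_of T" using f(2) by (simp add: Int_commute)
    then have "aff_dim T' < aff_dim T"
      using assms by (intro face_of_aff_dim_lt convex) auto
    then show False using assms aff_dim by simp
  qed
  then have "(T' \<inter> T) \<inter> interior T' = {}" using face_of_disjoint_interior[OF f(1)] by blast
  then show ?thesis using interior_subset[of T'] by blast
qed

lemma interior_disjoint:
  "T \<in> \<T> \<Longrightarrow> T' \<in> \<T> \<Longrightarrow> T \<noteq> T' \<Longrightarrow> interior T \<inter> interior T' = {}"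
  using Int_interior_empty[of T T'] interior_subset[of T] by blast

lemma edge_Int_interior_empty:
  assumes "T \<in> \<T>" "T' \<in> \<T>" "S edge_of T"
  shows "S \<inter> interior T' = {}"
proof (cases "T = T'")
  case True
  have "S \<noteq> T" using assms aff_dim[of T] by (auto simp: edge_of_def)
  then show ?thesis using assms True face_of_disjoint_interior by (auto simp: edge_of_def)
next
  case False
  then show ?thesis using Int_interior_empty assms edge_of_imp_subset by blast
qed

text \<open>A point of the closure outside the open set \<Omega> lies on a boundary edge, possibly a
  crack, and edges of the mesh meet no interior of a triangle.\<close>

lemma interior_subset_domain:
  assumes "T \<in> \<T>"
  shows "interior T \<subseteq> \<Omega>"
proof
  fix x assume x: "x \<in> interior T"
  then have "x \<in> closure \<Omega>" using assms Union_mesh interior_subset by blast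
  moreover have "x \<notin> frontier \<Omega>"
  proof
    assume "x \<in> frontier \<Omega>"
    then obtain S where "S \<in> mesh_edges \<T>" "x \<in> S" using frontier_domain by blast
    then show False using edge_Int_interior_empty[OF _ assms] x by (auto simp: mesh_edges_def)
  qed
  ultimately show "x \<in> \<Omega>" using open_domain by (auto simp: frontier_def interior_open)
qed

section \<open>Elementwise measurability and integration\<close>

lemma domain_subset_Union: "\<Omega> \<subseteq> \<Union>\<T>"
  using Union_mesh closure_subset by blast

lemma AE_in_interior: "AE x in lebesgue. x \<in> \<Omega> \<longleftrightarrow> x \<in> (\<Union>T\<in>\<T>. interior T)"
proof -
  have "negligible (\<Union>T\<in>\<T>. frontier T)"
    using finite_mesh convex by (intro negligible_Union) (auto intro: negligible_convex_frontier)
  then have "(\<Union>T\<in>\<T>. frontier T) \<in> null_sets lebesgue" by (simp add: negligible_iff_null_sets)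
  then have "AE x in lebesgue. x \<notin> (\<Union>T\<in>\<T>. frontier T)" by (rule AE_not_in)
  then show ?thesis
  proof eventually_elim
    case (elim x)
    show ?case
    proof
      assume "x \<in> \<Omega>"
      then obtain T where T: "T \<in> \<T>" "x \<in> T" using domain_subset_Union by blast
      then have "x \<in> interior T" using elim closed[of T] by (auto simp: frontier_def)
      with T show "x \<in> (\<Union>T\<in>\<T>. interior T)" by blast
    qed (use interior_subset_domain in blast)
  qed
qed

text \<open>Interiors are disjoint, so at most one summand survives, and what they miss of \<Omega>
  lies on finitely many frontiers of convex sets, hence in a null set.\<close>

lemma AE_split:
  fixes F :: "plane \<Rightarrow> 'b::euclidean_space"
  shows "AE x in lebesgue. (\<Sum>T\<in>\<T>. if x \<in> interior T then F x else 0) = (if x \<in> \<Omega> then F x else 0)"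
  using AE_in_interior
proof eventually_elim
  case (elim x)
  show ?case
  proof (cases "x \<in> \<Omega>")
    case True
    then obtain T where T: "T \<in> \<T>" "x \<in> interior T" using elim by blast
    have "(\<Sum>T'\<in>\<T>. if x \<in> interior T' then F x else 0) = (\<Sum>T'\<in>\<T>. if T' = T then F x else 0)"
      using T interior_disjoint by (intro sum.cong) (auto simp: disjoint_iff)
    also have "\<dots> = F x" using finite_mesh T by simp
    finally show ?thesis using True by simp
  next
    case False
    then show ?thesis using elim by (auto intro!: sum.neutral)
  qed
qed

lemma measurable_mesh:
  fixes F :: "plane \<Rightarrow> 'b::euclidean_space"
  assumes "\<And>T. T \<in> \<T> \<Longrightarrow> F \<in> borel_measurable (lebesgue_on (interior T))"
  shows "F \<in> borel_measurable (lebesgue_on \<Omega>)"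
proof -
  have "(\<lambda>x. \<Sum>T\<in>\<T>. if x \<in> interior T then F x else 0) \<in> borel_measurable lebesgue"
    using assms by (intro borel_measurable_sum borel_measurable_if_I) auto
  then have "(\<lambda>x. if x \<in> \<Omega> then F x else 0) \<in> borel_measurable lebesgue"
    by (rule borel_measurable_lebesgue_on_AE[of UNIV, unfolded lebesgue_on_UNIV_eq, rotated]) (rule AE_split, simp)
  then show ?thesis using open_domain by (simp add: borel_measurable_if)
qed

lemma integrable_mesh:
  fixes F :: "plane \<Rightarrow> 'b::euclidean_space"
  assumes "\<And>T. T \<in> \<T> \<Longrightarrow> integrable (lebesgue_on (interior T)) F"
  shows "integrable (lebesgue_on \<Omega>) F"
    and "(LINT x|lebesgue_on \<Omega>. F x) = (\<Sum>T\<in>\<T>. LINT x|lebesgue_on (interior T). F x)"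
proof -
  let ?F = "\<lambda>x. \<Sum>T\<in>\<T>. if x \<in> interior T then F x else 0"
  have 1: "integrable lebesgue (\<lambda>x. if x \<in> interior T then F x else 0)" if "T \<in> \<T>" for T
    using assms[OF that] by (subst Lebesgue_Measure.integrable_restrict_UNIV) auto
  then have int: "integrable lebesgue ?F" by (intro Bochner_Integration.integrable_sum) auto
  have meas: "(\<lambda>x. if x \<in> \<Omega> then F x else 0) \<in> borel_measurable lebesgue"
    using measurable_mesh[of F] assms open_domain by (intro borel_measurable_if_I) auto
  have "integrable lebesgue (\<lambda>x. if x \<in> \<Omega> then F x else 0)"
    by (rule integrable_cong_AE_imp[OF int meas AE_split])
  then show "integrable (lebesgue_on \<Omega>) F"
    using open_domain by (simp add: Lebesgue_Measure.integrable_restrict_UNIV)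
  have "(LINT x|lebesgue_on \<Omega>. F x) = (LINT x|lebesgue. (if x \<in> \<Omega> then F x else 0))"
    using open_domain by (simp add: Lebesgue_Measure.integral_restrict_UNIV)
  also have "\<dots> = (LINT x|lebesgue. ?F x)"
    using AE_split[of F] int meas by (intro integral_cong_AE) (auto elim: AE_mp)
  also have "\<dots> = (\<Sum>T\<in>\<T>. LINT x|lebesgue. (if x \<in> interior T then F x else 0))"
    by (intro Bochner_Integration.integral_sum 1)
  also have "\<dots> = (\<Sum>T\<in>\<T>. LINT x|lebesgue_on (interior T). F x)"
    by (intro sum.cong Lebesgue_Measure.integral_restrict_UNIV) auto
  finally show "(LINT x|lebesgue_on \<Omega>. F x) = (\<Sum>T\<in>\<T>. LINT x|lebesgue_on (interior T). F x)" .
qed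

lemma Lp2_mesh:
  assumes "\<And>T. T \<in> \<T> \<Longrightarrow> Lp_on 2 (interior T) F"
  shows "Lp_on 2 \<Omega> F"
  unfolding Lp2_iff
proof
  show "F \<in> borel_measurable (lebesgue_on \<Omega>)"
    using assms by (intro measurable_mesh Lp2_measurable)
  show "integrable (lebesgue_on \<Omega>) (\<lambda>x. (norm (F x))\<^sup>2)"
    using assms by (intro integrable_mesh(1) Lp2_integrable)
qed

section \<open>Vertices, open edges and their neighbourhoods\<close>

definition vertices :: "plane set" where
  "vertices = {x. \<exists>T\<in>\<T>. {x} face_of T}"

lemma finite_vertices: "finite vertices"
proof -
  have "vertices \<subseteq> (\<Union>T\<in>\<T>. the_elem ` {F. F face_of T})"
    unfolding vertices_def by (force intro: image_eqI[of _ _ "{_}"])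
  moreover have "finite (\<Union>T\<in>\<T>. the_elem ` {F. F face_of T})"
    using finite_mesh simplex simplex_imp_polytope finite_polytope_faces by blast
  ultimately show ?thesis by (rule finite_subset)
qed

text \<open>A descent through the faces: a point of a polyhedron outside its relative interior lies
  in a facet, and each passage to a facet lowers the dimension by one, from 2 to 1 to 0.\<close>

lemma point_cases:
  assumes "x \<in> \<Omega>"
  obtains (interior) T where "T \<in> \<T>" "x \<in> interior T"
    | (edge) T S where "T \<in> \<T>" "S edge_of T" "x \<in> rel_interior S"
    | (vertex) "x \<in> vertices"
proof -
  obtain T where T: "T \<in> \<T>" "x \<in> T" using assms domain_subset_Union by blast
  show ?thesis
  proof (cases "x \<in> interior T")
    case False
    then have "x \<in> \<Union>{F. F facet_of T}"
      using T rel_boundary_of_polyhedron[OF polyhedron[OF T(1)]] rel_interior_eq[OF T(1)] by blast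
    then obtain F where F: "F facet_of T" "x \<in> F" by blast
    have FT: "F face_of T" "aff_dim F = 1" using F aff_dim[OF T(1)] by (auto simp: facet_of_def)
    show ?thesis
    proof (cases "x \<in> rel_interior F")
      case True
      then show ?thesis using edge[OF T(1)] FT by (simp add: edge_of_def)
    next
      case False
      have "polyhedron F" by (rule face_of_polyhedron_polyhedron[OF polyhedron[OF T(1)] FT(1)])
      then have "x \<in> \<Union>{G. G facet_of F}"
        using False F rel_boundary_of_polyhedron by blast
      then obtain G where G: "G facet_of F" "x \<in> G" by blast
      then have "aff_dim G = 0" "G face_of T" using FT face_of_trans by (auto simp: facet_of_def)
      then have "{x} face_of T" using G by (auto simp: aff_dim_eq_0)
      then show ?thesis using vertex T by (auto simp: vertices_def)
    qed
  qed (use interior T in blast)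
qed

text \<open>Conformity of the mesh: the intersection of the two triangles is a face of
  \<open>T\<close> containing a relative interior point of \<open>S\<close>, so it contains
  \<open>S\<close>. Then \<open>S\<close> is a face of this intersection, which is a face of
  \<open>T'\<close>.\<close>

lemma edge_of_neighbour:
  assumes T: "T \<in> \<T>" "S edge_of T" and x: "x \<in> rel_interior S" and T': "T' \<in> \<T>" "x \<in> T'"
  shows "S edge_of T'"
proof -
  have S: "S face_of T" "aff_dim S = 1" using T by (auto simp: edge_of_def)
  have "x \<in> T" using x rel_interior_subset[of S] face_of_imp_subset[OF S(1)] by blast
  then have sub: "S \<subseteq> T \<inter> T'"
    using x T' by (intro subset_of_face_of[OF Int_face[OF T(1) T'(1)] face_of_imp_subset[OF S(1)]]) blast
  then have "S face_of T' \<inter> T" using face_of_subset[OF S(1), of "T \<inter> T'"] by (simp add: Int_commute)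
  then have "S face_of T'" using face_of_trans Int_face[OF T'(1) T(1)] by blast
  with S show ?thesis by (simp add: edge_of_def)
qed

text \<open>If \<open>T\<close> were the only triangle at \<open>x\<close>, removing the finitely
  many others from \<Omega> would leave an open neighbourhood of \<open>x\<close> inside
  \<open>T\<close>, while an edge contains no interior point of \<open>T\<close>.\<close>

lemma second_neighbour:
  assumes T: "T \<in> \<T>" "S edge_of T" and x: "x \<in> rel_interior S" "x \<in> \<Omega>"
  obtains T' where "T' \<in> \<T>" "T' \<noteq> T" "x \<in> T'"
proof (rule ccontr)
  assume "\<not> thesis"
  then have x': "x \<in> \<Omega> - \<Union>(\<T> - {T})" using that x by blast
  have op: "open (\<Omega> - \<Union>(\<T> - {T}))"
    using open_domain finite_mesh closed by (intro open_Diff closed_Union) auto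
  have "\<Omega> - \<Union>(\<T> - {T}) \<subseteq> T" using domain_subset_Union by blast
  then have "x \<in> interior T" by (rule interiorI[OF op x'])
  then show False using edge_Int_interior_empty[OF T(1) T(1) T(2)] x rel_interior_subset by blast
qed

lemma edge_neighbourhood:
  assumes T: "T \<in> \<T>" "S edge_of T" and x: "x \<in> rel_interior S"
  shows "\<exists>W. open W \<and> x \<in> W \<and> W \<inter> frontier T \<subseteq> rel_interior S"
proof (intro exI conjI)
  \<comment> \<open>All other edges of \<open>T\<close> and the end points of \<open>S\<close> form
    a closed set missing \<open>x\<close>; off this set the boundary of \<open>T\<close> is the open
    edge alone.\<close>
  let ?C = "\<Union>{F. F facet_of T \<and> F \<noteq> S} \<union> rel_frontier S"
  have S: "S face_of T" "aff_dim S = 1" "S \<subseteq> T" using T by (auto simp: edge_of_def face_of_imp_subset)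
  have "finite {F. F facet_of T \<and> F \<noteq> S}"
    by (rule finite_subset[OF _ finite_polyhedron_facets[OF polyhedron[OF T(1)]]]) blast
  moreover have cF: "closed F" if "F face_of T" for F
    using that face_of_imp_closed convex closed T by blast
  ultimately have "closed ?C"
    using convex[OF T(1)] face_of_imp_convex
    by (intro closed_Un closed_Union closed_rel_frontier) (auto simp: facet_of_def)
  then show "open (- ?C)" by (rule open_Compl)
  show "x \<in> - ?C"
  proof -
    \<comment> \<open>A face that meets the relative interior of \<open>S\<close> contains
      \<open>S\<close>, and equal dimensions then force equality.\<close>
    have "F = S" if F: "F facet_of T" "x \<in> F" for F
    proof (rule ccontr)
      assume "F \<noteq> S"
      have FT: "F face_of T" "aff_dim F = 1" using F aff_dim[OF T(1)] by (auto simp: facet_of_def)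
      have "S \<subseteq> F" using F x S by (intro subset_of_face_of[OF FT(1)]) auto
      then have "S face_of F" using face_of_subset[OF S(1)] face_of_imp_subset[OF FT(1)] by blast
      then have "aff_dim S < aff_dim F"
        using \<open>F \<noteq> S\<close> face_of_imp_convex[OF FT(1)] by (intro face_of_aff_dim_lt) auto
      with S FT show False by simp
    qed
    then show ?thesis using x by (auto simp: rel_frontier_def)
  qed
  show "- ?C \<inter> frontier T \<subseteq> rel_interior S"
  proof
    fix y assume y: "y \<in> - ?C \<inter> frontier T"
    then obtain F where "F facet_of T" "y \<in> F"
      using rel_frontier_of_polyhedron[OF polyhedron[OF T(1)]] rel_frontier_eq[OF T(1)] by blast
    with y have "y \<in> S" "y \<notin> rel_frontier S" by auto
    then show "y \<in> rel_interior S" using closure_subset[of S] by (auto simp: rel_frontier_def)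
  qed
qed

text \<open>A finite intersection of the previous neighbourhoods, minus the triangles away from
  \<open>x\<close>. A function supported in \<open>W\<close> thus satisfies the support condition of
  \<open>edge_test_fun\<close> for every triangle at \<open>x\<close>.\<close>

lemma edge_star_neighbourhood:
  assumes T: "T \<in> \<T>" "S edge_of T" and x: "x \<in> rel_interior S"
  obtains W where "open W" "x \<in> W" "\<And>T'. T' \<in> \<T> \<Longrightarrow> x \<notin> T' \<Longrightarrow> W \<inter> T' = {}"
    "\<And>T'. T' \<in> \<T> \<Longrightarrow> x \<in> T' \<Longrightarrow> W \<inter> frontier T' \<subseteq> rel_interior S"
proof -
  let ?A = "{T' \<in> \<T>. x \<in> T'}" and ?B = "{T' \<in> \<T>. x \<notin> T'}"
  have "\<forall>T'\<in>?A. \<exists>W. open W \<and> x \<in> W \<and> W \<inter> frontier T' \<subseteq> rel_interior S"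
    using edge_neighbourhood[OF _ edge_of_neighbour[OF T x] x] by blast
  then obtain W where "\<forall>T'\<in>?A. open (W T') \<and> x \<in> W T' \<and> W T' \<inter> frontier T' \<subseteq> rel_interior S"
    unfolding bchoice_iff by (elim exE)
  then have W: "\<And>T'. T' \<in> ?A \<Longrightarrow> open (W T')" "\<And>T'. T' \<in> ?A \<Longrightarrow> x \<in> W T'"
    "\<And>T'. T' \<in> ?A \<Longrightarrow> W T' \<inter> frontier T' \<subseteq> rel_interior S" by simp_all
  show ?thesis
  proof (rule that[of "(\<Inter>T'\<in>?A. W T') \<inter> - \<Union>?B"])
    show "open ((\<Inter>T'\<in>?A. W T') \<inter> - \<Union>?B)"
      using W(1) finite_mesh closed by (intro open_Int open_INT open_Compl closed_Union) auto
  qed (use W in blast)+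
qed

end

section \<open>Removable points\<close>

text \<open>With \<open>d\<close> the divergence of \<open>\<sigma>\<close>, this is the distributional pairing of Green's formula.\<close>

definition green_pairing :: "plane set \<Rightarrow> (plane \<Rightarrow> plane) \<Rightarrow> (plane \<Rightarrow> real) \<Rightarrow> (plane \<Rightarrow> real) \<Rightarrow> real" where
  "green_pairing U \<sigma> d \<phi> = (LINT x|lebesgue_on U. \<sigma> x \<bullet> grad \<phi> x + \<phi> x * d x)"

lemma Lp2_test_fun_UNIV:
  assumes "\<phi> \<in> test_fun UNIV" "open U"
  shows "Lp_on 2 U \<phi>" "Lp_on 2 U (grad \<phi>)"
  using Lp2_subset[OF Lp2_test_fun[OF assms(1) subset_UNIV open_UNIV]]
    Lp2_subset[OF Lp2_grad_test_fun[OF assms(1) subset_UNIV open_UNIV]] assms(2) by simp_all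

lemma green_pairing_split:
  assumes "Lp_on 2 U \<sigma>" "Lp_on 2 U d" "open U" "\<phi> \<in> test_fun UNIV"
  shows "green_pairing U \<sigma> d \<phi> = (LINT x|lebesgue_on U. \<sigma> x \<bullet> grad \<phi> x) + (LINT x|lebesgue_on U. \<phi> x * d x)"
  unfolding green_pairing_def
  using Lp2_test_fun_UNIV[OF assms(4,3)] assms
  by (intro Bochner_Integration.integral_add Lp2_inner_integrable Lp2_mult_integrable)

lemma green_pairing_add:
  assumes L2: "Lp_on 2 U \<sigma>" "Lp_on 2 U d" and U: "open U" and \<phi>: "\<phi> \<in> test_fun UNIV" and \<psi>: "\<psi> \<in> test_fun UNIV"
  shows "green_pairing U \<sigma> d (\<lambda>x. \<phi> x + \<psi> x) = green_pairing U \<sigma> d \<phi> + green_pairing U \<sigma> d \<psi>"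
proof -
  note l = Lp2_test_fun_UNIV[OF \<phi> U] Lp2_test_fun_UNIV[OF \<psi> U]
  have "green_pairing U \<sigma> d (\<lambda>x. \<phi> x + \<psi> x) =
    (LINT x|lebesgue_on U. (\<sigma> x \<bullet> grad \<phi> x + \<phi> x * d x) + (\<sigma> x \<bullet> grad \<psi> x + \<psi> x * d x))"
    unfolding green_pairing_def
    by (intro Bochner_Integration.integral_cong)
      (auto simp: grad_add test_fun_smooth[OF \<phi>] test_fun_smooth[OF \<psi>] inner_add_right algebra_simps)
  also have "\<dots> = green_pairing U \<sigma> d \<phi> + green_pairing U \<sigma> d \<psi>"
    unfolding green_pairing_def
    by (intro Bochner_Integration.integral_add Bochner_Integration.integrable_add
        Lp2_inner_integrable Lp2_mult_integrable L2 l)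
  finally show ?thesis .
qed

text \<open>Absolute continuity of the integral: off the null set consisting of \<open>p\<close> the
  indicators are eventually 0, and the squared norm of \<open>F\<close> is an integrable
  majorant.\<close>

lemma L2_norm_shrinking:
  assumes F: "Lp_on 2 U F" and U: "U \<in> sets lebesgue"
  shows "Lp_on 2 U (\<lambda>x. indicat_real (ball p r) x *\<^sub>R F x)" (is ?thesis1)
    and "(\<lambda>n. L2_norm U (\<lambda>x. indicat_real (ball p (inverse (real (Suc n)))) x *\<^sub>R F x)) \<longlonglongrightarrow> 0" (is ?thesis2)
proof -
  have [measurable]: "indicat_real (ball p r) \<in> borel_measurable (lebesgue_on U)" for r
    by (intro borel_measurable_indicator measurable_restrict_space1 sets_lebesgue_open) simp_all
  note Fm [measurable] = Lp2_measurable[OF F]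
  have m: "(\<lambda>x. indicat_real (ball p r) x *\<^sub>R F x) \<in> borel_measurable (lebesgue_on U)" for r
    by measurable
  show ?thesis1
    by (rule Lp2_bound[OF m Lp2_integrable[OF F]]) (simp add: indicator_def)
  have "(\<lambda>n. LINT x|lebesgue_on U. (norm (indicat_real (ball p (inverse (real (Suc n)))) x *\<^sub>R F x))\<^sup>2)
      \<longlonglongrightarrow> (LINT x|lebesgue_on U. 0)"
  proof (rule integral_dominated_convergence[where w="\<lambda>x. (norm (F x))\<^sup>2"])
    show "AE x in lebesgue_on U. (\<lambda>n. (norm (indicat_real (ball p (inverse (real (Suc n)))) x *\<^sub>R F x))\<^sup>2) \<longlonglongrightarrow> 0"
    proof -
      have "{p} \<in> null_sets lebesgue" by (simp add: negligible_iff_null_sets[symmetric])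
      then have "AE x in lebesgue. x \<notin> {p}" by (rule AE_not_in)
      then have "AE x in lebesgue_on U. x \<noteq> p" using U by (simp add: AE_restrict_space_iff) (auto elim: AE_mp)
      then show ?thesis
      proof eventually_elim
        case (elim x)
        then have "\<forall>\<^sub>F n in sequentially. inverse (real (Suc n)) < dist p x"
          by (intro order_tendstoD[OF LIMSEQ_inverse_real_of_nat]) simp
        then have "\<forall>\<^sub>F n in sequentially. (norm (indicat_real (ball p (inverse (real (Suc n)))) x *\<^sub>R F x))\<^sup>2 = 0"
          by eventually_elim (simp add: indicator_def)
        then show ?case by (rule tendsto_eventually)
      qed
    qed
    show "AE x in lebesgue_on U. norm ((norm (indicat_real (ball p (inverse (real (Suc n)))) x *\<^sub>R F x))\<^sup>2) \<le> (norm (F x))\<^sup>2" for n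
      by (intro AE_I2) (simp add: indicator_def)
    show "(\<lambda>x. (norm (indicat_real (ball p (inverse (real (Suc n)))) x *\<^sub>R F x))\<^sup>2) \<in> borel_measurable (lebesgue_on U)" for n
      using m by measurable
  qed (use Lp2_integrable[OF F] in simp_all)
  then have "(\<lambda>n. sqrt (LINT x|lebesgue_on U. (norm (indicat_real (ball p (inverse (real (Suc n)))) x *\<^sub>R F x))\<^sup>2)) \<longlonglongrightarrow> sqrt 0"
    by (intro tendsto_real_sqrt) simp
  then show ?thesis2 by (simp add: L2_norm_def)
qed

text \<open>Split \<phi> as \<phi> (1 - \<beta>) + \<phi> \<beta> with a cutoff \<beta> around
  \<open>p\<close>. The first part vanishes near \<open>p\<close> and pairs to 0, so the pairing
  with \<phi> equals that with \<phi> \<beta> at every cutoff scale. The point may lie outside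
  \<open>U\<close>, as vertices on the boundary do.\<close>

lemma green_pairing_removable_point:
  assumes \<sigma>: "Lp_on 2 \<Omega> \<sigma>" and d: "Lp_on 2 \<Omega> d" and \<Omega>: "open \<Omega>" and U: "open U" "U \<subseteq> \<Omega>"
    and 0: "\<And>\<phi>. \<phi> \<in> test_fun (U - {p}) \<Longrightarrow> green_pairing \<Omega> \<sigma> d \<phi> = 0"
    and \<phi>: "\<phi> \<in> test_fun U"
  shows "green_pairing \<Omega> \<sigma> d \<phi> = 0"
proof -
  obtain K M where K: "compact K" "K \<subseteq> U" "\<And>x. x \<notin> K \<Longrightarrow> \<phi> x = 0" "\<And>x. x \<notin> K \<Longrightarrow> grad \<phi> x = 0"
    "0 < M" "\<And>x. \<bar>\<phi> x\<bar> \<le> M" "\<And>x. norm (grad \<phi> x) \<le> M"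
    using \<phi> by (rule test_fun_support_obtain) blast
  have "bump_at 0 1 \<in> test_fun UNIV" by (rule test_fun_bump_at) auto
  then have "bump \<in> test_fun UNIV" by (simp add: bump_at_def[abs_def])
  then obtain B where B: "0 < B" "\<And>x. norm (grad bump x) \<le> B"
    by (rule test_fun_support_obtain) blast
  define \<rho> where "\<rho> n = inverse (real (Suc n))" for n
  have \<rho>: "0 < \<rho> n" "\<rho> n \<le> 1" for n by (auto simp: \<rho>_def inverse_le_1_iff simp del: of_nat_Suc)
  \<comment> \<open>A bump vanishes beyond twice its radius, so a third of \<rho> puts its support
    inside the open ball of radius \<rho>.\<close>
  define \<beta> where "\<beta> n = bump_at p (\<rho> n / 3)" for n
  have \<beta>: "smooth (\<beta> n)" "0 \<le> \<beta> n x" "\<beta> n x \<le> 1" for n x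
    by (auto simp: \<beta>_def smooth_bump_at bump_at_range)
  have \<beta>1: "\<beta> n x = 1" if "dist p x \<le> \<rho> n / 3" for n x
    unfolding \<beta>_def using \<rho>[of n] that by (intro bump_at_1) auto
  have \<beta>0: "\<beta> n x = 0" if "x \<notin> cball p (2 * (\<rho> n / 3))" for n x
    unfolding \<beta>_def using \<rho>[of n] that by (intro bump_at_0) auto
  have g\<beta>0: "grad (\<beta> n) x = 0" if "x \<notin> cball p (2 * (\<rho> n / 3))" for n x
    by (rule grad_0_outside[OF closed_cball \<beta>0 that])
  have ball: "x \<notin> cball p (2 * (\<rho> n / 3))" if "x \<notin> ball p (\<rho> n)" for n x
    using that \<rho>[of n] by simp
  have g\<beta>: "norm (grad (\<beta> n) x) \<le> 3 * B / \<rho> n" for n x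
    unfolding \<beta>_def grad_bump_at using B(2) \<rho>[of n] by (simp add: divide_simps)
  let ?\<psi> = "\<lambda>n x. \<phi> x * \<beta> n x"
  have \<psi>: "?\<psi> n \<in> test_fun U" for n by (rule test_fun_mult_smooth[OF \<phi> \<beta>(1)])
  then have \<psi>U: "?\<psi> n \<in> test_fun UNIV" for n by (rule test_fun_mono) simp
  have eq: "green_pairing \<Omega> \<sigma> d \<phi> = green_pairing \<Omega> \<sigma> d (?\<psi> n)" for n
  proof -
    have "(\<lambda>x. \<phi> x * (1 - \<beta> n x)) \<in> test_fun (U - {p})"
      unfolding test_fun_iff
    proof (intro conjI exI[of _ "K - ball p (\<rho> n / 3)"] allI impI)
      show "smooth (\<lambda>x. \<phi> x * (1 - \<beta> n x))"
        by (intro smooth_mult smooth_diff smooth_const \<beta> test_fun_smooth[OF \<phi>])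
      show "K - ball p (\<rho> n / 3) \<subseteq> U - {p}" using K(2) \<rho>[of n] by auto
      fix x assume "x \<notin> K - ball p (\<rho> n / 3)"
      then show "\<phi> x * (1 - \<beta> n x) = 0" using K(3)[of x] \<beta>1[of x n] by auto
    qed (use K(1) in \<open>auto intro: compact_diff\<close>)
    moreover from this have "(\<lambda>x. \<phi> x * (1 - \<beta> n x)) \<in> test_fun UNIV" by (rule test_fun_mono) simp
    ultimately have "green_pairing \<Omega> \<sigma> d (\<lambda>x. \<phi> x * (1 - \<beta> n x) + ?\<psi> n x) = green_pairing \<Omega> \<sigma> d (?\<psi> n)"
      using 0 by (subst green_pairing_add[OF \<sigma> d \<Omega> _ \<psi>U]) auto
    then show ?thesis by (simp add: algebra_simps)
  qed
  \<comment> \<open>From the product rule: 3 M B / \<rho> comes from differentiating the cutoff, and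
    the gradient of \<phi> is bounded by M, hence by M / \<rho> as \<rho> is at most 1.\<close>
  define c where "c = M * (1 + 3 * B)"
  have c: "0 \<le> c" using K(5) B(1) by (simp add: c_def)
  have g\<psi>: "norm (grad (?\<psi> n) x) \<le> c / \<rho> n" for n x
  proof -
    have "norm (grad (?\<psi> n) x) \<le> \<bar>\<phi> x\<bar> * norm (grad (\<beta> n) x) + \<bar>\<beta> n x\<bar> * norm (grad \<phi> x)"
      unfolding grad_mult[OF test_fun_smooth[OF \<phi>] \<beta>(1)] by (rule order_trans[OF norm_triangle_ineq]) simp
    also have "\<dots> \<le> M * (3 * B / \<rho> n) + 1 * (M / \<rho> n)"
    proof (intro add_mono mult_mono)
      show "norm (grad \<phi> x) \<le> M / \<rho> n"
        using K(7)[of x] K(5) divide_left_mono[of "\<rho> n" 1 M] \<rho>[of n] by simp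
    qed (use K(5,6) B g\<beta> \<beta> \<rho>[of n] in auto)
    also have "\<dots> = c / \<rho> n" by (simp add: c_def add_divide_distrib algebra_simps)
    finally show ?thesis .
  qed
  have g\<psi>0: "grad (?\<psi> n) x = 0" if "x \<notin> ball p (\<rho> n)" for n x
    unfolding grad_mult[OF test_fun_smooth[OF \<phi>] \<beta>(1)] using \<beta>0[OF ball[OF that]] g\<beta>0[OF ball[OF that]] by simp
  define V where "V = measure lebesgue (ball (0::plane) 1)"
  \<comment> \<open>The ball has area \<rho>^2 V, which cancels the square of 1/\<rho> exactly. This
    is where dimension two enters.\<close>
  have L2g: "L2_norm \<Omega> (grad (?\<psi> n)) \<le> sqrt (c\<^sup>2 * V)" for n
  proof -
    have "(LINT x|lebesgue_on \<Omega>. (norm (grad (?\<psi> n) x))\<^sup>2)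
        = (LINT x|lebesgue. (if x \<in> \<Omega> then (norm (grad (?\<psi> n) x))\<^sup>2 else 0))"
      using \<Omega> by (simp add: Lebesgue_Measure.integral_restrict_UNIV)
    also have "\<dots> \<le> (LINT x|lebesgue. (c / \<rho> n)\<^sup>2 * indicat_real (ball p (\<rho> n)) x)"
    proof (rule integral_mono')
      show "integrable lebesgue (\<lambda>x. (c / \<rho> n)\<^sup>2 * indicat_real (ball p (\<rho> n)) x)"
        using lmeasurable_ball[of p "\<rho> n"]
        by (intro integrable_mult_right integrable_real_indicator) (auto simp: fmeasurable_def)
      fix x
      show "(if x \<in> \<Omega> then (norm (grad (?\<psi> n) x))\<^sup>2 else 0) \<le> (c / \<rho> n)\<^sup>2 * indicat_real (ball p (\<rho> n)) x"
      proof (cases "x \<in> ball p (\<rho> n)")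
        case True
        then show ?thesis using power_mono[OF g\<psi>[of n x], of 2] by simp
      qed (simp add: g\<psi>0)
    qed simp
    also have "\<dots> = (c / \<rho> n)\<^sup>2 * measure lebesgue (ball p (\<rho> n))"
      by simp
    also have "\<dots> = c\<^sup>2 * V"
      using content_ball_conv_unit_ball[of "\<rho> n" p] \<rho>[of n] by (simp add: V_def power_divide)
    finally show ?thesis unfolding L2_norm_def by (rule real_sqrt_le_mono)
  qed
  have L2\<psi>: "L2_norm \<Omega> (?\<psi> n) \<le> L2_norm \<Omega> \<phi>" for n
    unfolding L2_norm_def
  proof (intro real_sqrt_le_mono Bochner_Integration.integral_mono)
    show "(norm (?\<psi> n x))\<^sup>2 \<le> (norm (\<phi> x))\<^sup>2" for x
      using \<beta>(2,3)[of n x] by (intro power_mono) (simp_all add: abs_mult mult_right_le_one_le)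
  qed (auto intro!: Lp2_integrable Lp2_test_fun[OF \<psi> U(2) \<Omega>] Lp2_test_fun[OF \<phi> U(2) \<Omega>] simp del: real_norm_def)
  \<comment> \<open>The product \<phi> \<beta> and its gradient live in the ball, so the indicator
    may be moved onto \<sigma> and \<open>d\<close>. Cauchy-Schwarz then leaves factors tending to 0
    times factors bounded in \<open>n\<close>.\<close>
  have bound: "\<bar>green_pairing \<Omega> \<sigma> d \<phi>\<bar> \<le> L2_norm \<Omega> (\<lambda>x. indicat_real (ball p (\<rho> n)) x *\<^sub>R \<sigma> x) * sqrt (c\<^sup>2 * V)
     + L2_norm \<Omega> (\<lambda>x. indicat_real (ball p (\<rho> n)) x *\<^sub>R d x) * L2_norm \<Omega> \<phi>" (is "_ \<le> ?S n * _ + ?D n * _") for n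
  proof -
    note l = Lp2_test_fun[OF \<psi>[of n] U(2) \<Omega>] Lp2_grad_test_fun[OF \<psi>[of n] U(2) \<Omega>]
    have i\<sigma>: "(LINT x|lebesgue_on \<Omega>. \<sigma> x \<bullet> grad (?\<psi> n) x)
        = (LINT x|lebesgue_on \<Omega>. (indicat_real (ball p (\<rho> n)) x *\<^sub>R \<sigma> x) \<bullet> grad (?\<psi> n) x)"
      using g\<psi>0[of _ n] by (intro Bochner_Integration.integral_cong) (auto simp: indicator_def)
    have id: "(LINT x|lebesgue_on \<Omega>. ?\<psi> n x * d x)
        = (LINT x|lebesgue_on \<Omega>. (indicat_real (ball p (\<rho> n)) x *\<^sub>R d x) \<bullet> ?\<psi> n x)"
      using \<beta>0[OF ball, of _ n] by (intro Bochner_Integration.integral_cong) (auto simp: indicator_def)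
    have "\<bar>LINT x|lebesgue_on \<Omega>. \<sigma> x \<bullet> grad (?\<psi> n) x\<bar> \<le> ?S n * L2_norm \<Omega> (grad (?\<psi> n))"
      unfolding i\<sigma> using \<Omega> by (intro L2_Cauchy_Schwarz L2_norm_shrinking(1)[OF \<sigma>] l) simp
    also have "\<dots> \<le> ?S n * sqrt (c\<^sup>2 * V)"
      by (intro mult_left_mono L2g L2_norm_nonneg)
    finally have 1: "\<bar>LINT x|lebesgue_on \<Omega>. \<sigma> x \<bullet> grad (?\<psi> n) x\<bar> \<le> ?S n * sqrt (c\<^sup>2 * V)" .
    have "\<bar>LINT x|lebesgue_on \<Omega>. ?\<psi> n x * d x\<bar> \<le> ?D n * L2_norm \<Omega> (?\<psi> n)"
      unfolding id using \<Omega> by (intro L2_Cauchy_Schwarz L2_norm_shrinking(1)[OF d] l) simp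
    also have "\<dots> \<le> ?D n * L2_norm \<Omega> \<phi>"
      by (intro mult_left_mono L2\<psi> L2_norm_nonneg)
    finally have 2: "\<bar>LINT x|lebesgue_on \<Omega>. ?\<psi> n x * d x\<bar> \<le> ?D n * L2_norm \<Omega> \<phi>" .
    show ?thesis
      unfolding eq[of n] green_pairing_split[OF \<sigma> d \<Omega> \<psi>U]
      by (rule order_trans[OF abs_triangle_ineq add_mono[OF 1 2]])
  qed
  have "(\<lambda>n. L2_norm \<Omega> (\<lambda>x. indicat_real (ball p (\<rho> n)) x *\<^sub>R \<sigma> x) * sqrt (c\<^sup>2 * V)
     + L2_norm \<Omega> (\<lambda>x. indicat_real (ball p (\<rho> n)) x *\<^sub>R d x) * L2_norm \<Omega> \<phi>) \<longlonglongrightarrow> 0 * sqrt (c\<^sup>2 * V) + 0 * L2_norm \<Omega> \<phi>"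
    unfolding \<rho>_def using L2_norm_shrinking(2)[OF \<sigma>] L2_norm_shrinking(2)[OF d] \<Omega>
    by (intro tendsto_intros) auto
  then have "\<bar>green_pairing \<Omega> \<sigma> d \<phi>\<bar> \<le> 0"
    using bound by (intro LIMSEQ_le_const) auto
  then show ?thesis by simp
qed

section \<open>Green's formula on the mesh\<close>

text \<open>Points are restored one at a time: the point \<open>p\<close> is filled in within the
  open set that still excludes the rest of \<open>V\<close>.\<close>

lemma green_pairing_removable_points:
  assumes \<sigma>: "Lp_on 2 \<Omega> \<sigma>" and d: "Lp_on 2 \<Omega> d" and \<Omega>: "open \<Omega>" and "finite V"
    and "\<And>\<phi>. \<phi> \<in> test_fun (\<Omega> - V) \<Longrightarrow> green_pairing \<Omega> \<sigma> d \<phi> = 0"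
    and \<phi>: "\<phi> \<in> test_fun \<Omega>"
  shows "green_pairing \<Omega> \<sigma> d \<phi> = 0"
  using assms(4,5)
proof (induction V rule: finite_induct)
  case empty
  then show ?case using \<phi> by simp
next
  case (insert p V)
  have op: "open (\<Omega> - V)" using \<Omega> insert.hyps by (intro open_Diff finite_imp_closed)
  have eq: "\<Omega> - V - {p} = \<Omega> - insert p V" by blast
  have "green_pairing \<Omega> \<sigma> d \<psi> = 0" if "\<psi> \<in> test_fun (\<Omega> - V)" for \<psi>
    by (rule green_pairing_removable_point[OF \<sigma> d \<Omega> op Diff_subset _ that, of p])
      (rule insert.prems, simp only: eq)
  then show ?case by (rule insert.IH)
qed

lemma normal_trace_eq: "normal_trace T \<tau> = green_pairing (interior T) \<tau> (weak_div (interior T) \<tau>)"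
  by (simp add: normal_trace_def green_pairing_def fun_eq_iff)

text \<open>The trace functional sees only the boundary; for functions supported inside, it reduces
  to the defining identity of the weak divergence.\<close>

lemma normal_trace_interior:
  assumes \<tau>: "Hdiv_on (interior T) \<tau>" and \<phi>: "\<phi> \<in> test_fun (interior T)"
  shows "normal_trace T \<tau> \<phi> = 0"
proof -
  have "Lp_on 2 (interior T) \<tau>" using \<tau> by (simp add: Hdiv_on_def)
  moreover have "\<phi> \<in> test_fun UNIV" using \<phi> by (rule test_fun_mono) simp
  ultimately show ?thesis
    using Lp2_weak_div[OF open_interior \<tau>] \<phi>
    by (simp add: normal_trace_eq green_pairing_split has_weak_div_def)
qed

lemma normal_trace_outside:
  assumes "\<phi> \<in> test_fun W" "W \<inter> interior T = {}"
  shows "normal_trace T \<tau> \<phi> = 0"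
proof -
  obtain K where K: "K \<subseteq> W" "\<And>x. x \<notin> K \<Longrightarrow> \<phi> x = 0" "\<And>x. x \<notin> K \<Longrightarrow> grad \<phi> x = 0"
    using assms(1) by (rule test_fun_support_obtain) blast
  have "(LINT x|lebesgue_on (interior T). \<tau> x \<bullet> grad \<phi> x + \<phi> x * weak_div (interior T) \<tau> x)
      = (LINT x|lebesgue_on (interior T). 0)"
  proof (intro Bochner_Integration.integral_cong refl)
    fix x assume "x \<in> space (lebesgue_on (interior T))"
    then have "x \<notin> K" using K(1) assms(2) by auto
    then show "\<tau> x \<bullet> grad \<phi> x + \<phi> x * weak_div (interior T) \<tau> x = 0" using K(2,3) by simp
  qed
  then show ?thesis by (simp add: normal_trace_def)
qed

text \<open>If at least three triangles contained the edge, all traces would vanish, so it need not be shown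
  that there are exactly two.\<close>

lemma sum_eq_0_if_pairwise:
  fixes j :: "'a \<Rightarrow> real"
  assumes A: "finite A" and "a \<in> A" "b \<in> A" "a \<noteq> b"
    and pair: "\<And>x y. x \<in> A \<Longrightarrow> y \<in> A \<Longrightarrow> x \<noteq> y \<Longrightarrow> j x + j y = 0"
  shows "sum j A = 0"
proof (cases "A = {a, b}")
  case True
  then show ?thesis using assms by simp
next
  case False
  then obtain c where c: "c \<in> A" "c \<noteq> a" "c \<noteq> b" using assms by blast
  have "j a = 0"
    using pair[OF \<open>a \<in> A\<close> \<open>b \<in> A\<close> \<open>a \<noteq> b\<close>] pair[OF \<open>a \<in> A\<close> \<open>c \<in> A\<close> c(2)[symmetric]]
      pair[OF \<open>b \<in> A\<close> \<open>c \<in> A\<close> c(3)[symmetric]] by simp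
  then have "j x = 0" if "x \<in> A" for x using pair[of a x] assms that by (cases "x = a") auto
  then show ?thesis by simp
qed

context mesh
begin

lemma elementwise_div_eq:
  assumes "T \<in> \<T>" "x \<in> interior T"
  shows "elementwise_div \<T> \<tau> x = weak_div (interior T) \<tau> x"
proof -
  have "elementwise_div \<T> \<tau> x = (\<Sum>T'\<in>\<T>. if T' = T then weak_div (interior T) \<tau> x else 0)"
    unfolding elementwise_div_def using assms interior_disjoint[of _ T]
    by (intro sum.cong) (auto simp: indicator_def disjoint_iff)
  also have "\<dots> = weak_div (interior T) \<tau> x" using finite_mesh assms by simp
  finally show ?thesis .
qed

lemma
  assumes \<tau>: "\<And>T. T \<in> \<T> \<Longrightarrow> Hdiv_on (interior T) \<tau>"
  shows Lp2_Hdiv: "Lp_on 2 \<Omega> \<tau>" and Lp2_elementwise_div: "Lp_on 2 \<Omega> (elementwise_div \<T> \<tau>)"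
proof -
  show "Lp_on 2 \<Omega> \<tau>" using \<tau> by (intro Lp2_mesh) (simp add: Hdiv_on_def)
  show "Lp_on 2 \<Omega> (elementwise_div \<T> \<tau>)"
  proof (rule Lp2_mesh)
    fix T assume T: "T \<in> \<T>"
    show "Lp_on 2 (interior T) (elementwise_div \<T> \<tau>)"
    proof (rule Lp2_AE[OF _ Lp2_weak_div(2)[OF open_interior \<tau>[OF T]]])
      show "AE x in lebesgue_on (interior T). weak_div (interior T) \<tau> x = elementwise_div \<T> \<tau> x"
        using T by (intro AE_I2) (simp add: elementwise_div_eq)
    qed simp
  qed
qed

lemma green_pairing_eq_sum_traces:
  assumes \<tau>: "\<And>T. T \<in> \<T> \<Longrightarrow> Hdiv_on (interior T) \<tau>" and \<phi>: "\<phi> \<in> test_fun UNIV"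
  shows "green_pairing \<Omega> \<tau> (elementwise_div \<T> \<tau>) \<phi> = (\<Sum>T\<in>\<T>. normal_trace T \<tau> \<phi>)"
proof -
  let ?F = "\<lambda>x. \<tau> x \<bullet> grad \<phi> x + \<phi> x * elementwise_div \<T> \<tau> x"
  have "integrable (lebesgue_on \<Omega>) ?F"
    by (intro Bochner_Integration.integrable_add Lp2_inner_integrable Lp2_mult_integrable
        Lp2_Hdiv[OF \<tau>] Lp2_elementwise_div[OF \<tau>] Lp2_test_fun_UNIV[OF \<phi> open_domain])
  then have "integrable (lebesgue_on (interior T)) ?F" if "T \<in> \<T>" for T
    by (rule integrable_lebesgue_on_subset) (use interior_subset_domain[OF that] open_domain in auto)
  then have "green_pairing \<Omega> \<tau> (elementwise_div \<T> \<tau>) \<phi> = (\<Sum>T\<in>\<T>. LINT x|lebesgue_on (interior T). ?F x)"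
    unfolding green_pairing_def by (rule integrable_mesh(2))
  also have "\<dots> = (\<Sum>T\<in>\<T>. normal_trace T \<tau> \<phi>)"
    unfolding normal_trace_def
    by (intro sum.cong Bochner_Integration.integral_cong) (auto simp: elementwise_div_eq)
  finally show ?thesis .
qed

text \<open>The heart of the proof: only the jumps across interior edges decide the pairing. Away
  from the vertices this is checked in a neighbourhood of each point, and the vertices are removed
  afterwards.\<close>

lemma green_pairing_eq_if_jumps_agree:
  assumes \<tau>: "\<And>T. T \<in> \<T> \<Longrightarrow> Hdiv_on (interior T) \<tau>" and \<sigma>: "\<And>T. T \<in> \<T> \<Longrightarrow> Hdiv_on (interior T) \<sigma>"
    and jumps: "\<And>S. S \<in> mesh_edges \<T> \<Longrightarrow> \<not> S \<subseteq> frontier \<Omega> \<Longrightarrow> normal_jumps_agree_on S \<T> \<tau> \<sigma>"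
    and \<phi>: "\<phi> \<in> test_fun \<Omega>"
  shows "green_pairing \<Omega> \<tau> (elementwise_div \<T> \<tau>) \<phi> = green_pairing \<Omega> \<sigma> (elementwise_div \<T> \<sigma>) \<phi>"
proof -
  \<comment> \<open>Forming the difference first gives a single pairing with square-integrable data
    that should vanish, the form required both for localisation and for removing points.\<close>
  define \<Lambda> where "\<Lambda> = green_pairing \<Omega> (\<lambda>x. \<tau> x - \<sigma> x) (\<lambda>x. elementwise_div \<T> \<tau> x - elementwise_div \<T> \<sigma> x)"
  have L2: "Lp_on 2 \<Omega> \<tau>" "Lp_on 2 \<Omega> \<sigma>"
    "Lp_on 2 \<Omega> (elementwise_div \<T> \<tau>)" "Lp_on 2 \<Omega> (elementwise_div \<T> \<sigma>)"
    by (rule Lp2_Hdiv[OF \<tau>] Lp2_Hdiv[OF \<sigma>] Lp2_elementwise_div[OF \<tau>] Lp2_elementwise_div[OF \<sigma>]; assumption)+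
  have \<Lambda>_diff: "\<Lambda> \<psi> = green_pairing \<Omega> \<tau> (elementwise_div \<T> \<tau>) \<psi> - green_pairing \<Omega> \<sigma> (elementwise_div \<T> \<sigma>) \<psi>"
    if \<psi>: "\<psi> \<in> test_fun UNIV" for \<psi>
  proof -
    note l = Lp2_test_fun_UNIV[OF \<psi> open_domain]
    have "\<Lambda> \<psi> = (LINT x|lebesgue_on \<Omega>. (\<tau> x \<bullet> grad \<psi> x + \<psi> x * elementwise_div \<T> \<tau> x)
        - (\<sigma> x \<bullet> grad \<psi> x + \<psi> x * elementwise_div \<T> \<sigma> x))"
      unfolding \<Lambda>_def green_pairing_def
      by (intro Bochner_Integration.integral_cong) (auto simp: inner_diff_left algebra_simps)
    also have "\<dots> = green_pairing \<Omega> \<tau> (elementwise_div \<T> \<tau>) \<psi> - green_pairing \<Omega> \<sigma> (elementwise_div \<T> \<sigma>) \<psi>"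
      unfolding green_pairing_def
      by (intro Bochner_Integration.integral_diff Bochner_Integration.integrable_add
          Lp2_inner_integrable Lp2_mult_integrable L2 l)
    finally show ?thesis .
  qed
  define j where "j \<psi> T = normal_trace T \<tau> \<psi> - normal_trace T \<sigma> \<psi>" for \<psi> T
  have \<Lambda>_sum: "\<Lambda> \<psi> = sum (j \<psi>) \<T>" if "\<psi> \<in> test_fun UNIV" for \<psi>
    using \<Lambda>_diff[OF that] green_pairing_eq_sum_traces[OF \<tau> that] green_pairing_eq_sum_traces[OF \<sigma> that]
    by (simp add: j_def sum_subtractf)
  have "\<Lambda> \<psi> = 0" if \<psi>: "\<psi> \<in> test_fun (\<Omega> - vertices)" for \<psi>
    using _ _ \<psi>
  proof (rule test_fun_locality)
    fix \<phi> \<psi> assume *: "\<phi> \<in> test_fun (\<Omega> - vertices)" "\<psi> \<in> test_fun (\<Omega> - vertices)"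
    show "\<Lambda> (\<lambda>x. \<phi> x + \<psi> x) = \<Lambda> \<phi> + \<Lambda> \<psi>"
      unfolding \<Lambda>_def using L2
      by (intro green_pairing_add Lp2_diff open_domain test_fun_mono[OF *(1)] test_fun_mono[OF *(2)]) auto
  next
    fix x assume x: "x \<in> \<Omega> - vertices"
    then have "x \<in> \<Omega>" by simp
    then show "\<exists>W. open W \<and> x \<in> W \<and> (\<forall>\<psi>\<in>test_fun ((\<Omega> - vertices) \<inter> W). \<Lambda> \<psi> = 0)"
    proof (cases rule: point_cases)
      case (interior T)
      \<comment> \<open>A function supported inside \<open>T\<close> sees neither the boundary of
        \<open>T\<close> nor any other triangle, so every trace vanishes.\<close>
      have "\<Lambda> \<psi> = 0" if "\<psi> \<in> test_fun ((\<Omega> - vertices) \<inter> interior T)" for \<psi>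
      proof -
        have \<psi>: "\<psi> \<in> test_fun (interior T)" using that by (rule test_fun_mono) blast
        have "j \<psi> T' = 0" if T': "T' \<in> \<T>" for T'
        proof (cases "T' = T")
          case True
          then show ?thesis
            using normal_trace_interior[OF \<tau>[OF T'], of \<psi>] normal_trace_interior[OF \<sigma>[OF T'], of \<psi>] \<psi>
            by (simp add: j_def)
        next
          case False
          then show ?thesis
            using normal_trace_outside[OF \<psi> interior_disjoint[OF interior(1) T']] by (simp add: j_def)
        qed
        then show ?thesis using \<Lambda>_sum[OF test_fun_mono[OF \<psi>]] by simp
      qed
      then show ?thesis using interior by (intro exI[of _ "interior T"]) auto
    next
      case (edge T S)
      obtain W where W: "open W" "x \<in> W" "\<And>T'. T' \<in> \<T> \<Longrightarrow> x \<notin> T' \<Longrightarrow> W \<inter> T' = {}"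
        "\<And>T'. T' \<in> \<T> \<Longrightarrow> x \<in> T' \<Longrightarrow> W \<inter> frontier T' \<subseteq> rel_interior S"
        by (rule edge_star_neighbourhood[OF edge]) (rule that, assumption+)
      \<comment> \<open>The jump condition says nothing about an edge with a single triangle, so a
        second one must be exhibited.\<close>
      obtain T' where T': "T' \<in> \<T>" "T' \<noteq> T" "x \<in> T'"
        by (rule second_neighbour[OF edge \<open>x \<in> \<Omega>\<close>]) (rule that)
      have xT: "x \<in> S" "x \<in> T" using edge rel_interior_subset edge_of_imp_subset by blast+
      have S: "S \<in> mesh_edges \<T>" "\<not> S \<subseteq> frontier \<Omega>"
        using edge xT \<open>x \<in> \<Omega>\<close> open_domain by (auto simp: mesh_edges_def frontier_def interior_open)
      have "\<Lambda> \<psi> = 0" if "\<psi> \<in> test_fun ((\<Omega> - vertices) \<inter> W)" for \<psi>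
      proof -
        have \<psi>: "\<psi> \<in> test_fun W" using that by (rule test_fun_mono) blast
        then have \<psi>': "\<psi> \<in> test_fun UNIV" by (rule test_fun_mono) simp
        have supp: "fun_support \<psi> \<subseteq> W" using \<psi> by (simp add: test_fun_def)
        let ?A = "{T' \<in> \<T>. x \<in> T'}"
        \<comment> \<open>Triangles not containing \<open>x\<close> are disjoint from
          \<open>W\<close>. All remaining ones have \<open>S\<close> as an edge, so any two of them
          are subject to the jump condition.\<close>
        have "sum (j \<psi>) \<T> = sum (j \<psi>) ?A"
        proof (rule sum.mono_neutral_right)
          show "\<forall>T\<in>\<T> - ?A. j \<psi> T = 0"
          proof
            fix T assume "T \<in> \<T> - ?A"
            then have "W \<inter> interior T = {}" using W(3)[of T] interior_subset[of T] by blast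
            then show "j \<psi> T = 0" using normal_trace_outside[OF \<psi>] by (simp add: j_def)
          qed
        qed (use finite_mesh in auto)
        also have "sum (j \<psi>) ?A = 0"
        proof (rule sum_eq_0_if_pairwise[of _ T T'])
          fix T1 T2 assume T12: "T1 \<in> ?A" "T2 \<in> ?A" "T1 \<noteq> T2"
          have "S edge_of T1" "S edge_of T2" using edge_of_neighbour[OF edge] T12 by auto
          moreover have "\<psi> \<in> edge_test_fun T1 S \<inter> edge_test_fun T2 S"
            using \<psi>' supp W(4)[of T1] W(4)[of T2] T12 by (auto simp: edge_test_fun_def)
          ultimately have "normal_jump T1 T2 \<tau> \<psi> = normal_jump T1 T2 \<sigma> \<psi>"
            using jumps[OF S] T12 unfolding normal_jumps_agree_on_def by blast
          then show "j \<psi> T1 + j \<psi> T2 = 0" by (simp add: j_def normal_jump_def)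
        qed (use finite_mesh T' edge xT in auto)
        finally show ?thesis using \<Lambda>_sum[OF \<psi>'] by simp
      qed
      then show ?thesis using W by blast
    qed (use x in simp)
  qed
  then have "\<Lambda> \<phi> = 0"
    unfolding \<Lambda>_def
    by (rule green_pairing_removable_points[OF Lp2_diff[OF L2(1,2)] Lp2_diff[OF L2(3,4)] open_domain
        finite_vertices _ \<phi>])
  then show ?thesis using \<Lambda>_diff[OF test_fun_mono[OF \<phi>]] by simp
qed

end

section \<open>The error estimate\<close>

lemma has_weak_grad_diff:
  assumes U: "open U" and u: "has_weak_grad U u g" and v: "has_weak_grad U v h"
  shows "has_weak_grad U (\<lambda>x. u x - v x) (\<lambda>x. g x - h x)"
  unfolding has_weak_grad_def
proof (intro conjI ballI)
  have l: "loc_integrable_on U u" "loc_integrable_on U g" "loc_integrable_on U v" "loc_integrable_on U h"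
    using u v by (auto simp: has_weak_grad_def)
  then show "loc_integrable_on U (\<lambda>x. u x - v x)" "loc_integrable_on U (\<lambda>x. g x - h x)"
    by (auto intro: loc_integrable_diff)
  fix \<phi> assume \<phi>: "\<phi> \<in> test_fun U"
  have "(LINT x|lebesgue_on U. (u x - v x) *\<^sub>R grad \<phi> x)
      = (LINT x|lebesgue_on U. u x *\<^sub>R grad \<phi> x) - (LINT x|lebesgue_on U. v x *\<^sub>R grad \<phi> x)"
    unfolding scaleR_diff_left
    by (intro Bochner_Integration.integral_diff loc_integrable_scaleR_grad[OF \<phi> U] l)
  also have "\<dots> = - ((LINT x|lebesgue_on U. \<phi> x *\<^sub>R g x) - (LINT x|lebesgue_on U. \<phi> x *\<^sub>R h x))"
    using u v \<phi> by (simp add: has_weak_grad_def)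
  also have "(LINT x|lebesgue_on U. \<phi> x *\<^sub>R g x) - (LINT x|lebesgue_on U. \<phi> x *\<^sub>R h x)
      = (LINT x|lebesgue_on U. \<phi> x *\<^sub>R (g x - h x))"
    unfolding scaleR_diff_right
    by (intro Bochner_Integration.integral_diff[symmetric] loc_integrable_test[OF \<phi> U] l)
  finally show "(LINT x|lebesgue_on U. (u x - v x) *\<^sub>R grad \<phi> x) = - (LINT x|lebesgue_on U. \<phi> x *\<^sub>R (g x - h x))" .
qed

text \<open>Testing the weak gradient of the i-th component of grad u and taking its i-th coordinate
  gives one summand; local integrability makes the integrals split, whatever the exponent
  \<open>p\<close>.\<close>

lemma integral_weak_laplacian:
  assumes U: "open U" and u: "W2_on p U u" and \<phi>: "\<phi> \<in> test_fun U"
  shows "(LINT x|lebesgue_on U. weak_grad U u x \<bullet> grad \<phi> x) = - (LINT x|lebesgue_on U. \<phi> x * weak_laplacian U u x)"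
proof -
  define g h where "g i y = weak_grad U u y $ i" and "h i = weak_grad U (g i)" for i y
  have wg: "has_weak_grad U (g i) (h i)" for i
    using u has_weak_grad_weak_grad unfolding W2_on_def W1_on_def h_def g_def by blast
  have l: "loc_integrable_on U (g i)" "loc_integrable_on U (h i)" for i
    using wg[of i] by (auto simp: has_weak_grad_def)
  note int = loc_integrable_scaleR_grad[OF \<phi> U l(1)] loc_integrable_test[OF \<phi> U l(2)]
  have comp: "(LINT x|lebesgue_on U. (g i x *\<^sub>R grad \<phi> x) \<bullet> axis i 1)
      = - (LINT x|lebesgue_on U. (\<phi> x *\<^sub>R h i x) \<bullet> axis i 1)" for i
  proof -
    have "(LINT x|lebesgue_on U. (g i x *\<^sub>R grad \<phi> x) \<bullet> axis i 1)
        = (LINT x|lebesgue_on U. g i x *\<^sub>R grad \<phi> x) \<bullet> axis i 1"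
      by (rule integral_inner_left) (rule int(1))
    also have "\<dots> = - ((LINT x|lebesgue_on U. \<phi> x *\<^sub>R h i x) \<bullet> axis i 1)"
      using wg[of i] \<phi> by (simp add: has_weak_grad_def)
    also have "(LINT x|lebesgue_on U. \<phi> x *\<^sub>R h i x) \<bullet> axis i 1 = (LINT x|lebesgue_on U. (\<phi> x *\<^sub>R h i x) \<bullet> axis i 1)"
      by (rule integral_inner_left[symmetric]) (rule int(2))
    finally show ?thesis .
  qed
  have "(LINT x|lebesgue_on U. weak_grad U u x \<bullet> grad \<phi> x)
      = (LINT x|lebesgue_on U. (\<Sum>i\<in>UNIV. (g i x *\<^sub>R grad \<phi> x) \<bullet> axis i 1))"
    by (intro Bochner_Integration.integral_cong refl) (simp add: inner_axis g_def inner_vec_def[of "weak_grad U u _"])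
  also have "\<dots> = (\<Sum>i\<in>UNIV. (LINT x|lebesgue_on U. (g i x *\<^sub>R grad \<phi> x) \<bullet> axis i 1))"
    by (intro Bochner_Integration.integral_sum integrable_inner_left) (rule int(1))
  also have "\<dots> = - (\<Sum>i\<in>UNIV. (LINT x|lebesgue_on U. (\<phi> x *\<^sub>R h i x) \<bullet> axis i 1))"
    by (simp only: comp sum_negf)
  also have "(\<Sum>i\<in>UNIV. (LINT x|lebesgue_on U. (\<phi> x *\<^sub>R h i x) \<bullet> axis i 1))
      = (LINT x|lebesgue_on U. (\<Sum>i\<in>UNIV. (\<phi> x *\<^sub>R h i x) \<bullet> axis i 1))"
    by (intro Bochner_Integration.integral_sum[symmetric] integrable_inner_left) (rule int(2))
  also have "\<dots> = (LINT x|lebesgue_on U. \<phi> x * weak_laplacian U u x)"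
    by (intro Bochner_Integration.integral_cong refl)
      (simp add: weak_laplacian_def inner_axis h_def g_def[abs_def] sum_distrib_left)
  finally show ?thesis .
qed

lemma Lp2_Linf:
  assumes U: "U \<in> lmeasurable" and g: "Linf_on U g"
  shows "Lp_on 2 U g"
  unfolding Lp2_iff
proof
  show m: "g \<in> borel_measurable (lebesgue_on U)" using g by (simp add: Linf_on_def)
  obtain M where M: "AE x in lebesgue_on U. norm (g x) \<le> M" using g by (auto simp: Linf_on_def)
  show "integrable (lebesgue_on U) (\<lambda>x. (norm (g x))\<^sup>2)"
  proof (rule Bochner_Integration.integrable_bound[where f="\<lambda>_. M\<^sup>2"])
    show "integrable (lebesgue_on U) (\<lambda>_. M\<^sup>2)"
      using U by (intro finite_measure.integrable_const finite_measure_lebesgue_on)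
    show "(\<lambda>x. (norm (g x))\<^sup>2) \<in> borel_measurable (lebesgue_on U)" using m by measurable
    show "AE x in lebesgue_on U. norm ((norm (g x))\<^sup>2) \<le> norm (M\<^sup>2)"
      using M by eventually_elim (simp add: power_mono)
  qed
qed

text \<open>Bounds on \<open>f\<close> are given for each fixed \<open>s\<close> separately, not
  uniformly in \<open>s\<close>. Monotonicity in \<open>s\<close> bridges the gap by squeezing the
  composite between the bounded functions at \<open>M\<close> and \<open>- M\<close>.\<close>

lemma Lp2_superposition:
  fixes f :: "plane \<Rightarrow> real \<Rightarrow> real"
  assumes U: "U \<in> lmeasurable"
    and f_cont: "continuous_on (U \<times> UNIV) (\<lambda>(x, s). f x s)"
    and f_bdd: "\<And>s. Linf_on U (\<lambda>x. f x s)"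
    and f_mono: "\<And>x s t. x \<in> U \<Longrightarrow> t \<le> s \<Longrightarrow> f x t \<le> f x s"
    and v: "continuous_on U v" "\<And>x. x \<in> U \<Longrightarrow> \<bar>v x\<bar> \<le> M"
  shows "Lp_on 2 U (\<lambda>x. f x (v x))"
proof (rule Lp2_bound)
  have "continuous_on U (\<lambda>x. (\<lambda>(x, s). f x s) (x, v x))"
    by (rule continuous_on_compose2[OF f_cont]) (auto intro: continuous_intros v)
  then show "(\<lambda>x. f x (v x)) \<in> borel_measurable (lebesgue_on U)"
    using U by (intro continuous_measurable_lebesgue_on) (auto simp: fmeasurable_def)
  show "integrable (lebesgue_on U) (\<lambda>x. (norm (f x M))\<^sup>2 + (norm (f x (- M)))\<^sup>2)"
    by (intro Bochner_Integration.integrable_add Lp2_integrable Lp2_Linf[OF U f_bdd])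
  fix x assume x: "x \<in> U"
  have "f x (- M) \<le> f x (v x)" "f x (v x) \<le> f x M"
    using v(2)[OF x] by (auto intro!: f_mono x)
  then have "\<bar>f x (v x)\<bar> \<le> \<bar>f x M\<bar> \<or> \<bar>f x (v x)\<bar> \<le> \<bar>f x (- M)\<bar>" by linarith
  then have "(f x (v x))\<^sup>2 \<le> (f x M)\<^sup>2 \<or> (f x (v x))\<^sup>2 \<le> (f x (- M))\<^sup>2"
    by (simp add: abs_le_square_iff)
  then have "(f x (v x))\<^sup>2 \<le> (f x M)\<^sup>2 + (f x (- M))\<^sup>2"
    using zero_le_power2[of "f x M"] zero_le_power2[of "f x (- M)"] by linarith
  then show "(norm (f x (v x)))\<^sup>2 \<le> (norm (f x M))\<^sup>2 + (norm (f x (- M)))\<^sup>2" by simp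
qed

text \<open>Differences of the two approximating sequences do. The limit of the gradients is kept as
  the difference of the chosen weak gradients, so that no representative for the difference has to
  be compared here.\<close>

lemma H10_diff_approx:
  assumes U: "open U" and u: "H10_on U u" and v: "H10_on U v"
  obtains \<phi> :: "nat \<Rightarrow> plane \<Rightarrow> real" where "\<And>n. \<phi> n \<in> test_fun U"
    "(\<lambda>n. L2_norm U (\<lambda>x. \<phi> n x - (u x - v x))) \<longlonglongrightarrow> 0"
    "(\<lambda>n. L2_norm U (\<lambda>x. grad (\<phi> n) x - (weak_grad U u x - weak_grad U v x))) \<longlonglongrightarrow> 0"
proof -
  obtain \<alpha> where \<alpha>: "\<And>n. \<alpha> n \<in> test_fun U" "(\<lambda>n. L2_norm U (\<lambda>x. \<alpha> n x - u x)) \<longlonglongrightarrow> 0"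
    "(\<lambda>n. L2_norm U (\<lambda>x. grad (\<alpha> n) x - weak_grad U u x)) \<longlonglongrightarrow> 0"
    using u by (auto simp: H10_on_def)
  obtain \<beta> where \<beta>: "\<And>n. \<beta> n \<in> test_fun U" "(\<lambda>n. L2_norm U (\<lambda>x. \<beta> n x - v x)) \<longlonglongrightarrow> 0"
    "(\<lambda>n. L2_norm U (\<lambda>x. grad (\<beta> n) x - weak_grad U v x)) \<longlonglongrightarrow> 0"
    using v by (auto simp: H10_on_def)
  have W: "W1_on 2 U u" "W1_on 2 U v" using u v by (auto simp: H10_on_def)
  note L2 = Lp2_test_fun[OF \<alpha>(1) subset_refl U] Lp2_test_fun[OF \<beta>(1) subset_refl U]
    Lp2_grad_test_fun[OF \<alpha>(1) subset_refl U] Lp2_grad_test_fun[OF \<beta>(1) subset_refl U]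
    Lp2_weak_grad(2)[OF U W(1)] Lp2_weak_grad(2)[OF U W(2)]
  have L2': "Lp_on 2 U u" "Lp_on 2 U v" using W by (auto simp: W1_on_def)
  show ?thesis
  proof (rule that[of "\<lambda>n x. \<alpha> n x - \<beta> n x"])
    show "(\<lambda>x. \<alpha> n x - \<beta> n x) \<in> test_fun U" for n by (intro test_fun_diff \<alpha> \<beta>)
    show "(\<lambda>n. L2_norm U (\<lambda>x. \<alpha> n x - \<beta> n x - (u x - v x))) \<longlonglongrightarrow> 0"
    proof (rule Lim_null_comparison[OF _ tendsto_add_zero[OF \<alpha>(2) \<beta>(2)]], rule always_eventually, rule allI)
      fix n
      have "(\<lambda>x. \<alpha> n x - \<beta> n x - (u x - v x)) = (\<lambda>x. (\<alpha> n x - u x) - (\<beta> n x - v x))" by auto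
      then show "norm (L2_norm U (\<lambda>x. \<alpha> n x - \<beta> n x - (u x - v x)))
          \<le> L2_norm U (\<lambda>x. \<alpha> n x - u x) + L2_norm U (\<lambda>x. \<beta> n x - v x)"
        using L2_norm_triangle_diff[OF Lp2_diff[OF L2(1)[of n] L2'(1)] Lp2_diff[OF L2(2)[of n] L2'(2)]]
        by (simp add: L2_norm_nonneg)
    qed
    show "(\<lambda>n. L2_norm U (\<lambda>x. grad (\<lambda>x. \<alpha> n x - \<beta> n x) x - (weak_grad U u x - weak_grad U v x))) \<longlonglongrightarrow> 0"
    proof (rule Lim_null_comparison[OF _ tendsto_add_zero[OF \<alpha>(3) \<beta>(3)]], rule always_eventually, rule allI)
      fix n
      have "(\<lambda>x. grad (\<lambda>x. \<alpha> n x - \<beta> n x) x - (weak_grad U u x - weak_grad U v x))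
          = (\<lambda>x. (grad (\<alpha> n) x - weak_grad U u x) - (grad (\<beta> n) x - weak_grad U v x))"
        using \<alpha>(1)[of n] \<beta>(1)[of n] by (auto simp: grad_diff test_fun_smooth)
      then show "norm (L2_norm U (\<lambda>x. grad (\<lambda>x. \<alpha> n x - \<beta> n x) x - (weak_grad U u x - weak_grad U v x)))
          \<le> L2_norm U (\<lambda>x. grad (\<alpha> n) x - weak_grad U u x) + L2_norm U (\<lambda>x. grad (\<beta> n) x - weak_grad U v x)"
        using L2_norm_triangle_diff[OF Lp2_diff[OF L2(3)[of n] L2(5)] Lp2_diff[OF L2(4)[of n] L2(6)]]
        by (simp add: L2_norm_nonneg)
    qed
  qed
qed

section \<open>Finite element functions and their gradients\<close>

context mesh
begin

text \<open>On each triangle the global weak gradient restricts to a weak gradient of an affine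
  function, hence is constant almost everywhere and has divergence 0.\<close>

lemma
  assumes v: "v \<in> fe_space \<Omega> \<T>" and T: "T \<in> \<T>"
  shows Hdiv_weak_grad_fe: "Hdiv_on (interior T) (weak_grad \<Omega> v)"
    and weak_div_weak_grad_fe: "AE x in lebesgue_on (interior T). weak_div (interior T) (weak_grad \<Omega> v) x = 0"
proof -
  let ?G = "weak_grad \<Omega> v" and ?I = "interior T"
  have "W1_on 2 \<Omega> v" using v by (simp add: fe_space_def H10_on_def)
  note G = Lp2_weak_grad[OF open_domain this]
  note sub = interior_subset_domain[OF T]
  obtain a b where ab: "\<And>x. x \<in> T \<Longrightarrow> v x = a \<bullet> x + b"
    using v T by (auto simp: fe_space_def)
  have GI: "has_weak_grad ?I v ?G" by (rule has_weak_grad_subset[OF G(1) sub open_domain open_interior])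
  have aI: "has_weak_grad ?I v (\<lambda>_. a)"
    using ab interior_subset[of T] by (intro has_weak_grad_affine[where b=b]) auto
  have L2: "Lp_on 2 ?I ?G" using Lp2_subset[OF G(2) sub] open_domain by simp
  have d0: "has_weak_div ?I ?G (\<lambda>_. 0)"
    using GI by (intro has_weak_div_AE_const[OF open_interior _ Lp2_measurable[OF L2] weak_grad_unique[OF open_interior GI aI]])
      (simp add: has_weak_grad_def)
  have "Lp_on 2 ?I (\<lambda>_. 0 :: real)" by (simp add: Lp2_iff)
  then show Hd: "Hdiv_on ?I ?G" using L2 d0 by (auto simp: Hdiv_on_def)
  show "AE x in lebesgue_on ?I. weak_div ?I ?G x = 0"
    by (rule weak_div_unique[OF open_interior Lp2_weak_div(1)[OF open_interior Hd] d0])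
qed

lemma elementwise_div_weak_grad_fe:
  assumes v: "v \<in> fe_space \<Omega> \<T>"
  shows "AE x in lebesgue_on \<Omega>. elementwise_div \<T> (weak_grad \<Omega> v) x = 0"
proof -
  have "AE x in lebesgue. \<forall>T\<in>\<T>. x \<in> interior T \<longrightarrow> weak_div (interior T) (weak_grad \<Omega> v) x = 0"
    using weak_div_weak_grad_fe[OF v] by (intro AE_finite_allI finite_mesh) (simp add: AE_restrict_space_iff)
  with AE_in_interior have "AE x in lebesgue. x \<in> \<Omega> \<longrightarrow> elementwise_div \<T> (weak_grad \<Omega> v) x = 0"
    by eventually_elim (use elementwise_div_eq in auto)
  then show ?thesis using open_domain by (simp add: AE_restrict_space_iff)
qed

text \<open>In the equality of the two pairings the elementwise divergence of the discrete gradient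
  drops out, leaving its gradient term alone.\<close>

lemma integral_weak_grad_fe:
  assumes v: "v \<in> fe_space \<Omega> \<T>"
    and \<tau>: "\<And>T. T \<in> \<T> \<Longrightarrow> Hdiv_on (interior T) \<tau>"
    and jumps: "\<And>S. S \<in> mesh_edges \<T> \<Longrightarrow> \<not> S \<subseteq> frontier \<Omega> \<Longrightarrow>
                  normal_jumps_agree_on S \<T> \<tau> (weak_grad \<Omega> v)"
    and \<phi>: "\<phi> \<in> test_fun \<Omega>"
  shows "(LINT x|lebesgue_on \<Omega>. weak_grad \<Omega> v x \<bullet> grad \<phi> x)
    = (LINT x|lebesgue_on \<Omega>. \<tau> x \<bullet> grad \<phi> x) + (LINT x|lebesgue_on \<Omega>. \<phi> x * elementwise_div \<T> \<tau> x)"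
proof -
  note Hd = Hdiv_weak_grad_fe[OF v]
  have \<phi>': "\<phi> \<in> test_fun UNIV" using \<phi> by (rule test_fun_mono) simp
  have "(LINT x|lebesgue_on \<Omega>. \<phi> x * elementwise_div \<T> (weak_grad \<Omega> v) x) = 0"
    using elementwise_div_weak_grad_fe[OF v] by (intro integral_eq_zero_AE) (auto elim: AE_mp)
  moreover have "green_pairing \<Omega> \<tau> (elementwise_div \<T> \<tau>) \<phi>
      = green_pairing \<Omega> (weak_grad \<Omega> v) (elementwise_div \<T> (weak_grad \<Omega> v)) \<phi>"
    by (rule green_pairing_eq_if_jumps_agree[OF \<tau> Hd jumps \<phi>])
  ultimately show ?thesis
    using green_pairing_split[OF Lp2_Hdiv[OF \<tau>] Lp2_elementwise_div[OF \<tau>] open_domain \<phi>']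
      green_pairing_split[OF Lp2_Hdiv[OF Hd] Lp2_elementwise_div[OF Hd] open_domain \<phi>'] by simp
qed

end

theorem theorem4p1:
  fixes \<Omega> :: "plane set" and \<T> :: "plane set set"
    and \<epsilon> C\<^sub>f :: real and f :: "plane \<Rightarrow> real \<Rightarrow> real"
    and u u\<^sub>h :: "plane \<Rightarrow> real" and \<tau> :: "plane \<Rightarrow> plane"
  assumes domain: "polygonal_domain \<Omega>"
    and mesh: "triangulation_of \<T> \<Omega>"
    and eps: "0 < \<epsilon>" "\<epsilon> \<le> 1"
    and f_cont: "continuous_on (\<Omega> \<times> UNIV) (\<lambda>(x, s). f x s)"
    and f_bdd: "\<And>s. Linf_on \<Omega> (\<lambda>x. f x s)"
    and f_mono: "\<And>x s t. x \<in> \<Omega> \<Longrightarrow> t \<le> s \<Longrightarrow> f x s - f x t \<ge> C\<^sub>f * (s - t)"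
    and C_eps: "C\<^sub>f + \<epsilon>\<^sup>2 \<ge> 1"
    and C_pos: "C\<^sub>f > 0"
    and u: "bvp_solution \<Omega> \<epsilon> f u"
    and u\<^sub>h: "u\<^sub>h \<in> fe_space \<Omega> \<T>"
    and \<tau>: "\<And>T. T \<in> \<T> \<Longrightarrow> Hdiv_on (interior T) \<tau>"
    and jumps: "\<And>S. S \<in> mesh_edges \<T> \<Longrightarrow> \<not> S \<subseteq> frontier \<Omega> \<Longrightarrow>
                  normal_jumps_agree_on S \<T> \<tau> (weak_grad \<Omega> u\<^sub>h)"
  shows "energy_norm \<epsilon> C\<^sub>f \<Omega> (\<lambda>x. u\<^sub>h x - u x) \<le>
           sqrt ((L2_norm \<Omega> (\<lambda>x. \<epsilon> *\<^sub>R \<tau> x))\<^sup>2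
             + inverse C\<^sub>f * (L2_norm \<Omega> (\<lambda>x. \<epsilon>\<^sup>2 * elementwise_div \<T> \<tau> x + f x (u\<^sub>h x)))\<^sup>2)"
proof -
  have \<Omega>: "open \<Omega>" "bounded \<Omega>" using domain by (auto simp: polygonal_domain_def)
  interpret mesh \<T> \<Omega> by unfold_locales (fact mesh \<Omega>(1))+
  have meas: "\<Omega> \<in> lmeasurable" using \<Omega> by (simp add: lmeasurable_open)
  have H: "H10_on \<Omega> u\<^sub>h" "H10_on \<Omega> u" and cont: "continuous_on (closure \<Omega>) u\<^sub>h" "continuous_on (closure \<Omega>) u"
    and pde: "AE x in lebesgue_on \<Omega>. - \<epsilon>\<^sup>2 * weak_laplacian \<Omega> u x + f x (u x) = 0"
    using u u\<^sub>h by (auto simp: bvp_solution_def fe_space_def)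
  obtain l where W2: "W2_on l \<Omega> u" using u by (auto simp: bvp_solution_def)
  have W1: "W1_on 2 \<Omega> u\<^sub>h" "W1_on 2 \<Omega> u" using H by (auto simp: H10_on_def)
  \<comment> \<open>\<open>G\<close> is the difference of the chosen representatives, since the
    approximation converges to it; it is identified with the weak gradient of \<open>w\<close> only
    at the end.\<close>
  define G w d where "G x = weak_grad \<Omega> u\<^sub>h x - weak_grad \<Omega> u x" and "w x = u\<^sub>h x - u x"
    and "d = elementwise_div \<T> \<tau>" for x
  note Gu = Lp2_weak_grad[OF \<Omega>(1) W1(2)] and Gh = Lp2_weak_grad[OF \<Omega>(1) W1(1)]
  have L2: "Lp_on 2 \<Omega> G" "Lp_on 2 \<Omega> w" "Lp_on 2 \<Omega> \<tau>" "Lp_on 2 \<Omega> d"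
  proof -
    show "Lp_on 2 \<Omega> G" unfolding G_def by (intro Lp2_diff Gu Gh)
    show "Lp_on 2 \<Omega> w" unfolding w_def using W1 by (intro Lp2_diff) (auto simp: W1_on_def)
    show "Lp_on 2 \<Omega> \<tau>" by (rule Lp2_Hdiv[OF \<tau>])
    show "Lp_on 2 \<Omega> d" unfolding d_def by (rule Lp2_elementwise_div[OF \<tau>])
  qed
  have Lf: "Lp_on 2 \<Omega> (\<lambda>x. f x (v x))" if v: "continuous_on (closure \<Omega>) v" for v
  proof -
    have "compact (closure \<Omega>)" using \<Omega>(2) by simp
    then obtain M where M: "\<And>x. x \<in> closure \<Omega> \<Longrightarrow> norm (v x) \<le> M"
      using compact_imp_bounded[OF compact_continuous_image[OF v]] unfolding bounded_iff by auto
    have "f x t \<le> f x s" if "x \<in> \<Omega>" "t \<le> s" for x s t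
      using f_mono[OF that] mult_nonneg_nonneg[of "C\<^sub>f" "s - t"] C_pos that by linarith
    then show ?thesis
      using M closure_subset[of \<Omega>] continuous_on_subset[OF v closure_subset]
      by (intro Lp2_superposition[OF meas f_cont f_bdd, where M=M]) auto
  qed
  note Lu = Lf[OF cont(2)] and Lh = Lf[OF cont(1)]
  \<comment> \<open>The equation identifies the Laplacian almost everywhere with the
    square-integrable function f(.;u) / \<epsilon>^2, which also settles its measurability against
    \<phi>.\<close>
  have weak: "\<epsilon>\<^sup>2 * (LINT x|lebesgue_on \<Omega>. weak_grad \<Omega> u x \<bullet> grad \<phi> x) = - (LINT x|lebesgue_on \<Omega>. f x (u x) * \<phi> x)"
    if \<phi>: "\<phi> \<in> test_fun \<Omega>" for \<phi>
  proof -
    have ae: "AE x in lebesgue_on \<Omega>. inverse (\<epsilon>\<^sup>2) * (f x (u x) * \<phi> x) = \<phi> x * weak_laplacian \<Omega> u x"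
      using pde by eventually_elim (use eps in \<open>simp add: field_simps\<close>)
    have "integrable (lebesgue_on \<Omega>) (\<lambda>x. inverse (\<epsilon>\<^sup>2) * (f x (u x) * \<phi> x))"
      by (intro integrable_mult_right Lp2_mult_integrable Lu Lp2_test_fun[OF \<phi> subset_refl \<Omega>(1)])
    note m = borel_measurable_integrable[OF this]
    have "(LINT x|lebesgue_on \<Omega>. \<phi> x * weak_laplacian \<Omega> u x)
        = (LINT x|lebesgue_on \<Omega>. inverse (\<epsilon>\<^sup>2) * (f x (u x) * \<phi> x))"
      by (rule integral_cong_AE[OF m borel_measurable_lebesgue_on_AE[OF _ m ae] ae, symmetric])
        (use \<Omega>(1) in simp)
    also have "\<dots> = inverse (\<epsilon>\<^sup>2) * (LINT x|lebesgue_on \<Omega>. f x (u x) * \<phi> x)" by simp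
    finally show ?thesis using integral_weak_laplacian[OF \<Omega>(1) W2 \<phi>] eps by simp
  qed
  define R where "R x = \<epsilon>\<^sup>2 * d x + f x (u x)" for x
  have L2': "Lp_on 2 \<Omega> (\<lambda>x. G x - \<tau> x)" "Lp_on 2 \<Omega> R"
    unfolding R_def by (intro Lp2_diff Lp2_add Lp2_cmult Lu L2)+
  \<comment> \<open>Both sides pair square-integrable data with the test function or its gradient,
    so the identity survives the limit and holds with \<open>w\<close> and \<open>G\<close> in place
    of \<phi> and its gradient.\<close>
  have test: "\<epsilon>\<^sup>2 * (LINT x|lebesgue_on \<Omega>. (G x - \<tau> x) \<bullet> grad \<phi> x) = (LINT x|lebesgue_on \<Omega>. R x \<bullet> \<phi> x)"
    if \<phi>: "\<phi> \<in> test_fun \<Omega>" for \<phi>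
  proof -
    note l = Lp2_test_fun[OF \<phi> subset_refl \<Omega>(1)] Lp2_grad_test_fun[OF \<phi> subset_refl \<Omega>(1)]
    have "(LINT x|lebesgue_on \<Omega>. (G x - \<tau> x) \<bullet> grad \<phi> x) = (LINT x|lebesgue_on \<Omega>. weak_grad \<Omega> u\<^sub>h x \<bullet> grad \<phi> x)
      - (LINT x|lebesgue_on \<Omega>. weak_grad \<Omega> u x \<bullet> grad \<phi> x) - (LINT x|lebesgue_on \<Omega>. \<tau> x \<bullet> grad \<phi> x)"
      using Lp2_inner_integrable[OF Gh(2) l(2)] Lp2_inner_integrable[OF Gu(2) l(2)] Lp2_inner_integrable[OF L2(3) l(2)]
      by (simp add: G_def inner_diff_left)
    also have "\<dots> = (LINT x|lebesgue_on \<Omega>. d x * \<phi> x) - (LINT x|lebesgue_on \<Omega>. weak_grad \<Omega> u x \<bullet> grad \<phi> x)"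
      using integral_weak_grad_fe[OF u\<^sub>h \<tau> jumps \<phi>] by (simp add: d_def mult.commute)
    finally have "\<epsilon>\<^sup>2 * (LINT x|lebesgue_on \<Omega>. (G x - \<tau> x) \<bullet> grad \<phi> x)
        = \<epsilon>\<^sup>2 * (LINT x|lebesgue_on \<Omega>. d x * \<phi> x) + (LINT x|lebesgue_on \<Omega>. f x (u x) * \<phi> x)"
      using weak[OF \<phi>] by (simp add: right_diff_distrib)
    also have "\<dots> = (LINT x|lebesgue_on \<Omega>. \<epsilon>\<^sup>2 * (d x * \<phi> x) + f x (u x) * \<phi> x)"
      using Lp2_mult_integrable[OF L2(4) l(1)] Lp2_mult_integrable[OF Lu l(1)] by simp
    also have "\<dots> = (LINT x|lebesgue_on \<Omega>. R x \<bullet> \<phi> x)"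
      by (intro Bochner_Integration.integral_cong refl) (simp add: R_def algebra_simps)
    finally show ?thesis .
  qed
  obtain \<phi> :: "nat \<Rightarrow> plane \<Rightarrow> real" where \<phi>: "\<And>n. \<phi> n \<in> test_fun \<Omega>"
    "(\<lambda>n. L2_norm \<Omega> (\<lambda>x. \<phi> n x - w x)) \<longlonglongrightarrow> 0" "(\<lambda>n. L2_norm \<Omega> (\<lambda>x. grad (\<phi> n) x - G x)) \<longlonglongrightarrow> 0"
    using H10_diff_approx[OF \<Omega>(1) H] unfolding w_def G_def by blast
  have "(\<lambda>n. \<epsilon>\<^sup>2 * (LINT x|lebesgue_on \<Omega>. (G x - \<tau> x) \<bullet> grad (\<phi> n) x)) \<longlonglongrightarrow> \<epsilon>\<^sup>2 * (LINT x|lebesgue_on \<Omega>. (G x - \<tau> x) \<bullet> G x)"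
    by (intro tendsto_mult_left L2_tendsto_inner L2' L2 \<phi>(3) Lp2_grad_test_fun[OF \<phi>(1) subset_refl \<Omega>(1)])
  moreover have "(\<lambda>n. LINT x|lebesgue_on \<Omega>. R x \<bullet> \<phi> n x) \<longlonglongrightarrow> (LINT x|lebesgue_on \<Omega>. R x \<bullet> w x)"
    by (intro L2_tendsto_inner L2' L2 \<phi>(2) Lp2_test_fun[OF \<phi>(1) subset_refl \<Omega>(1)])
  ultimately have error: "\<epsilon>\<^sup>2 * (LINT x|lebesgue_on \<Omega>. (G x - \<tau> x) \<bullet> G x) = (LINT x|lebesgue_on \<Omega>. R x \<bullet> w x)"
    unfolding test[OF \<phi>(1)] by (rule LIMSEQ_unique)
  \<comment> \<open>The residual of the estimate. It differs from \<open>R\<close> only by the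
    change of the nonlinear term between \<open>u\<close> and the discrete function, which is what
    monotonicity controls.\<close>
  define R' where "R' x = \<epsilon>\<^sup>2 * d x + f x (u\<^sub>h x)" for x
  have L2R: "Lp_on 2 \<Omega> R'" unfolding R'_def by (intro Lp2_add Lp2_cmult Lh L2)
  have mono: "C\<^sub>f * (w x)\<^sup>2 \<le> R' x * w x - R x * w x" if x: "x \<in> \<Omega>" for x
  proof (cases "u x \<le> u\<^sub>h x")
    case True
    then have "C\<^sub>f * w x * w x \<le> (f x (u\<^sub>h x) - f x (u x)) * w x"
      using f_mono[OF x True] by (intro mult_right_mono) (auto simp: w_def)
    then show ?thesis by (simp add: R_def R'_def power2_eq_square algebra_simps)
  next
    case False
    \<comment> \<open>Monotonicity is applied with the two arguments exchanged; multiplying by the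
      negative value of \<open>w\<close> restores the direction of the inequality.\<close>
    then have "(f x (u\<^sub>h x) - f x (u x)) * w x \<ge> C\<^sub>f * w x * w x"
      using f_mono[OF x, of "u\<^sub>h x" "u x"] by (intro mult_right_mono_neg) (auto simp: w_def algebra_simps)
    then show ?thesis by (simp add: R_def R'_def power2_eq_square algebra_simps)
  qed
  have "C\<^sub>f * (L2_norm \<Omega> w)\<^sup>2 = (LINT x|lebesgue_on \<Omega>. C\<^sub>f * (w x)\<^sup>2)"
    by (simp add: L2_norm_power2)
  also have "\<dots> \<le> (LINT x|lebesgue_on \<Omega>. R' x \<bullet> w x - R x \<bullet> w x)"
    using Lp2_integrable[OF L2(2)] Lp2_inner_integrable[OF L2R L2(2)] Lp2_inner_integrable[OF L2'(2) L2(2)] mono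
    by (intro Bochner_Integration.integral_mono) auto
  also have "\<dots> = (LINT x|lebesgue_on \<Omega>. R' x \<bullet> w x) - (LINT x|lebesgue_on \<Omega>. R x \<bullet> w x)"
    by (rule Bochner_Integration.integral_diff[OF Lp2_inner_integrable[OF L2R L2(2)] Lp2_inner_integrable[OF L2'(2) L2(2)]])
  also have "(LINT x|lebesgue_on \<Omega>. R x \<bullet> w x)
      = \<epsilon>\<^sup>2 * ((L2_norm \<Omega> G)\<^sup>2 - (LINT x|lebesgue_on \<Omega>. \<tau> x \<bullet> G x))"
    unfolding error[symmetric] L2_norm_power2 power2_norm_eq_inner inner_diff_left
    using Lp2_inner_integrable[OF L2(1) L2(1)] Lp2_inner_integrable[OF L2(3) L2(1)] by simp
  finally have "\<epsilon>\<^sup>2 * (L2_norm \<Omega> G)\<^sup>2 + C\<^sub>f * (L2_norm \<Omega> w)\<^sup>2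
      \<le> (LINT x|lebesgue_on \<Omega>. R' x \<bullet> w x) + \<epsilon>\<^sup>2 * (LINT x|lebesgue_on \<Omega>. \<tau> x \<bullet> G x)"
    by (simp add: right_diff_distrib)
  also have "\<dots> \<le> L2_norm \<Omega> R' * L2_norm \<Omega> w + \<epsilon>\<^sup>2 * (L2_norm \<Omega> \<tau> * L2_norm \<Omega> G)"
    using L2_Cauchy_Schwarz[OF L2R L2(2)] L2_Cauchy_Schwarz[OF L2(3) L2(1)]
    by (intro add_mono mult_left_mono) auto
  \<comment> \<open>Young's inequality, weighted so that exactly half of each energy term appears on
    the right. Absorbing these halves and doubling leaves constant 1 in the estimate.\<close>
  also have "\<dots> \<le> (inverse C\<^sub>f * (L2_norm \<Omega> R')\<^sup>2 + C\<^sub>f * (L2_norm \<Omega> w)\<^sup>2) / 2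
      + \<epsilon>\<^sup>2 * (((L2_norm \<Omega> \<tau>)\<^sup>2 + (L2_norm \<Omega> G)\<^sup>2) / 2)"
  proof (intro add_mono mult_left_mono)
    have "0 \<le> inverse C\<^sub>f * (L2_norm \<Omega> R' - C\<^sub>f * L2_norm \<Omega> w)\<^sup>2" using C_pos by simp
    then show "L2_norm \<Omega> R' * L2_norm \<Omega> w \<le> (inverse C\<^sub>f * (L2_norm \<Omega> R')\<^sup>2 + C\<^sub>f * (L2_norm \<Omega> w)\<^sup>2) / 2"
      using C_pos by (simp add: power2_eq_square field_simps)
    show "L2_norm \<Omega> \<tau> * L2_norm \<Omega> G \<le> ((L2_norm \<Omega> \<tau>)\<^sup>2 + (L2_norm \<Omega> G)\<^sup>2) / 2"
      using sum_squares_bound[of "L2_norm \<Omega> \<tau>" "L2_norm \<Omega> G"] by simp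
  qed simp
  finally have main: "\<epsilon>\<^sup>2 * (L2_norm \<Omega> G)\<^sup>2 + C\<^sub>f * (L2_norm \<Omega> w)\<^sup>2 \<le> \<epsilon>\<^sup>2 * (L2_norm \<Omega> \<tau>)\<^sup>2 + inverse C\<^sub>f * (L2_norm \<Omega> R')\<^sup>2"
    by (simp add: field_simps)
  \<comment> \<open>The energy norm is stated with the representative chosen for the gradient of
    \<open>w\<close>, which agrees with \<open>G\<close> only almost everywhere; uniqueness makes
    the norms equal.\<close>
  have wg: "has_weak_grad \<Omega> w G"
    unfolding w_def[abs_def] G_def[abs_def] by (rule has_weak_grad_diff[OF \<Omega>(1) Gh(1) Gu(1)])
  have G': "AE x in lebesgue_on \<Omega>. G x = weak_grad \<Omega> w x"
    by (rule weak_grad_unique[OF \<Omega>(1) wg has_weak_grad_weak_grad[OF wg]])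
  have "L2_norm \<Omega> (weak_grad \<Omega> w) = L2_norm \<Omega> G"
    using Lp2_measurable[OF L2(1)] Lp2_measurable[OF Lp2_AE[OF _ L2(1) G']] G' \<Omega>(1)
    by (intro L2_norm_cong_AE[symmetric]) auto
  moreover have "(L2_norm \<Omega> (\<lambda>x. \<epsilon> *\<^sub>R \<tau> x))\<^sup>2 = \<epsilon>\<^sup>2 * (L2_norm \<Omega> \<tau>)\<^sup>2"
    by (simp add: L2_norm_power2 power_mult_distrib)
  ultimately show ?thesis
    using main unfolding energy_norm_def w_def[abs_def] R'_def[abs_def] d_def
    by (simp only: real_sqrt_le_iff)
qed

end
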